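(* Let $\eta>0$ and let $\mathcal{T}$ be an $\eta$-CDG in $\mathbb{R}^2$. There is a subdivision $\tilde{\mathcal{T}}$ of $\mathcal{T}$ that is an $\frac{\eta}{10}$-CDG, i.e. $\tilde{\mathcal{T}}$ is a subcomplex of a Delaunay triangulation of some $\frac{\eta}{10}$-Gromov subset $\tilde S$ of $\mathbb{R}^2$. Moreover, $\tilde{\mathcal{T}}$ and $\tilde S$ can be chosen so that each edge $\tilde e$ of $\tilde{\mathcal{T}}$ that is a subedge of an edge $e$ of $\mathcal{T}$ satisfies one of the following conditions: (1) If $\tilde e$ does not contain a vertex of $e$, then $\tilde e$ is $\left(\frac{1}{100}\frac{\eta}{10}\right)$-stable (with respect to $\tilde S$). (2) If $\tilde e$ contains a vertex of $e$, then $\mathrm{length}(\tilde e)=\frac{\mathrm{length}(e)}{10}$. In particular, each triangle $\tilde\Delta$ of $\tilde{\mathcal{T}}$ that has a vertex of $\mathcal{T}$ as one of its vertices is similar to the triangle $\Delta$ of $\mathcal{T}$ with $\tilde\Delta\subset\Delta$.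
   Context: Definitions. A subset $Y$ of a metric space $X$ is $\eta$-separated if distinct points of $Y$ are at distance $\geq\eta$; it is $\eta$-Gromov if it is $\eta$-separated and not properly contained in any other $\eta$-separated subset of $X$. A triangulation of a discrete point set $P\subset\mathbb{R}^2$ is Delaunay if the circumdisk of every triangle (the disk whose boundary circle passes through its three vertices) contains no points of $P$ in its interior. A simplicial complex $\mathcal{T}$ in $\mathbb{R}^2$ is an $\eta$-CDG if it is a subcomplex of a Delaunay triangulation of an $\eta$-Gromov subset of $\mathbb{R}^2$. For $S\subset\mathbb{R}^2$, a segment between two points of $S$ is in the Delaunay graph of $S$ if it is an edge of every Delaunay triangulation of $S$. Given a discrete $S\subset\mathbb{R}^2$, $\xi>0$, and a segment $ab$ between two points $a,b\in S$, the segment $ab$ is $\xi$-stable (with respect to $S$) if for every embedding $\iota:S\to\mathbb{R}^2$ with $|\iota-\mathrm{id}_S|<\xi$ the segment $\iota(a)\iota(b)$ is in the Delaunay graph of $\iota(S)$. *)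

theory Defs
  imports "HOL-Analysis.Analysis"
begin

definition separated :: "real \<Rightarrow> 'a::metric_space set \<Rightarrow> bool" where
  "separated \<eta> Y \<longleftrightarrow> (\<forall>x\<in>Y. \<forall>y\<in>Y. x \<noteq> y \<longrightarrow> dist x y \<ge> \<eta>)"

definition gromov :: "real \<Rightarrow> 'a::metric_space set \<Rightarrow> bool" where
  "gromov \<eta> Y \<longleftrightarrow> separated \<eta> Y \<and> (\<forall>Z. separated \<eta> Z \<longrightarrow> \<not> Y \<subset> Z)"

(* The library's simplicial_complex with finiteness weakened to local finiteness in the
   underlying polyhedron. As there, the empty set counts as a face of every simplex. *)
definition lf_simplicial_complex :: "'a::euclidean_space set set \<Rightarrow> bool" where
  "lf_simplicial_complex K \<longleftrightarrow>
     locally_finite_in (top_of_set (\<Union>K)) K \<and>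
     (\<forall>S\<in>K. \<exists>n. n simplex S) \<and>
     (\<forall>F S. S \<in> K \<and> F face_of S \<longrightarrow> F \<in> K) \<and>
     (\<forall>S S'. S \<in> K \<and> S' \<in> K \<longrightarrow> (S \<inter> S') face_of S)"

definition vertices :: "'a::euclidean_space set set \<Rightarrow> 'a set" where
  "vertices K = {v. {v} \<in> K}"

definition edges :: "'a::euclidean_space set set \<Rightarrow> 'a set set" where
  "edges K = {e\<in>K. 1 simplex e}"

definition triangles :: "'a::euclidean_space set set \<Rightarrow> 'a set set" where
  "triangles K = {\<Delta>\<in>K. 2 simplex \<Delta>}"

definition subcomplex :: "'a::euclidean_space set set \<Rightarrow> 'a set set \<Rightarrow> bool" where
  "subcomplex T K \<longleftrightarrow> lf_simplicial_complex T \<and> T \<subseteq> K"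

definition subdivision :: "'a::euclidean_space set set \<Rightarrow> 'a set set \<Rightarrow> bool" where
  "subdivision T' T \<longleftrightarrow>
     lf_simplicial_complex T' \<and>
     (\<forall>S'\<in>T'. \<exists>S\<in>T. S' \<subseteq> S) \<and>
     (\<forall>S\<in>T. \<exists>F. finite F \<and> F \<subseteq> T' \<and> S = \<Union>F)"

definition triangulation_of :: "'a::euclidean_space set \<Rightarrow> 'a set set \<Rightarrow> bool" where
  "triangulation_of P K \<longleftrightarrow>
     discrete P \<and> lf_simplicial_complex K \<and> vertices K = P \<and> \<Union>K = convex hull P"

(* The quantifier over z and r picks out exactly the circumscribed circle of each triangle. *)
definition delaunay_triangulation :: "(real^2) set \<Rightarrow> (real^2) set set \<Rightarrow> bool" where
  "delaunay_triangulation P K \<longleftrightarrow>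
     triangulation_of P K \<and>
     (\<forall>\<Delta>\<in>triangles K. \<forall>z r.
        {v. v extreme_point_of \<Delta>} \<subseteq> sphere z r \<longrightarrow> interior (cball z r) \<inter> P = {})"

definition cdg_in :: "real \<Rightarrow> (real^2) set \<Rightarrow> (real^2) set set \<Rightarrow> bool" where
  "cdg_in \<eta> S T \<longleftrightarrow>
     gromov \<eta> S \<and> (\<exists>K. delaunay_triangulation S K \<and> subcomplex T K)"

definition cdg :: "real \<Rightarrow> (real^2) set set \<Rightarrow> bool" where
  "cdg \<eta> T \<longleftrightarrow> (\<exists>S. cdg_in \<eta> S T)"

definition in_delaunay_graph :: "(real^2) set \<Rightarrow> real^2 \<Rightarrow> real^2 \<Rightarrow> bool" where
  "in_delaunay_graph S a b \<longleftrightarrow>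
     a \<in> S \<and> b \<in> S \<and> (\<forall>K. delaunay_triangulation S K \<longrightarrow> closed_segment a b \<in> edges K)"

definition stable_segment :: "real \<Rightarrow> (real^2) set \<Rightarrow> real^2 \<Rightarrow> real^2 \<Rightarrow> bool" where
  "stable_segment \<xi> S a b \<longleftrightarrow>
     discrete S \<and> a \<in> S \<and> b \<in> S \<and>
     (\<forall>\<iota>. embedding_map (top_of_set S) euclidean \<iota> \<and> (\<forall>x\<in>S. norm (\<iota> x - x) < \<xi>) \<longrightarrow>
        in_delaunay_graph (\<iota> ` S) (\<iota> a) (\<iota> b))"

definition similar :: "'a::metric_space set \<Rightarrow> 'a set \<Rightarrow> bool" where
  "similar A B \<longleftrightarrow> (\<exists>k>0. \<exists>f. (\<forall>x y. dist (f x) (f y) = k * dist x y) \<and> f ` A = B)"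

end

theory Submission
  imports Defs
begin

text \<open>
  A Delaunay triangle of an \<open>\<eta>\<close>-Gromov set has circumradius below \<open>\<eta>\<close> and sides at least \<open>\<eta>\<close>, so the
  sines of its angles are at least 1/2. Let \<open>\<delta> = \<eta> / 10\<close> and cut every edge at 1/10 and 9/10 of its length
  and in between into equal pieces of length between \<open>1.1 \<delta>\<close> and \<open>1.26 \<delta>\<close>. In a \<open>\<delta>\<close>-separated set the diametral
  disc of such a piece contains no further point, even after a small perturbation, so the piece is a stable
  Delaunay edge. At a vertex \<open>v\<close> the corners of the triangles are homothetic copies of the triangles, and their
  circumscribed discs are empty in any \<open>\<delta>\<close>-separated set containing the cut points, once one extra point is
  added beyond every corner whose angle is large. All these points together are \<open>\<delta>\<close>-separated, hence contained in
  a \<open>\<delta>\<close>-Gromov set \<open>P\<close>. The Delaunay cells of \<open>P\<close> with more than three vertices are triangulated as fans, with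
  apex \<open>v\<close> if they contain an old vertex \<open>v\<close>, which makes the corners triangles of the complex.
  Throughout, simplices and cells are separated by the difference of the powers of a point with respect
  to two circles, which is an affine function.
\<close>

section \<open>Affine functionals on convex hulls\<close>

text \<open>The obstacle is the corner at an old vertex \<open>v\<close>. The circumscribed disc of
  a triangle \<open>v a b\<close>, shrunk by 1/10 about \<open>v\<close>, has radius below \<delta>,
  so a further point of a \<delta>-separated set inside it must avoid the \<delta>-discs about
  \<open>v\<close> and the two cut points. In the sector of the corner this is possible only in the
  cap beyond the cut points, and only if the angle at \<open>v\<close> exceeds 60 degrees. As the
  other two angles exceed 30 degrees, the angle at \<open>v\<close> is below 120 degrees, and a
  single extra point near the midpoint of the arc suffices. The rest of the disc lies in sectors of
  other triangles at \<open>v\<close>: there, a point of the disc also lies in the shrunk disc of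
  the triangle owning the sector, which reduces the claim to its own sector. Separation is a local
  question: two prescribed points closer than \<delta> have a midpoint within
  \<open>\<delta> / 2\<close> of both, and altitude estimates then put both into one old triangle.
  The end pieces of an edge can be too long for the diametral disc argument; they become edges
  because the corner triangles are triangles of the complex.\<close>

lemma convex_hull_zero_face:
  fixes A :: "'a::real_inner set"
  assumes "finite A" and nonneg: "\<And>a. a \<in> A \<Longrightarrow> 0 \<le> u \<bullet> a + c"
    and x: "x \<in> convex hull A" and "u \<bullet> x + c \<le> 0"
  shows "x \<in> convex hull {a \<in> A. u \<bullet> a + c = 0}"
proof -
  let ?B = "{a \<in> A. u \<bullet> a + c = 0}"
  obtain w where w: "\<And>a. a \<in> A \<Longrightarrow> 0 \<le> w a" "sum w A = 1" "(\<Sum>a\<in>A. w a *\<^sub>R a) = x"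
    using x convex_hull_finite[OF \<open>finite A\<close>] by auto
  have "(\<Sum>a\<in>A. w a * (u \<bullet> a + c)) = u \<bullet> x + c"
    by (simp add: w(2) w(3)[symmetric] inner_sum_right distrib_left sum.distrib
        flip: sum_distrib_right)
  moreover have "\<And>a. a \<in> A \<Longrightarrow> 0 \<le> w a * (u \<bullet> a + c)"
    using w(1) nonneg by simp
  \<comment> \<open>Nonnegative terms with a sum at most zero all vanish, so the weights are
    concentrated on the zero set of the functional.\<close>
  ultimately have "\<forall>a\<in>A. w a * (u \<bullet> a + c) = 0"
    using assms(4) sum_nonneg_eq_0_iff[OF \<open>finite A\<close>, of "\<lambda>a. w a * (u \<bullet> a + c)"]
      sum_nonneg[of A "\<lambda>a. w a * (u \<bullet> a + c)"] by auto
  then have z: "\<And>a. a \<in> A - ?B \<Longrightarrow> w a = 0" by auto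
  have "sum w ?B = 1"
    using w(2) sum.mono_neutral_left[of A ?B w] z \<open>finite A\<close> by auto
  moreover have "(\<Sum>a\<in>?B. w a *\<^sub>R a) = x"
    using w(3) sum.mono_neutral_left[of A ?B "\<lambda>a. w a *\<^sub>R a"] z \<open>finite A\<close> by auto
  ultimately show ?thesis
    using w(1) convex_hull_finite[of ?B] \<open>finite A\<close> by auto
qed

lemma convex_hull_functional_nonneg:
  fixes A :: "'a::real_inner set"
  assumes "\<And>a. a \<in> A \<Longrightarrow> 0 \<le> u \<bullet> a + c" and "x \<in> convex hull A"
  shows "0 \<le> u \<bullet> x + c"
proof -
  have "convex hull A \<subseteq> {x. u \<bullet> x \<ge> - c}"
    by (rule hull_minimal) (use assms(1) in \<open>force simp: convex_halfspace_ge\<close>)+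
  then show ?thesis using assms(2) by auto
qed

text \<open>Weak separation forces the functional to vanish at a common point of the hulls, so that
  point lies in the contact face on either side. Fan triangles and forced edges are both treated
  this way.\<close>

lemma convex_hull_separated_faces:
  fixes A B :: "'a::real_inner set"
  assumes "finite A" "finite B"
    and A: "\<And>a. a \<in> A \<Longrightarrow> u \<bullet> a + c \<le> 0" and B: "\<And>b. b \<in> B \<Longrightarrow> 0 \<le> u \<bullet> b + c"
    and x: "x \<in> convex hull A" "x \<in> convex hull B"
  shows "x \<in> convex hull {a \<in> A. u \<bullet> a + c = 0}" "x \<in> convex hull {b \<in> B. u \<bullet> b + c = 0}"
proof -
  have 1: "0 \<le> u \<bullet> x + c" by (rule convex_hull_functional_nonneg[OF B x(2)])
  have 2: "0 \<le> (-u) \<bullet> x + (-c)"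
    by (rule convex_hull_functional_nonneg[OF _ x(1)]) (use A in force)
  show "x \<in> convex hull {b \<in> B. u \<bullet> b + c = 0}"
    by (rule convex_hull_zero_face) (use assms 2 in auto)
  have "x \<in> convex hull {a \<in> A. (-u) \<bullet> a + (-c) = 0}"
    by (rule convex_hull_zero_face) (use A assms 1 in force)+
  moreover have "{a \<in> A. (-u) \<bullet> a + (-c) = 0} = {a \<in> A. u \<bullet> a + c = 0}" by auto
  ultimately show "x \<in> convex hull {a \<in> A. u \<bullet> a + c = 0}" by simp
qed

lemma convex_hull_Int_affine_independent:
  fixes V :: "'a::euclidean_space set"
  assumes "\<not> affine_dependent V" "A \<subseteq> V" "B \<subseteq> V"
  shows "convex hull A \<inter> convex hull B = convex hull (A \<inter> B)"
  by (metis Un_least affine_dependent_subset assms convex_hull_Int)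

section \<open>Power of a point\<close>

definition disc_power :: "'a::real_inner \<Rightarrow> real \<Rightarrow> 'a \<Rightarrow> real" where
  "disc_power z r x = (dist z x)\<^sup>2 - r\<^sup>2"

text \<open>The quadratic terms cancel; for distinct centres the zero set of the remaining affine
  function is the radical axis of the two circles.\<close>

lemma disc_power_diff:
  "disc_power z r x - disc_power w s x = (2 *\<^sub>R (w - z)) \<bullet> x + (z \<bullet> z - w \<bullet> w - r\<^sup>2 + s\<^sup>2)"
  unfolding disc_power_def dist_norm power2_norm_eq_inner
  by (simp add: inner_diff_left inner_diff_right inner_commute algebra_simps)

lemma disc_power_sphere: "x \<in> sphere z r \<Longrightarrow> disc_power z r x = 0"
  by (simp add: disc_power_def)

lemma disc_power_neg_iff: "0 \<le> r \<Longrightarrow> disc_power z r x < 0 \<longleftrightarrow> x \<in> ball z r"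
  by (simp add: disc_power_def abs_le_square_iff[of r, symmetric] flip: not_le)

lemma disc_power_zero_iff: "0 \<le> r \<Longrightarrow> disc_power z r x = 0 \<longleftrightarrow> x \<in> sphere z r"
  by (auto simp: disc_power_def)

text \<open>Strict convexity of the ball: were the points collinear, the middle one would be
  strictly closer to the centre than the outer ones.\<close>

lemma sphere_affine_independent:
  fixes a b c :: "'a::euclidean_space"
  assumes "a \<in> sphere z r" "b \<in> sphere z r" "c \<in> sphere z r" "a \<noteq> b" "a \<noteq> c" "b \<noteq> c"
  shows "\<not> affine_dependent {a, b, c}"
proof
  have *: "z \<notin> closed_segment x y"
    if "x \<in> sphere w r" "y \<in> sphere w r" "z \<in> sphere w r" "z \<noteq> x" "z \<noteq> y" for x y z w :: 'a
    using dist_decreases_open_segment[of z x y w] that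
    by (auto simp: open_segment_def)
  assume "affine_dependent {a, b, c}"
  then have "collinear {a, b, c}" using collinear_3_eq_affine_dependent by blast
  then have "a \<in> closed_segment b c \<or> b \<in> closed_segment c a \<or> c \<in> closed_segment a b"
    using collinear_between_cases between_mem_segment by metis
  then show False using *[of b z c a] *[of c z a b] *[of a z b c] assms by auto
qed

text \<open>Points of the sphere are extreme in the ball, hence extreme in the hull, and extreme
  points of a hull belong to the generating set.\<close>

lemma convex_hull_Int_sphere:
  fixes A :: "'a::euclidean_space set"
  assumes "finite A" "A \<subseteq> sphere z r"
  shows "convex hull A \<inter> sphere z r = A"
proof
  show "convex hull A \<inter> sphere z r \<subseteq> A"
  proof
    fix x assume x: "x \<in> convex hull A \<inter> sphere z r"
    have "x extreme_point_of (convex hull A)"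
      unfolding extreme_point_of_def
    proof (intro conjI ballI notI)
      show "x \<in> convex hull A" using x by simp
      fix a b assume ab: "a \<in> convex hull A" "b \<in> convex hull A" "x \<in> open_segment a b"
      have "convex hull A \<subseteq> cball z r"
        by (rule hull_minimal) (use assms in auto)
      then have "dist z a \<le> r" "dist z b \<le> r" using ab by auto
      then show False
        using dist_decreases_open_segment[OF ab(3), of z] x by auto
    qed
    then show "x \<in> A" by (rule extreme_point_of_convex_hull)
  qed
  show "A \<subseteq> convex hull A \<inter> sphere z r" using assms hull_subset[of A] by auto
qed

section \<open>Separated and maximal separated sets\<close>

lemma separated_finite_Int_cball:
  fixes P :: "'a::euclidean_space set"
  assumes "separated \<delta> P" "\<delta> > 0"
  shows "finite (P \<inter> cball x R)"
proof -
  have "\<not> z islimpt P" for z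
    by (rule discrete_imp_not_islimpt[OF \<open>\<delta> > 0\<close>])
      (use assms(1) in \<open>fastforce simp: separated_def\<close>)
  then show ?thesis
    using finite_not_islimpt_in_compact[of "cball x R" P] by (simp add: Int_commute)
qed

lemma separated_finite_bounded:
  fixes P :: "'a::euclidean_space set"
  assumes "separated \<delta> P" "\<delta> > 0" "bounded B"
  shows "finite (P \<inter> B)"
proof -
  obtain x R where "B \<subseteq> cball x R" using \<open>bounded B\<close> bounded_subset_cball by metis
  then show ?thesis
    by (intro finite_subset[OF _ separated_finite_Int_cball[OF assms(1,2), of x R]]) auto
qed

lemma separated_discrete:
  assumes "separated \<delta> P" "\<delta> > 0"
  shows "discrete P"
  unfolding discrete_def isolated_in_def
proof (intro ballI conjI)
  fix x assume x: "x \<in> P"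
  have "ball x \<delta> \<inter> P = {x}"
    using assms x unfolding separated_def by force
  then show "\<exists>T. open T \<and> T \<inter> P = {x}" by blast
qed auto

lemma separated_closed:
  fixes P :: "'a::euclidean_space set"
  assumes "separated \<delta> P" "\<delta> > 0"
  shows "closed P"
  using assms discrete_imp_closed[of \<delta> P] unfolding separated_def
  by (metis dist_commute linorder_not_less)

lemma separated_countable:
  fixes P :: "'a::euclidean_space set"
  assumes "separated \<delta> P" "\<delta> > 0"
  shows "countable P"
proof -
  have "P = (\<Union>n::nat. P \<inter> cball 0 (real n))"
    using real_arch_simple by auto
  moreover have "countable (\<Union>n::nat. P \<inter> cball 0 (real n))"
    by (intro countable_UN) (auto intro: countable_finite separated_finite_Int_cball[OF assms])
  ultimately show ?thesis by simp
qed

lemma gromov_dense: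
  fixes P :: "'a::euclidean_space set"
  assumes "gromov \<delta> P" "\<delta> > 0"
  obtains p where "p \<in> P" "dist x p < \<delta>"
proof (cases "x \<in> P")
  case True then show ?thesis using that assms by force
next
  case False
  then have "P \<subset> insert x P" by auto
  then have "\<not> separated \<delta> (insert x P)" "separated \<delta> P" using assms unfolding gromov_def by auto
  then obtain p where "p \<in> P" "dist x p < \<delta>"
    unfolding separated_def by (metis dist_commute insert_iff linorder_not_less)
  then show ?thesis using that by blast
qed

lemma gromov_extension:
  assumes "separated \<delta> Y"
  obtains P where "gromov \<delta> P" "Y \<subseteq> P"
proof -
  let ?A = "{Z. separated \<delta> Z \<and> Y \<subseteq> Z}"
  have "\<exists>M\<in>?A. \<forall>X\<in>?A. M \<subseteq> X \<longrightarrow> X = M"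
  proof (rule subset_Zorn_nonempty)
    show "?A \<noteq> {}" using assms by auto
    fix \<C> assume C: "\<C> \<noteq> {}" "subset.chain ?A \<C>"
    have "separated \<delta> (\<Union>\<C>)"
      unfolding separated_def
    proof (intro ballI impI)
      fix x y assume "x \<in> \<Union>\<C>" "y \<in> \<Union>\<C>" "x \<noteq> y"
      then obtain X1 X2 where X: "X1 \<in> \<C>" "x \<in> X1" "X2 \<in> \<C>" "y \<in> X2" by auto
      then have "X1 \<subseteq> X2 \<or> X2 \<subseteq> X1" using C(2) unfolding subset_chain_def by auto
      then obtain X where "X \<in> \<C>" "x \<in> X" "y \<in> X" using X by auto
      moreover have "separated \<delta> X" using C(2) \<open>X \<in> \<C>\<close> unfolding subset_chain_def by auto
      ultimately show "\<delta> \<le> dist x y" using \<open>x \<noteq> y\<close> unfolding separated_def by auto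
    qed
    moreover have "Y \<subseteq> \<Union>\<C>" using C unfolding subset_chain_def by blast
    ultimately show "\<Union>\<C> \<in> ?A" by simp
  qed
  then obtain P where P: "separated \<delta> P" "Y \<subseteq> P" and
      max: "\<forall>X. separated \<delta> X \<and> Y \<subseteq> X \<longrightarrow> P \<subseteq> X \<longrightarrow> X = P"
    by auto
  have "\<not> P \<subset> Z" if "separated \<delta> Z" for Z
    using max that P(2) by auto
  then show ?thesis using that P unfolding gromov_def by auto
qed

text \<open>If \<open>x\<close> were outside the hull, the point at distance
  \<open>\<bar>R\<bar> + 1\<close> behind a hyperplane separating \<open>x\<close> from the hull
  would be farther than \<open>R\<close> from all of \<open>P\<close>.\<close>

lemma convex_hull_coarsely_dense:
  fixes P :: "'a::euclidean_space set"
  assumes "\<And>x. \<exists>p\<in>P. dist x p \<le> R"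
  shows "convex hull P = UNIV"
proof (rule ccontr)
  assume "convex hull P \<noteq> UNIV"
  then obtain x where x: "x \<notin> convex hull P" by auto
  obtain a where a: "a \<noteq> 0" "\<And>y. y \<in> convex hull P \<Longrightarrow> 0 \<le> a \<bullet> (y - x)"
  proof -
    have "convex ((\<lambda>y. y - x) ` (convex hull P))" "0 \<notin> (\<lambda>y. y - x) ` (convex hull P)"
      using x by (auto intro: convex_translation_subtract)
    then obtain a where "a \<noteq> 0" "\<forall>y\<in>(\<lambda>y. y - x) ` (convex hull P). 0 \<le> a \<bullet> y"
      using separating_hyperplane_set_0 by blast
    then show ?thesis using that by auto
  qed
  obtain p where p: "p \<in> P" "dist (x - ((\<bar>R\<bar> + 1) / norm a) *\<^sub>R a) p \<le> R" using assms by blast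
  define y where "y = x - ((\<bar>R\<bar> + 1) / norm a) *\<^sub>R a"
  have "a \<bullet> (p - x) = a \<bullet> (p - y) - (\<bar>R\<bar> + 1) * norm a"
    using a(1) by (simp add: y_def algebra_simps dot_square_norm power2_eq_square add_divide_distrib)
  also have "\<dots> \<le> norm a * R - (\<bar>R\<bar> + 1) * norm a"
  proof -
    have "a \<bullet> (p - y) \<le> norm a * norm (p - y)" by (rule norm_cauchy_schwarz)
    also have "\<dots> \<le> norm a * R"
      using p(2) by (intro mult_left_mono) (auto simp: y_def dist_norm norm_minus_commute)
    finally show ?thesis by simp
  qed
  also have "\<dots> = norm a * (R - (\<bar>R\<bar> + 1))" by (simp add: algebra_simps)
  also have "\<dots> < 0" using a(1) by (intro mult_pos_neg) auto
  finally show False using a(2)[of p] p(1) hull_subset[of P convex] by auto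
qed

lemma gromov_convex_hull:
  fixes P :: "'a::euclidean_space set"
  assumes "gromov \<delta> P" "\<delta> > 0"
  shows "convex hull P = UNIV"
proof (rule convex_hull_coarsely_dense)
  show "\<exists>p\<in>P. dist x p \<le> \<delta>" for x
    using gromov_dense[OF assms, of x] less_imp_le by metis
qed

section \<open>Locally finite simplicial complexes covering the plane\<close>

lemma convex_hull_affine_independent_inject:
  fixes A B :: "'a::euclidean_space set"
  assumes "\<not> affine_dependent A" "\<not> affine_dependent B" "convex hull A = convex hull B"
  shows "A = B"
  using extreme_point_of_convex_hull_affine_independent[OF assms(1)]
    extreme_point_of_convex_hull_affine_independent[OF assms(2)] assms(3) by auto

lemma lf_simplex:
  assumes "lf_simplicial_complex K" "\<sigma> \<in> K"
  shows "\<exists>n. n simplex \<sigma>" "compact \<sigma>" "closed \<sigma>" "convex \<sigma>"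
  using assms compact_simplex closed_simplex convex_simplex
  unfolding lf_simplicial_complex_def by metis+

lemma lf_face:
  assumes "lf_simplicial_complex K" "\<sigma> \<in> K" "\<tau> face_of \<sigma>"
  shows "\<tau> \<in> K"
  using assms unfolding lf_simplicial_complex_def by metis

lemma lf_Int_face:
  assumes "lf_simplicial_complex K" "\<sigma> \<in> K" "\<tau> \<in> K"
  shows "\<sigma> \<inter> \<tau> face_of \<sigma>" "\<sigma> \<inter> \<tau> face_of \<tau>"
proof -
  show "\<sigma> \<inter> \<tau> face_of \<sigma>" using assms unfolding lf_simplicial_complex_def by metis
  have "\<tau> \<inter> \<sigma> face_of \<tau>" using assms unfolding lf_simplicial_complex_def by metis
  then show "\<sigma> \<inter> \<tau> face_of \<tau>" by (simp add: Int_commute)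
qed

text \<open>The common face contains a relative interior point of \<open>\<sigma>\<close>, and the
  only face of \<open>\<sigma>\<close> with this property is \<open>\<sigma>\<close> itself.\<close>

lemma lf_rel_interior_face:
  assumes "lf_simplicial_complex K" "\<sigma> \<in> K" "\<tau> \<in> K" "x \<in> rel_interior \<sigma>" "x \<in> \<tau>"
  shows "\<sigma> face_of \<tau>"
proof -
  have "x \<in> \<sigma>" using assms(4) rel_interior_subset by auto
  then have "\<sigma> \<inter> \<tau> = \<sigma>"
    using face_of_disjoint_rel_interior[OF lf_Int_face(1)[OF assms(1-3)]] assms(4,5) by auto
  then show ?thesis using lf_Int_face(2)[OF assms(1-3)] by simp
qed

context
  fixes K :: "(real^2) set set"
  assumes lf: "lf_simplicial_complex K" and cover: "\<Union>K = UNIV"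
begin

lemma lf_finite_nbhd: "\<exists>e>0. finite {\<sigma> \<in> K. \<sigma> \<inter> ball x e \<noteq> {}}"
proof -
  have "locally_finite_in euclidean K"
    using lf cover unfolding lf_simplicial_complex_def by simp
  then obtain V where "open V" "x \<in> V" and V: "finite {\<sigma> \<in> K. \<sigma> \<inter> V \<noteq> {}}"
    unfolding locally_finite_in_def by auto
  then obtain e where "e > 0" "ball x e \<subseteq> V" by (auto simp: open_contains_ball)
  then show ?thesis
    using finite_subset[OF _ V, of "{\<sigma> \<in> K. \<sigma> \<inter> ball x e \<noteq> {}}"] by blast
qed

text \<open>Only finitely many simplices come near \<open>x\<close>, and those among them that miss
  \<open>x\<close> have a closed union.\<close>

lemma lf_star_nbhd: "\<exists>e>0. \<forall>\<sigma>\<in>K. \<sigma> \<inter> ball x e \<noteq> {} \<longrightarrow> x \<in> \<sigma>"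
proof -
  obtain e where e: "e > 0" "finite {\<sigma> \<in> K. \<sigma> \<inter> ball x e \<noteq> {}}" using lf_finite_nbhd by auto
  define G where "G = {\<sigma> \<in> K. \<sigma> \<inter> ball x e \<noteq> {} \<and> x \<notin> \<sigma>}"
  have "finite G" unfolding G_def by (rule finite_subset[OF _ e(2)]) auto
  then have "closed (\<Union>G)" using lf_simplex(3)[OF lf] by (auto simp: G_def)
  moreover have "x \<in> - \<Union>G" by (auto simp: G_def)
  ultimately obtain d where d: "d > 0" "ball x d \<subseteq> - \<Union>G"
    using open_contains_ball[of "- \<Union>G"] open_Compl by metis
  have "x \<in> \<sigma>" if "\<sigma> \<in> K" "\<sigma> \<inter> ball x (min d e) \<noteq> {}" for \<sigma>
  proof (rule ccontr)
    assume "x \<notin> \<sigma>"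
    then have "\<sigma> \<in> G" using that by (auto simp: G_def)
    then show False using d(2) that(2) by auto
  qed
  then show ?thesis using d(1) e(1) by (intro exI[of _ "min d e"]) auto
qed

lemma lf_closed_Union:
  assumes "A \<subseteq> K" shows "closed (\<Union>A)"
proof -
  have "\<exists>e>0. ball x e \<subseteq> - \<Union>A" if "x \<in> - \<Union>A" for x
  proof -
    obtain e where e: "e > 0" "\<And>\<sigma>. \<sigma> \<in> K \<Longrightarrow> \<sigma> \<inter> ball x e \<noteq> {} \<Longrightarrow> x \<in> \<sigma>"
      using lf_star_nbhd by metis
    have "ball x e \<subseteq> - \<Union>A" using e(2) that assms by blast
    then show ?thesis using e(1) by auto
  qed
  then have "open (- \<Union>A)" using open_contains_ball by blast
  then show ?thesis by (simp add: closed_def)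
qed

lemma lf_finite_compact:
  assumes "compact C" shows "finite {\<sigma> \<in> K. \<sigma> \<inter> C \<noteq> {}}"
proof -
  have "\<forall>x. \<exists>e. e > 0 \<and> finite {\<sigma> \<in> K. \<sigma> \<inter> ball x e \<noteq> {}}" using lf_finite_nbhd by simp
  from choice[OF this] obtain e
    where e: "\<And>x. e x > 0" "\<And>x. finite {\<sigma> \<in> K. \<sigma> \<inter> ball x (e x) \<noteq> {}}" by auto
  have "C \<subseteq> (\<Union>x\<in>C. ball x (e x))" using e(1) by auto
  then obtain D where D: "finite D" "C \<subseteq> (\<Union>x\<in>D. ball x (e x))"
    using compactE_image[OF assms, of C "\<lambda>x. ball x (e x)"] open_ball by metis
  have "{\<sigma> \<in> K. \<sigma> \<inter> C \<noteq> {}} \<subseteq> (\<Union>x\<in>D. {\<sigma> \<in> K. \<sigma> \<inter> ball x (e x) \<noteq> {}})"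
    using D(2) by fastforce
  moreover have "finite (\<Union>x\<in>D. {\<sigma> \<in> K. \<sigma> \<inter> ball x (e x) \<noteq> {}})" using e(2) D(1) by blast
  ultimately show ?thesis by (rule finite_subset)
qed

text \<open>By local finiteness, a ball free of triangles would be covered by finitely many
  simplices of lower dimension, which are null sets.\<close>

lemma triangles_cover: "\<exists>\<Delta>\<in>triangles K. x \<in> \<Delta>"
proof (rule ccontr)
  assume "\<not> ?thesis"
  then have x: "x \<in> - \<Union>(triangles K)" by auto
  have "open (- \<Union>(triangles K))"
    using lf_closed_Union[of "triangles K"] by (auto simp: triangles_def)
  then obtain d where d: "d > 0" "ball x d \<subseteq> - \<Union>(triangles K)"
    using x open_contains_ball by blast
  obtain e where e: "e > 0" "finite {\<sigma> \<in> K. \<sigma> \<inter> ball x e \<noteq> {}}" using lf_finite_nbhd by auto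
  define F where "F = {\<sigma> \<in> K. \<sigma> \<inter> ball x e \<noteq> {}} - triangles K"
  have "negligible (\<Union>F)"
  proof (rule negligible_Union)
    show "finite F" using e(2) by (simp add: F_def)
    fix \<sigma> assume \<sigma>: "\<sigma> \<in> F"
    then obtain n where n: "n simplex \<sigma>" using lf_simplex(1)[OF lf] by (auto simp: F_def)
    then have "aff_dim \<sigma> = n" by (rule aff_dim_simplex)
    moreover have "n \<noteq> 2" using \<sigma> n by (auto simp: F_def triangles_def)
    moreover have "aff_dim \<sigma> \<le> 2" using aff_dim_le_DIM[of \<sigma>] by simp
    ultimately have "aff_dim \<sigma> < int DIM(real^2)" by simp
    then have "interior \<sigma> = {}" using aff_dim_nonempty_interior[of \<sigma>] by linarith
    then show "negligible \<sigma>"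
      using lf_simplex(4)[OF lf] \<sigma> by (auto simp: F_def negligible_convex_interior)
  qed
  moreover have "ball x (min d e) \<subseteq> \<Union>F"
  proof
    fix y assume y: "y \<in> ball x (min d e)"
    obtain \<sigma> where "\<sigma> \<in> K" "y \<in> \<sigma>" using cover by blast
    then have "\<sigma> \<in> F" using y d(2) by (auto simp: F_def)
    then show "y \<in> \<Union>F" using \<open>y \<in> \<sigma>\<close> by auto
  qed
  ultimately have "negligible (ball x (min d e))" using negligible_subset by blast
  then show False using open_not_negligible[of "ball x (min d e)"] d(1) e(1) by auto
qed

lemma face_of_triangle_exists:
  assumes "\<sigma> \<in> K" "\<sigma> \<noteq> {}"
  shows "\<exists>\<Delta>\<in>triangles K. \<sigma> face_of \<Delta>"
proof -
  obtain x where "x \<in> rel_interior \<sigma>"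
    using assms lf_simplex(4)[OF lf] rel_interior_eq_empty by auto
  moreover obtain \<Delta> where "\<Delta> \<in> triangles K" "x \<in> \<Delta>" using triangles_cover by auto
  ultimately show ?thesis
    using lf_rel_interior_face[OF lf assms(1), of \<Delta> x] by (auto simp: triangles_def)
qed

end

text \<open>An ordered triple of vertices, so that a corner can be singled out. Independence of the
  set \<open>{a, b, c}\<close> does not exclude coincidences, hence the three inequalities.\<close>

definition tri :: "(real^2) set set \<Rightarrow> real^2 \<Rightarrow> real^2 \<Rightarrow> real^2 \<Rightarrow> bool" where
  "tri K a b c \<longleftrightarrow> \<not> affine_dependent {a, b, c} \<and> a \<noteq> b \<and> a \<noteq> c \<and> b \<noteq> c \<and> convex hull {a, b, c} \<in> K"

lemma tri_perm:
  assumes "tri K a b c"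
  shows "tri K b a c" "tri K a c b" "tri K c b a" "tri K b c a" "tri K c a b"
  using assms unfolding tri_def by (auto simp: insert_commute)

lemma triangles_iff_tri: "\<Delta> \<in> triangles K \<longleftrightarrow> (\<exists>a b c. tri K a b c \<and> \<Delta> = convex hull {a, b, c})"
proof
  assume "\<Delta> \<in> triangles K"
  then obtain C where C: "\<Delta> \<in> K" "\<not> affine_dependent C" "int (card C) = 3" "\<Delta> = convex hull C"
    unfolding triangles_def simplex_def by auto
  then have "card C = 3" by simp
  then obtain a b c where "C = {a, b, c}" "a \<noteq> b" "a \<noteq> c" "b \<noteq> c" unfolding card_3_iff by auto
  then show "\<exists>a b c. tri K a b c \<and> \<Delta> = convex hull {a, b, c}"
    using C unfolding tri_def by metis
next
  assume "\<exists>a b c. tri K a b c \<and> \<Delta> = convex hull {a, b, c}"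
  then obtain a b c where abc: "tri K a b c" "\<Delta> = convex hull {a, b, c}" by auto
  then have "2 simplex \<Delta>"
    unfolding simplex_def tri_def by (intro exI[of _ "{a,b,c}"]) auto
  then show "\<Delta> \<in> triangles K" using abc unfolding triangles_def tri_def by auto
qed

lemma edges_iff_segment: "e \<in> edges K \<longleftrightarrow> (\<exists>a b. a \<noteq> b \<and> e = closed_segment a b \<and> e \<in> K)"
proof
  assume "e \<in> edges K"
  then obtain C where C: "e \<in> K" "int (card C) = 2" "e = convex hull C"
    unfolding edges_def simplex_def by auto
  then have "card C = 2" by simp
  then obtain a b where "C = {a, b}" "a \<noteq> b" unfolding card_2_iff by auto
  then show "\<exists>a b. a \<noteq> b \<and> e = closed_segment a b \<and> e \<in> K"
    using C by (auto simp: segment_convex_hull)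
qed (auto simp: edges_def one_simplex_segment)

lemma tri_hull_subset_in:
  assumes "lf_simplicial_complex K" "tri K a b c" "F \<subseteq> {a, b, c}"
  shows "convex hull F \<in> K"
  using lf_face[OF assms(1), of "convex hull {a, b, c}" "convex hull F"] assms(2,3)
    face_of_convex_hull_affine_independent[of "{a, b, c}"] unfolding tri_def by blast

lemma tri_faces:
  assumes "lf_simplicial_complex K" "tri K a b c"
  shows "{a} \<in> K" "{b} \<in> K" "{c} \<in> K"
    "closed_segment a b \<in> K" "closed_segment a c \<in> K" "closed_segment b c \<in> K"
  using tri_hull_subset_in[OF assms, of "{a}"] tri_hull_subset_in[OF assms, of "{b}"]
    tri_hull_subset_in[OF assms, of "{c}"] tri_hull_subset_in[OF assms, of "{a, b}"]
    tri_hull_subset_in[OF assms, of "{a, c}"] tri_hull_subset_in[OF assms, of "{b, c}"]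
  by (auto simp: segment_convex_hull)

text \<open>The intersection is a face of both simplices. As a simplex determines its vertices, both
  descriptions of it use the same set \<open>F\<close>.\<close>

lemma tri_Int_faces:
  assumes "lf_simplicial_complex K" "tri K a b c" "\<not> affine_dependent V" "convex hull V \<in> K"
  obtains F where "F \<subseteq> {a, b, c}" "F \<subseteq> V" "convex hull V \<inter> convex hull {a, b, c} = convex hull F"
proof -
  have t: "convex hull {a, b, c} \<in> K" "\<not> affine_dependent {a, b, c}" using assms(2) by (auto simp: tri_def)
  obtain F where F: "F \<subseteq> {a, b, c}" "convex hull V \<inter> convex hull {a, b, c} = convex hull F"
    using lf_Int_face(2)[OF assms(1,4) t(1)] face_of_convex_hull_affine_independent[OF t(2)] by auto
  obtain G where G: "G \<subseteq> V" "convex hull V \<inter> convex hull {a, b, c} = convex hull G"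
    using lf_Int_face(1)[OF assms(1,4) t(1)] face_of_convex_hull_affine_independent[OF assms(3)] by auto
  have "F = G"
    using convex_hull_affine_independent_inject F G affine_independent_subset t(2) assms(3) by metis
  then show ?thesis using that F G by auto
qed

lemma vertex_in_tri:
  assumes "lf_simplicial_complex K" "tri K a b c" "{v} \<in> K" "v \<in> convex hull {a, b, c}"
  shows "v \<in> {a, b, c}"
proof -
  have "convex hull {v} \<in> K" using assms(3) by simp
  then obtain F where "F \<subseteq> {a, b, c}" "F \<subseteq> {v}" "convex hull {v} \<inter> convex hull {a, b, c} = convex hull F"
    by (rule tri_Int_faces[OF assms(1,2) affine_independent_1[of v]])
  moreover from this have "F = {} \<or> F = {v}" by blast
  ultimately show ?thesis using assms(4) by auto
qed

lemma edge_Int_tri: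
  assumes "lf_simplicial_complex K" "tri K a b c" "closed_segment x y \<in> K"
    and p: "p \<in> closed_segment x y" "p \<in> convex hull {a, b, c}"
  shows "{x, y} \<subseteq> {a, b, c} \<or> p \<in> {a, b, c} \<inter> {x, y}"
proof -
  obtain F where F: "F \<subseteq> {a, b, c}" "F \<subseteq> {x, y}"
      "convex hull {x, y} \<inter> convex hull {a, b, c} = convex hull F"
    using tri_Int_faces[OF assms(1,2), of "{x, y}"] assms(3) affine_independent_2
    by (auto simp: segment_convex_hull)
  have p': "p \<in> convex hull F" using p F(3) by (auto simp: segment_convex_hull)
  consider "F = {x, y}" | "F = {}" | "F = {x}" | "F = {y}" using F(2) by blast
  then show ?thesis using p' F(1) by cases auto
qed

lemma edge_in_tri:
  assumes "lf_simplicial_complex K" "\<Union>K = UNIV" "closed_segment x y \<in> K" "x \<noteq> y"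
  obtains z where "tri K x y z"
proof -
  obtain \<Delta> where \<Delta>: "\<Delta> \<in> triangles K" "closed_segment x y face_of \<Delta>"
    using face_of_triangle_exists[OF assms(1-3)] by auto
  then obtain a b c where abc: "tri K a b c" "\<Delta> = convex hull {a, b, c}" by (auto simp: triangles_iff_tri)
  then have ind: "\<not> affine_dependent {a, b, c}" by (auto simp: tri_def)
  obtain F where F: "F \<subseteq> {a, b, c}" "closed_segment x y = convex hull F"
    using \<Delta>(2) abc(2) face_of_convex_hull_affine_independent[OF ind] by auto
  then have "F = {x, y}"
    using convex_hull_affine_independent_inject[of F "{x, y}"] affine_independent_subset[OF ind]
    by (auto simp: segment_convex_hull affine_independent_2)
  then have "{x, y} \<subseteq> {a, b, c}" using F(1) by simp
  then show ?thesis using that abc(1) assms(4) tri_perm[OF abc(1)] by auto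
qed

text \<open>Close to \<open>v\<close> there are only simplices containing \<open>v\<close>.
  Contracting \<open>p\<close> towards \<open>v\<close> puts it into a triangle at \<open>v\<close>,
  and scaling back keeps the coefficients nonnegative.\<close>

lemma vertex_star_sector:
  assumes "lf_simplicial_complex K" "\<Union>K = UNIV" "{v} \<in> K"
  obtains c d \<kappa> \<mu> where "tri K v c d" "0 \<le> \<kappa>" "0 \<le> \<mu>" "p = v + \<kappa> *\<^sub>R (c - v) + \<mu> *\<^sub>R (d - v)"
proof -
  obtain e where e: "e > 0" "\<And>\<sigma>. \<sigma> \<in> K \<Longrightarrow> \<sigma> \<inter> ball v e \<noteq> {} \<Longrightarrow> v \<in> \<sigma>"
    using lf_star_nbhd[OF assms(1,2)] by metis
  obtain t where t: "t > 0" "t * norm (p - v) < e"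
  proof
    show "e / (norm (p - v) + 1) > 0" using e(1) by (simp add: add_nonneg_pos)
    have "norm (p - v) + 1 > 0" by (simp add: add_nonneg_pos)
    then show "e / (norm (p - v) + 1) * norm (p - v) < e" using e(1) by (simp add: field_simps)
  qed
  define q where "q = v + t *\<^sub>R (p - v)"
  obtain \<Delta> where \<Delta>: "\<Delta> \<in> triangles K" "q \<in> \<Delta>" using triangles_cover[OF assms(1,2)] by metis
  have "q \<in> ball v e" using t by (simp add: q_def dist_norm)
  then have "\<Delta> \<inter> ball v e \<noteq> {}" using \<Delta>(2) by blast
  then have "v \<in> \<Delta>" using e(2)[of \<Delta>] \<Delta>(1) by (auto simp: triangles_def)
  obtain a b c where abc: "tri K a b c" "\<Delta> = convex hull {a, b, c}" using \<Delta>(1) by (auto simp: triangles_iff_tri)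
  have "v \<in> {a, b, c}" using vertex_in_tri[OF assms(1) abc(1) assms(3)] \<open>v \<in> \<Delta>\<close> abc(2) by auto
  then obtain c' d where cd: "tri K v c' d" "\<Delta> = convex hull {v, c', d}"
    using tri_perm[OF abc(1)] abc by (auto simp: insert_commute)
  obtain \<alpha> \<beta> where ab: "0 \<le> \<alpha>" "0 \<le> \<beta>" "q = v + \<alpha> *\<^sub>R (c' - v) + \<beta> *\<^sub>R (d - v)"
    using \<Delta>(2) cd(2) convex_hull_3_alt[of v c' d] by auto
  have "p = v + (1 / t) *\<^sub>R (q - v)" using t(1) by (simp add: q_def)
  also have "\<dots> = v + (\<alpha> / t) *\<^sub>R (c' - v) + (\<beta> / t) *\<^sub>R (d - v)"
    unfolding ab(3) by (simp add: scaleR_add_right)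
  finally show ?thesis using that[OF cd(1), of "\<alpha> / t" "\<beta> / t"] ab t(1) by simp
qed

lemma triangle_eq_if_interior_meets:
  assumes "lf_simplicial_complex K" "\<Delta>1 \<in> triangles K" "\<Delta>2 \<in> triangles K"
    "x \<in> interior \<Delta>1" "x \<in> \<Delta>2"
  shows "\<Delta>1 = \<Delta>2"
proof (rule ccontr)
  assume "\<Delta>1 \<noteq> \<Delta>2"
  have K: "\<Delta>1 \<in> K" "\<Delta>2 \<in> K" and d: "aff_dim \<Delta>1 = 2" "aff_dim \<Delta>2 = 2"
    using assms(2,3) aff_dim_simplex unfolding triangles_def by auto
  have "\<Delta>1 face_of \<Delta>2"
    using lf_rel_interior_face[OF assms(1) K, of x] interior_subset_rel_interior assms(4,5) by auto
  then show False
    using face_of_aff_dim_lt[of \<Delta>2 \<Delta>1] lf_simplex(4)[OF assms(1) K(2)] \<open>\<Delta>1 \<noteq> \<Delta>2\<close> d by auto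
qed

lemma triangle_interior_nonempty:
  assumes "\<Delta> \<in> triangles (K :: (real^2) set set)" shows "interior \<Delta> \<noteq> {}"
proof -
  have s: "2 simplex \<Delta>" using assms by (simp add: triangles_def)
  have "aff_dim \<Delta> = int DIM(real^2)" using aff_dim_simplex[OF s] by simp
  then have "interior \<Delta> = rel_interior \<Delta>" unfolding aff_dim_eq_full by (simp add: rel_interior_interior)
  moreover have "\<Delta> \<noteq> {}" using s by auto
  ultimately show ?thesis using convex_simplex[OF s] by (simp add: rel_interior_eq_empty)
qed

text \<open>The union of the triangles containing \<open>y\<close> is clopen in the ball of radius \<open>r\<close>.\<close>

lemma ball_in_star:
  assumes lf: "lf_simplicial_complex K" and cover: "\<Union>K = UNIV"
    and far: "\<And>a b c q. tri K a b c \<Longrightarrow> y \<in> convex hull {a, b, c} \<Longrightarrow> q \<in> closed_segment a b \<Longrightarrow>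
        y \<notin> closed_segment a b \<Longrightarrow> r \<le> dist y q"
    and "\<Delta> \<in> triangles K" "z \<in> \<Delta>" "dist y z < r"
  shows "y \<in> \<Delta>"
proof -
  define U where "U = \<Union>{\<Delta> \<in> triangles K. y \<in> \<Delta>}"
  \<comment> \<open>The triangle \<open>\<Delta>2\<close> and a triangle containing \<open>y\<close>
    and \<open>q\<close> meet in a common face. If that face omits \<open>y\<close>, then
    \<open>q\<close> lies on an edge omitting \<open>y\<close>, and \<open>far\<close> keeps such
    edges at distance at least \<open>r\<close>.\<close>
  have star: "y \<in> \<Delta>2" if q: "q \<in> U" "dist y q < r" and \<Delta>2: "\<Delta>2 \<in> triangles K" "q \<in> \<Delta>2" for q \<Delta>2
  proof (rule ccontr)
    assume y: "y \<notin> \<Delta>2"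
    obtain a b c where abc: "tri K a b c" "y \<in> convex hull {a, b, c}" "q \<in> convex hull {a, b, c}"
      using q(1) unfolding U_def triangles_iff_tri by auto
    obtain x1 x2 x3 where x: "tri K x1 x2 x3" "\<Delta>2 = convex hull {x1, x2, x3}"
      using \<Delta>2(1) unfolding triangles_iff_tri by auto
    then have x': "\<not> affine_dependent {x1, x2, x3}" "convex hull {x1, x2, x3} \<in> K" by (auto simp: tri_def)
    obtain F where F: "F \<subseteq> {a, b, c}" "\<Delta>2 \<inter> convex hull {a, b, c} = convex hull F"
      using tri_Int_faces[OF lf abc(1) x'] x(2) by metis
    have qF: "q \<in> convex hull F" and yF: "y \<notin> convex hull F" using F(2) \<Delta>2(2) abc(3) y by auto
    have far': "r \<le> dist y q"
      if G: "G \<subseteq> {a, b, c}" "y \<notin> convex hull G" "q \<in> convex hull G" "card G = 2" for G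
    proof -
      obtain u w where "G = {u, w}" "u \<noteq> w" using G(4) unfolding card_2_iff by auto
      moreover from this have "u \<in> {a, b, c}" "w \<in> {a, b, c}" using G(1) by auto
      ultimately obtain s where "tri K u w s" "{u, w, s} = {a, b, c}"
        using tri_perm[OF abc(1)] abc(1) by (auto simp: insert_commute)
      then show ?thesis
        using far[of u w s q] G(2,3) abc(2) \<open>G = {u, w}\<close> by (auto simp: segment_convex_hull)
    qed
    have ind: "\<not> affine_dependent {a, b, c}" "a \<noteq> b" "a \<noteq> c" "b \<noteq> c" using abc(1) by (auto simp: tri_def)
    \<comment> \<open>If the common face is a single vertex \<open>u\<close> other than
      \<open>y\<close>, one of the two edges at \<open>u\<close> omits \<open>y\<close>, since they
      share only \<open>u\<close>.\<close>
    have vertex: "\<exists>G\<subseteq>{a, b, c}. y \<notin> convex hull G \<and> q \<in> convex hull G \<and> card G = 2"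
      if F: "F = {u}" and uvw: "{u, v, w} = {a, b, c}" "u \<noteq> v" "u \<noteq> w" "v \<noteq> w" for u v w
    proof -
      have "convex hull {u, v} \<inter> convex hull {u, w} = convex hull {u}"
        using convex_hull_Int_affine_independent[of "{u, v, w}" "{u, v}" "{u, w}"] ind(1) uvw by auto
      then have "y \<notin> convex hull {u, v} \<or> y \<notin> convex hull {u, w}" using yF F by auto
      moreover have "q \<in> convex hull {u, v}" "q \<in> convex hull {u, w}" using qF F by (auto simp: hull_inc)
      moreover have "{u, v} \<subseteq> {a, b, c}" "{u, w} \<subseteq> {a, b, c}" using uvw(1) by auto
      moreover have "card {u, v} = 2" "card {u, w} = 2" using uvw by auto
      ultimately show ?thesis by meson
    qed
    consider "F = {}" | "F = {a}" | "F = {b}" | "F = {c}" | "F = {a, b}" | "F = {a, c}" | "F = {b, c}"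
      | "F = {a, b, c}" using F(1) by blast
    then have "\<exists>G\<subseteq>{a, b, c}. y \<notin> convex hull G \<and> q \<in> convex hull G \<and> card G = 2"
    proof cases
      case 2 then show ?thesis using vertex[of a b c] ind by simp
    next
      case 3 then show ?thesis using vertex[of b a c] ind by (simp add: insert_commute)
    next
      case 4 then show ?thesis using vertex[of c a b] ind by (simp add: insert_commute)
    next
      case 5 then show ?thesis using qF yF ind by (intro exI[of _ F]) auto
    next
      case 6 then show ?thesis using qF yF ind by (intro exI[of _ F]) auto
    next
      case 7 then show ?thesis using qF yF ind by (intro exI[of _ F]) auto
    qed (use qF yF abc(2) in auto)
    then have "r \<le> dist y q" using far' by auto
    then show False using q(2) by simp
  qed
  have "closed U" unfolding U_def
    by (rule lf_closed_Union[OF lf cover]) (auto simp: triangles_def)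
  then have 1: "closedin (top_of_set (ball y r)) (ball y r \<inter> U)" by (simp add: closedin_closed_Int)
  \<comment> \<open>Near a point \<open>q\<close> of \<open>U\<close> only triangles through
    \<open>q\<close> occur, and by \<open>star\<close> these contain \<open>y\<close>.\<close>
  have 2: "openin (top_of_set (ball y r)) (ball y r \<inter> U)"
    unfolding openin_contains_ball
  proof (intro conjI ballI)
    fix q assume q: "q \<in> ball y r \<inter> U"
    obtain e where e: "e > 0" "\<And>\<sigma>. \<sigma> \<in> K \<Longrightarrow> \<sigma> \<inter> ball q e \<noteq> {} \<Longrightarrow> q \<in> \<sigma>"
      using lf_star_nbhd[OF lf cover] by metis
    have "p \<in> U" if p: "p \<in> ball q e" for p
    proof -
      obtain \<Delta>2 where \<Delta>2: "\<Delta>2 \<in> triangles K" "p \<in> \<Delta>2" using triangles_cover[OF lf cover] by metis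
      then have "\<Delta>2 \<inter> ball q e \<noteq> {}" using p by blast
      then have "q \<in> \<Delta>2" using e(2)[of \<Delta>2] \<Delta>2(1) by (auto simp: triangles_def)
      then have "y \<in> \<Delta>2" using star[of q \<Delta>2] q \<Delta>2(1) by auto
      then show ?thesis using \<Delta>2 by (auto simp: U_def)
    qed
    then show "\<exists>e>0. ball q e \<inter> ball y r \<subseteq> ball y r \<inter> U" using e(1) by auto
  qed auto
  obtain \<Delta>0 where "\<Delta>0 \<in> triangles K" "y \<in> \<Delta>0" using triangles_cover[OF lf cover] by metis
  then have "y \<in> U" by (auto simp: U_def)
  moreover have "0 < r" using assms(6) zero_le_dist[of y z] by linarith
  ultimately have "y \<in> ball y r \<inter> U" by simp
  then have "ball y r \<inter> U \<noteq> {}" by blast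
  then have "ball y r \<inter> U = ball y r" using 1 2 connected_clopen[of "ball y r"] by auto
  moreover have "z \<in> ball y r" using assms(6) by simp
  ultimately have "z \<in> U" by blast
  then show ?thesis using star[of z \<Delta>] assms by auto
qed

section \<open>Delaunay triangulations\<close>

lemma inner_real2: "(x :: real^2) \<bullet> y = x $ 1 * y $ 1 + x $ 2 * y $ 2"
  by (simp add: inner_vec_def sum_2)

lemma independent_det:
  fixes a b c :: "real^2"
  assumes "\<not> affine_dependent {a, b, c}" "a \<noteq> b" "a \<noteq> c" "b \<noteq> c"
  shows "(b - a) $ 1 * (c - a) $ 2 - (b - a) $ 2 * (c - a) $ 1 \<noteq> 0"
proof
  define u w where "u = b - a" and "w = c - a"
  assume "(b - a) $ 1 * (c - a) $ 2 - (b - a) $ 2 * (c - a) $ 1 = 0"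
  then have D: "u $ 1 * w $ 2 - u $ 2 * w $ 1 = 0" by (simp add: u_def w_def)
  have uu: "u \<bullet> u \<noteq> 0" using assms(2) by (simp add: u_def)
  have "(u \<bullet> u) *\<^sub>R w = (u \<bullet> w) *\<^sub>R u"
    using D unfolding vec_eq_iff forall_2 inner_real2 by simp algebra
  then have "(1 / (u \<bullet> u)) *\<^sub>R (u \<bullet> u) *\<^sub>R w = (1 / (u \<bullet> u)) *\<^sub>R (u \<bullet> w) *\<^sub>R u" by simp
  then have "w = ((u \<bullet> w) / (u \<bullet> u)) *\<^sub>R u" using uu by simp
  then have "c = a + ((u \<bullet> w) / (u \<bullet> u)) *\<^sub>R (b - a)"
    unfolding u_def[symmetric] by (simp add: w_def algebra_simps)
  also have "\<dots> = ((u \<bullet> w) / (u \<bullet> u)) *\<^sub>R b + (1 - (u \<bullet> w) / (u \<bullet> u)) *\<^sub>R a"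
    by (simp add: algebra_simps)
  finally obtain t where "c = t *\<^sub>R b + (1 - t) *\<^sub>R a" by blast
  then have "collinear {b, c, a}" unfolding collinear_3_expand by auto
  then show False using assms by (simp add: collinear_3_eq_affine_dependent insert_commute)
qed

text \<open>Cramer's rule; \<open>g\<close> and \<open>h\<close> read off the coordinates of a point
  relative to the corner \<open>v\<close> with sides towards \<open>a\<close> and
  \<open>b\<close>.\<close>

lemma dual_basis:
  fixes a b v :: "real^2"
  assumes "\<not> affine_dependent {v, a, b}" "v \<noteq> a" "v \<noteq> b" "a \<noteq> b"
  obtains g h where "\<And>p. p = v + (g \<bullet> (p - v)) *\<^sub>R (a - v) + (h \<bullet> (p - v)) *\<^sub>R (b - v)"
    "g \<bullet> (a - v) = 1" "h \<bullet> (a - v) = 0" "g \<bullet> (b - v) = 0" "h \<bullet> (b - v) = 1"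
proof -
  define A B D where "A = a - v" and "B = b - v" and "D = A $ 1 * B $ 2 - A $ 2 * B $ 1"
  have D: "D \<noteq> 0" using independent_det[OF assms] by (simp add: D_def A_def B_def)
  define g h where "g = (vector [B $ 2 / D, - (B $ 1) / D] :: real^2)" and "h = (vector [- (A $ 2) / D, A $ 1 / D] :: real^2)"
  have g: "g \<bullet> p = (B $ 2 * p $ 1 - B $ 1 * p $ 2) / D" and h: "h \<bullet> p = (A $ 1 * p $ 2 - A $ 2 * p $ 1) / D" for p
    by (simp_all add: inner_real2 g_def h_def diff_divide_distrib)
  have "p - v = (g \<bullet> (p - v)) *\<^sub>R A + (h \<bullet> (p - v)) *\<^sub>R B" for p
  proof -
    define q where "q = p - v"
    have "D *\<^sub>R q = D *\<^sub>R ((g \<bullet> q) *\<^sub>R A + (h \<bullet> q) *\<^sub>R B)"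
      unfolding vec_eq_iff forall_2 using D by (simp add: g h distrib_left) (simp add: D_def algebra_simps)
    then show ?thesis using D unfolding q_def by simp
  qed
  then have "p = v + (g \<bullet> (p - v)) *\<^sub>R A + (h \<bullet> (p - v)) *\<^sub>R B" for p
    by (metis add.assoc add_diff_cancel_left' diff_add_cancel add.commute)
  moreover have "g \<bullet> A = 1" "h \<bullet> A = 0" "g \<bullet> B = 0" "h \<bullet> B = 1"
    using D by (simp_all add: g h) (simp_all add: D_def algebra_simps)
  ultimately show ?thesis using that[of g h] unfolding A_def B_def by blast
qed

lemma circumcentre_exists:
  fixes a b c :: "real^2"
  assumes "\<not> affine_dependent {a, b, c}" "a \<noteq> b" "a \<noteq> c" "b \<noteq> c"
  obtains z where "dist z b = dist z a" "dist z c = dist z a"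
proof -
  define u w where "u = b - a" and "w = c - a"
  define D where "D = u $ 1 * w $ 2 - u $ 2 * w $ 1"
  have "D \<noteq> 0" using independent_det[OF assms] by (simp add: D_def u_def w_def)
  \<comment> \<open>Cramer's rule for the equations
    \<open>2 * (u \<bullet> y) = u \<bullet> u\<close> and
    \<open>2 * (w \<bullet> y) = w \<bullet> w\<close> of the two perpendicular bisectors.\<close>
  define y :: "real^2" where "y = vector [((u \<bullet> u) * w $ 2 - (w \<bullet> w) * u $ 2) / (2 * D),
      (u $ 1 * (w \<bullet> w) - w $ 1 * (u \<bullet> u)) / (2 * D)]"
  have y: "2 * D * y $ 1 = (u \<bullet> u) * w $ 2 - (w \<bullet> w) * u $ 2" "2 * D * y $ 2 = u $ 1 * (w \<bullet> w) - w $ 1 * (u \<bullet> u)"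
    using \<open>D \<noteq> 0\<close> by (simp_all add: y_def)
  have "D * (2 * (u \<bullet> y)) = u $ 1 * (2 * D * y $ 1) + u $ 2 * (2 * D * y $ 2)"
    unfolding inner_real2[of u y] by (simp add: algebra_simps)
  also have "\<dots> = D * (u \<bullet> u)" unfolding y by (simp add: D_def algebra_simps)
  finally have u: "2 * (u \<bullet> y) = u \<bullet> u" using \<open>D \<noteq> 0\<close> by simp
  have "D * (2 * (w \<bullet> y)) = w $ 1 * (2 * D * y $ 1) + w $ 2 * (2 * D * y $ 2)"
    unfolding inner_real2[of w y] by (simp add: algebra_simps)
  also have "\<dots> = D * (w \<bullet> w)" unfolding y by (simp add: D_def algebra_simps)
  finally have w: "2 * (w \<bullet> y) = w \<bullet> w" using \<open>D \<noteq> 0\<close> by simp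
  have "dist (a + y) b = dist (a + y) a"
  proof -
    have "dist (a + y) b = norm (y - u)" by (simp add: dist_norm u_def algebra_simps)
    also have "\<dots> = norm y" using u by (simp add: norm_eq inner_diff inner_commute)
    finally show ?thesis by (simp add: dist_norm)
  qed
  moreover have "dist (a + y) c = dist (a + y) a"
  proof -
    have "dist (a + y) c = norm (y - w)" by (simp add: dist_norm w_def algebra_simps)
    also have "\<dots> = norm y" using w by (simp add: norm_eq inner_diff inner_commute)
    finally show ?thesis by (simp add: dist_norm)
  qed
  ultimately show ?thesis using that by blast
qed

lemma hyperplane_collinear:
  fixes u :: "real^2"
  assumes "u \<noteq> 0" "\<And>x. x \<in> X \<Longrightarrow> u \<bullet> x = c"
  shows "collinear X"
proof -
  have "aff_dim X \<le> aff_dim {x. u \<bullet> x = c}" using assms(2) by (intro aff_dim_subset) auto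
  then show ?thesis using assms(1) by (simp add: collinear_aff_dim)
qed

text \<open>Three distinct points of a circle are affinely independent, so no line carries
  them.\<close>

lemma sphere_hyperplane_3:
  fixes u :: "real^2"
  assumes "u \<noteq> 0" "u \<bullet> x = c" "u \<bullet> y = c" "u \<bullet> w = c" "{x, y, w} \<subseteq> sphere z r"
  shows "x = y \<or> x = w \<or> y = w"
proof -
  have "collinear {x, y, w}" by (rule hyperplane_collinear[OF assms(1), of _ c]) (use assms in auto)
  then show ?thesis
    using sphere_affine_independent[of x z r y w] assms(5) collinear_3_eq_affine_dependent[of x y w] by auto
qed

text \<open>If the centres differed, the three common points would all lie on the radical
  axis.\<close>

lemma circle_unique:
  fixes z w :: "real^2"
  assumes "{a, b, c} \<subseteq> sphere z r" "{a, b, c} \<subseteq> sphere w s" "a \<noteq> b" "a \<noteq> c" "b \<noteq> c"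
  shows "z = w \<and> r = s"
proof -
  have "(2 *\<^sub>R (w - z)) \<bullet> x = - (z \<bullet> z - w \<bullet> w - r\<^sup>2 + s\<^sup>2)" if "x \<in> {a, b, c}" for x
    using disc_power_diff[of z r x w s] disc_power_sphere[of x z r] disc_power_sphere[of x w s] that assms(1,2)
    by auto
  then have "2 *\<^sub>R (w - z) = 0"
    using sphere_hyperplane_3[of "2 *\<^sub>R (w - z)" a _ b c z r] assms(1,3-5) by fastforce
  then show ?thesis using assms(1,2) by auto
qed

lemma delaunay_triangulationD:
  assumes "delaunay_triangulation P K"
  shows "lf_simplicial_complex K" "vertices K = P" "\<Union>K = convex hull P"
  using assms unfolding delaunay_triangulation_def triangulation_of_def by auto

lemma delaunay_tri_in:
  assumes "delaunay_triangulation P K" "tri K a b c"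
  shows "a \<in> P" "b \<in> P" "c \<in> P"
  using tri_faces(1-3)[OF delaunay_triangulationD(1)[OF assms(1)] assms(2)]
    delaunay_triangulationD(2)[OF assms(1)] unfolding vertices_def by auto

lemma delaunay_circumcircle:
  assumes "delaunay_triangulation P K" "tri K a b c"
  obtains z r where "r > 0" "dist z a = r" "dist z b = r" "dist z c = r" "\<And>p. p \<in> P \<Longrightarrow> r \<le> dist z p"
proof -
  have t: "\<not> affine_dependent {a, b, c}" "a \<noteq> b" "a \<noteq> c" "b \<noteq> c" using assms(2) by (auto simp: tri_def)
  obtain z where z: "dist z b = dist z a" "dist z c = dist z a" using circumcentre_exists[OF t] by metis
  define r where "r = dist z a"
  have "r \<noteq> 0" using z t(2) unfolding r_def by auto
  then have "r > 0" using zero_le_dist[of z a] unfolding r_def by linarith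
  have "{v. v extreme_point_of (convex hull {a, b, c})} \<subseteq> sphere z r"
    using extreme_point_of_convex_hull_affine_independent[OF t(1)] z by (auto simp: r_def)
  moreover have "convex hull {a, b, c} \<in> triangles K" using assms(2) triangles_iff_tri by blast
  ultimately have "interior (cball z r) \<inter> P = {}" using assms(1) unfolding delaunay_triangulation_def by metis
  then have "p \<notin> ball z r" if "p \<in> P" for p using that by auto
  then have "\<And>p. p \<in> P \<Longrightarrow> r \<le> dist z p" by (simp add: not_less)
  then show ?thesis using z by (intro that[of r z, OF \<open>r > 0\<close>]) (simp_all add: r_def)
qed

text \<open>The midpoint of \<open>p q\<close> lies in some triangle. The difference between the
  powers for the given circle and for its circumscribed circle separates \<open>{p, q}\<close> from
  its vertices, so the midpoint lies in the hull of the common points. Being neither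
  \<open>p\<close> nor \<open>q\<close>, it needs both as vertices.\<close>

lemma delaunay_forced_edge:
  assumes K: "delaunay_triangulation P K" "\<Union>K = UNIV"
    and pq: "p \<in> P" "q \<in> P" "p \<noteq> q" "disc_power m s p = 0" "disc_power m s q = 0"
    and empty: "\<And>x. x \<in> P \<Longrightarrow> x \<noteq> p \<Longrightarrow> x \<noteq> q \<Longrightarrow> 0 < disc_power m s x"
  shows "closed_segment p q \<in> K"
proof -
  note lf = delaunay_triangulationD(1)[OF K(1)]
  define x where "x = midpoint p q"
  obtain \<Delta> where "\<Delta> \<in> triangles K" "x \<in> \<Delta>" using triangles_cover[OF lf K(2)] by metis
  then obtain a b c where abc: "tri K a b c" "x \<in> convex hull {a, b, c}" by (auto simp: triangles_iff_tri)
  obtain z r where zr: "dist z a = r" "dist z b = r" "dist z c = r" "\<And>p. p \<in> P \<Longrightarrow> r \<le> dist z p" "r > 0"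
    using delaunay_circumcircle[OF K(1) abc(1)] by metis
  define u k where "u = 2 *\<^sub>R (z - m)" and "k = m \<bullet> m - z \<bullet> z - s\<^sup>2 + r\<^sup>2"
  have g: "u \<bullet> y + k = disc_power m s y - disc_power z r y" for y
    unfolding u_def k_def disc_power_diff by simp
  have abcP: "{a, b, c} \<subseteq> P" using delaunay_tri_in[OF K(1) abc(1)] by auto
  have nonneg: "0 \<le> disc_power m s y" if "y \<in> P" for y
    using empty[OF that] pq(4,5) by (cases "y = p \<or> y = q") auto
  have zero: "disc_power z r y = 0" if "y \<in> {a, b, c}" for y
    using zr(1-3) that by (auto simp: disc_power_def)
  have pq': "0 \<le> disc_power z r y" if "y \<in> P" for y
    using zr(4)[OF that] zr(5) by (simp add: disc_power_def)
  have "0 \<le> u \<bullet> y + k" if "y \<in> {a, b, c}" for y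
    unfolding g using nonneg zero[OF that] abcP that by fastforce
  moreover have "u \<bullet> y + k \<le> 0" if "y \<in> {p, q}" for y
    unfolding g using that pq' pq by auto
  moreover have "x \<in> convex hull {p, q}"
    unfolding x_def by (simp flip: segment_convex_hull)
  ultimately have "x \<in> convex hull {y \<in> {a, b, c}. u \<bullet> y + k = 0}"
    using convex_hull_separated_faces(2)[of "{p, q}" "{a, b, c}" u k x] abc(2) by simp
  moreover have "{y \<in> {a, b, c}. u \<bullet> y + k = 0} \<subseteq> {p, q} \<inter> {a, b, c}" (is "?Z \<subseteq> _")
  proof
    fix y assume y: "y \<in> ?Z"
    then have "disc_power m s y = 0" using zero[of y] unfolding g by auto
    then show "y \<in> {p, q} \<inter> {a, b, c}" using empty[of y] y abcP by fastforce
  qed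
  ultimately have x: "x \<in> convex hull ({p, q} \<inter> {a, b, c})" using hull_mono by blast
  have "x \<noteq> p" "x \<noteq> q" unfolding x_def using pq(3) by (simp_all add: midpoint_eq_endpoint)
  then have "p \<in> {a, b, c} \<and> q \<in> {a, b, c}" using x by (auto split: if_splits simp: Int_insert_left)
  then have "convex hull {p, q} \<in> K" using tri_hull_subset_in[OF lf abc(1), of "{p, q}"] by simp
  then show ?thesis by (simp add: segment_convex_hull)
qed

section \<open>Existence of Delaunay triangulations\<close>

text \<open>The points of \<open>P\<close> on an empty circle span a Delaunay cell. A fan triangle joins the apex of the cell to an
  edge \<open>a b\<close> of the cell; the functional \<open>u\<close> witnesses that \<open>a b\<close> is an edge.\<close>

definition fan :: "(real^2) set \<Rightarrow> ((real^2) set \<Rightarrow> real^2) \<Rightarrow> (real^2) set \<Rightarrow> bool" where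
  "fan P apex A \<longleftrightarrow> (\<exists>z r v a b u. (\<forall>p\<in>P. r \<le> dist z p) \<and> v = apex (P \<inter> sphere z r) \<and>
     v \<in> P \<inter> sphere z r \<and> a \<in> P \<inter> sphere z r \<and> b \<in> P \<inter> sphere z r \<and> v \<noteq> a \<and> v \<noteq> b \<and> a \<noteq> b \<and>
     u \<bullet> a = u \<bullet> b \<and> (\<forall>q\<in>P \<inter> sphere z r. q \<noteq> a \<and> q \<noteq> b \<longrightarrow> u \<bullet> a < u \<bullet> q) \<and> A = {v, a, b})"

lemma fanI:
  assumes "\<And>p. p \<in> P \<Longrightarrow> r \<le> dist z p" "v = apex (P \<inter> sphere z r)"
    "v \<in> P \<inter> sphere z r" "a \<in> P \<inter> sphere z r" "b \<in> P \<inter> sphere z r" "v \<noteq> a" "v \<noteq> b" "a \<noteq> b"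
    "u \<bullet> a = u \<bullet> b" "\<And>q. q \<in> P \<inter> sphere z r \<Longrightarrow> q \<noteq> a \<Longrightarrow> q \<noteq> b \<Longrightarrow> u \<bullet> a < u \<bullet> q"
  shows "fan P apex {v, a, b}"
  unfolding fan_def
  by (rule exI[of _ z], rule exI[of _ r], rule exI[of _ v], rule exI[of _ a], rule exI[of _ b], rule exI[of _ u])
    (use assms in blast)

lemma fan_independent:
  assumes "fan P apex A"
  shows "finite A" "card A = 3" "\<not> affine_dependent A" "A \<subseteq> P"
proof -
  obtain z r v a b where *: "v \<in> P" "a \<in> P" "b \<in> P" "v \<in> sphere z r" "a \<in> sphere z r" "b \<in> sphere z r"
      "v \<noteq> a" "v \<noteq> b" "a \<noteq> b" "A = {v, a, b}"
    using assms unfolding fan_def by blast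
  then show "finite A" "card A = 3" "A \<subseteq> P" by auto
  show "\<not> affine_dependent A"
    unfolding *(10) by (rule sphere_affine_independent[OF *(4-9)])
qed

text \<open>Two triangles of one cell are separated by an affine function vanishing at the apex,
  triangles of different cells by the power difference of their circles.\<close>

lemma fan_Int_subset:
  assumes "fan P apex A" "fan P apex B"
  shows "convex hull A \<inter> convex hull B \<subseteq> convex hull (A \<inter> B)"
proof
  fix x assume x: "x \<in> convex hull A \<inter> convex hull B"
  obtain z r v a b u where A: "\<And>p. p\<in>P \<Longrightarrow> r \<le> dist z p" "v = apex (P \<inter> sphere z r)"
     "{v, a, b} \<subseteq> P \<inter> sphere z r" "v \<noteq> a" "v \<noteq> b" "a \<noteq> b"
     "u \<bullet> a = u \<bullet> b" "\<And>q. q\<in>P \<inter> sphere z r \<Longrightarrow> q \<noteq> a \<Longrightarrow> q \<noteq> b \<Longrightarrow> u \<bullet> a < u \<bullet> q" "A = {v, a, b}"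
    using assms(1) unfolding fan_def by blast
  obtain w s v' c d t where B: "\<And>p. p\<in>P \<Longrightarrow> s \<le> dist w p" "v' = apex (P \<inter> sphere w s)"
     "{v', c, d} \<subseteq> P \<inter> sphere w s" "v' \<noteq> c" "v' \<noteq> d" "c \<noteq> d"
     "t \<bullet> c = t \<bullet> d" "\<And>q. q\<in>P \<inter> sphere w s \<Longrightarrow> q \<noteq> c \<Longrightarrow> q \<noteq> d \<Longrightarrow> t \<bullet> c < t \<bullet> q" "B = {v', c, d}"
    using assms(2) unfolding fan_def by blast
  show "x \<in> convex hull (A \<inter> B)"
  proof (cases "z = w \<and> r = s")
    case True
    have v: "v' = v" using A(2) B(2) True by simp
    define \<alpha> \<beta> where "\<alpha> = u \<bullet> v - u \<bullet> a" and "\<beta> = t \<bullet> v - t \<bullet> c"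
    have pos: "\<alpha> > 0" "\<beta> > 0" using A B v unfolding \<alpha>_def \<beta>_def by auto
    \<comment> \<open>Each quotient is 0 on the chord of its own triangle, 1 at the common apex and
      nonnegative on the cell. Hence the difference has opposite weak signs on the two
      chords.\<close>
    define g where "g y = (u \<bullet> y - u \<bullet> a) / \<alpha> - (t \<bullet> y - t \<bullet> c) / \<beta>" for y
    have g: "(u /\<^sub>R \<alpha> - t /\<^sub>R \<beta>) \<bullet> y + (t \<bullet> c / \<beta> - u \<bullet> a / \<alpha>) = g y" for y
      by (simp add: g_def inner_diff_left diff_divide_distrib divide_inverse algebra_simps)
    have gv: "g v = 0" using pos by (simp add: g_def \<alpha>_def \<beta>_def)
    have ga: "g y \<le> 0 \<and> (g y = 0 \<longrightarrow> y = c \<or> y = d)" if "y \<in> {a, b}" for y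
    proof -
      have "u \<bullet> y = u \<bullet> a" using that A(7) by auto
      then have "g y = - ((t \<bullet> y - t \<bullet> c) / \<beta>)" by (simp add: g_def)
      moreover have "y = c \<or> y = d \<or> t \<bullet> c < t \<bullet> y" using B(8)[of y] that A(3) True by auto
      ultimately show ?thesis using pos B(7) by auto
    qed
    have gc: "0 \<le> g y" if "y \<in> {c, d}" for y
    proof -
      have "t \<bullet> y = t \<bullet> c" using that B(7) by auto
      then have "g y = (u \<bullet> y - u \<bullet> a) / \<alpha>" by (simp add: g_def)
      moreover have "y = a \<or> y = b \<or> u \<bullet> a < u \<bullet> y" using A(8)[of y] that B(3) True by auto
      ultimately show ?thesis using pos A(7) by auto
    qed
    have "x \<in> convex hull {y \<in> A. (u /\<^sub>R \<alpha> - t /\<^sub>R \<beta>) \<bullet> y + (t \<bullet> c / \<beta> - u \<bullet> a / \<alpha>) = 0}"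
      by (rule convex_hull_separated_faces(1)[where B = B])
        (use x A(9) B(9) v ga gc gv in \<open>auto simp: g\<close>)
    moreover have "{y \<in> A. g y = 0} \<subseteq> A \<inter> B" using ga A(9) B(9) v by auto
    ultimately show ?thesis unfolding g using hull_mono by blast
  next
    case False
    \<comment> \<open>Different circles share at most two points, so \<open>V\<close> is affinely
      independent and hulls of its subsets intersect as the subsets do.\<close>
    define V where "V = P \<inter> sphere z r \<inter> sphere w s"
    have V3: "False" if "{x1, x2, x3} \<subseteq> V" "x1 \<noteq> x2" "x1 \<noteq> x3" "x2 \<noteq> x3" for x1 x2 x3
      using circle_unique[of x1 x2 x3 z r w s] that False unfolding V_def by auto
    have ind: "\<not> affine_dependent V"
    proof (cases "\<exists>y1 y2. y1 \<in> V \<and> y2 \<in> V \<and> y1 \<noteq> y2")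
      case True
      then obtain y1 y2 where y: "y1 \<in> V" "y2 \<in> V" "y1 \<noteq> y2" by auto
      then have "V = {y1, y2}" using V3[of y1 y2] by auto
      then show ?thesis by (simp add: affine_independent_2)
    next
      case False
      then have "V = {} \<or> (\<exists>y. V = {y})" by blast
      then show ?thesis by auto
    qed
    define k where "k = z \<bullet> z - w \<bullet> w - r\<^sup>2 + s\<^sup>2"
    have g: "(2 *\<^sub>R (w - z)) \<bullet> y + k = disc_power z r y - disc_power w s y" for y
      unfolding k_def disc_power_diff by simp
    have rs: "0 \<le> r" "0 \<le> s" using A(3) B(3) by auto
    have pz: "0 \<le> disc_power z r y" "0 \<le> disc_power w s y" if "y \<in> P" for y
      using A(1)[OF that] B(1)[OF that] rs by (auto simp: disc_power_def)
    have Az: "disc_power z r y = 0" "y \<in> P" if "y \<in> A" for y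
      using A(3,9) that by (auto simp: disc_power_sphere)
    have Bz: "disc_power w s y = 0" "y \<in> P" if "y \<in> B" for y
      using B(3,9) that by (auto simp: disc_power_sphere)
    have "x \<in> convex hull {y \<in> A. (2 *\<^sub>R (w - z)) \<bullet> y + k = 0}"
      by (rule convex_hull_separated_faces(1)[where B = B])
        (use x A(9) B(9) Az Bz pz in \<open>auto simp del: inner_scaleR_left simp: g\<close>)
    moreover have "{y \<in> A. (2 *\<^sub>R (w - z)) \<bullet> y + k = 0} \<subseteq> A \<inter> V"
    proof
      fix y assume y: "y \<in> {y \<in> A. (2 *\<^sub>R (w - z)) \<bullet> y + k = 0}"
      then have "disc_power w s y = 0" using Az(1)[of y] unfolding g by simp
      then have "y \<in> sphere w s" by (simp only: disc_power_zero_iff[OF rs(2)])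
      then show "y \<in> A \<inter> V" using y A(3,9) unfolding V_def by auto
    qed
    ultimately have 1: "x \<in> convex hull (A \<inter> V)" using hull_mono by blast
    have "x \<in> convex hull {y \<in> B. (2 *\<^sub>R (w - z)) \<bullet> y + k = 0}"
      by (rule convex_hull_separated_faces(2)[where A = A])
        (use x A(9) B(9) Az Bz pz in \<open>auto simp del: inner_scaleR_left simp: g\<close>)
    moreover have "{y \<in> B. (2 *\<^sub>R (w - z)) \<bullet> y + k = 0} \<subseteq> B \<inter> V"
    proof
      fix y assume y: "y \<in> {y \<in> B. (2 *\<^sub>R (w - z)) \<bullet> y + k = 0}"
      then have "disc_power z r y = 0" using Bz(1)[of y] unfolding g by simp
      then have "y \<in> sphere z r" by (simp only: disc_power_zero_iff[OF rs(1)])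
      then show "y \<in> B \<inter> V" using y B(3,9) unfolding V_def by auto
    qed
    ultimately have 2: "x \<in> convex hull (B \<inter> V)" using hull_mono by blast
    have "x \<in> convex hull ((A \<inter> V) \<inter> (B \<inter> V))"
      using 1 2 convex_hull_Int_affine_independent[OF ind, of "A \<inter> V" "B \<inter> V"] by auto
    then show ?thesis using hull_mono[of "(A \<inter> V) \<inter> (B \<inter> V)" "A \<inter> B" convex] by blast
  qed
qed

section \<open>Boundary edges of polygons inscribed in a circle\<close>

lemma supporting_functional:
  fixes S :: "'a::euclidean_space set"
  assumes "convex S" "x \<in> S" "x \<notin> interior S"
  obtains a where "a \<noteq> 0" "\<And>y. y \<in> S \<Longrightarrow> a \<bullet> x \<le> a \<bullet> y"
proof (cases "interior S = {}")
  case True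
  obtain a b where ab: "a \<noteq> 0" "S \<subseteq> {x. a \<bullet> x = b}" using empty_interior_subset_hyperplane[OF assms(1) True] by metis
  show ?thesis
  proof (rule that[OF ab(1)])
    show "a \<bullet> x \<le> a \<bullet> y" if "y \<in> S" for y
    proof -
      have "a \<bullet> y = b" "a \<bullet> x = b" using ab(2) that assms(2) by blast+
      then show ?thesis by simp
    qed
  qed
next
  case False
  then have "x \<notin> rel_interior S" using assms(3) rel_interior_nonempty_interior by auto
  then show ?thesis using supporting_hyperplane_rel_boundary[OF assms(1,2)] that by metis
qed

text \<open>A supporting line at \<open>w\<close> carries at most two points of \<open>Q\<close>,
  because \<open>Q\<close> lies on a circle. The case \<open>p = q\<close> occurs when
  \<open>w\<close> is a vertex.\<close>

lemma inscribed_polygon_boundary: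
  fixes Q :: "(real^2) set"
  assumes "finite Q" "Q \<subseteq> sphere z r" "w \<in> convex hull Q" "w \<notin> interior (convex hull Q)"
  obtains p q f where "p \<in> Q" "q \<in> Q" "w \<in> closed_segment p q" "f \<bullet> p = f \<bullet> w" "f \<bullet> q = f \<bullet> w"
    "\<And>s. s \<in> Q \<Longrightarrow> s \<noteq> p \<Longrightarrow> s \<noteq> q \<Longrightarrow> f \<bullet> w < f \<bullet> s"
proof -
  obtain f where f: "f \<noteq> 0" "\<And>y. y \<in> convex hull Q \<Longrightarrow> f \<bullet> w \<le> f \<bullet> y"
    using supporting_functional[OF convex_convex_hull assms(3,4)] by metis
  define Q0 where "Q0 = {s \<in> Q. f \<bullet> s + (- (f \<bullet> w)) = 0}"
  have w: "w \<in> convex hull Q0"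
    unfolding Q0_def by (rule convex_hull_zero_face) (use assms f(2) hull_inc in force)+
  then have "Q0 \<noteq> {}" by auto
  then obtain p where p: "p \<in> Q0" by auto
  obtain q where q: "q \<in> Q0" "Q0 \<subseteq> {p, q}"
  proof (cases "Q0 = {p}")
    case True then show ?thesis using that p by auto
  next
    case False
    then obtain q where q: "q \<in> Q0" "q \<noteq> p" using p by auto
    have "s = p \<or> s = q" if "s \<in> Q0" for s
    proof -
      have "{s, p, q} \<subseteq> sphere z r" using that p q assms(2) unfolding Q0_def by blast
      then show ?thesis
        using sphere_hyperplane_3[OF f(1), of s "f \<bullet> w" p q z r] that p q unfolding Q0_def by auto
    qed
    then show ?thesis using that q by auto
  qed
  have "Q0 = {p, q}" using p q by auto
  then have "w \<in> closed_segment p q" using w by (simp add: segment_convex_hull)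
  moreover have "f \<bullet> w < f \<bullet> s" if "s \<in> Q" "s \<noteq> p" "s \<noteq> q" for s
  proof -
    have "s \<notin> Q0" using q(2) that by auto
    then have "f \<bullet> s \<noteq> f \<bullet> w" using that(1) by (auto simp: Q0_def)
    then show ?thesis using f(2)[of s] that(1) hull_inc[of s Q convex] by force
  qed
  ultimately show ?thesis using that[of p q f] p q unfolding Q0_def by auto
qed

section \<open>Delaunay cells of a maximal separated set\<close>

context
  fixes P :: "(real^2) set" and \<delta> :: real
  assumes P: "gromov \<delta> P" and \<delta>: "\<delta> > 0"
begin

lemma P_separated: "separated \<delta> P"
  using P by (simp add: gromov_def)

lemma P_nonempty: "P \<noteq> {}"
proof -
  obtain p where "p \<in> P" by (rule gromov_dense[OF P \<delta>])
  then show ?thesis by auto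
qed

lemma empty_disc_radius:
  assumes "\<And>p. p \<in> P \<Longrightarrow> r \<le> dist z p"
  shows "r < \<delta>"
proof -
  obtain p where "p \<in> P" "dist z p < \<delta>" by (rule gromov_dense[OF P \<delta>])
  then show ?thesis using assms[of p] by simp
qed

text \<open>The centre of the Delaunay disc of \<open>x\<close> minimises the power of \<open>x\<close> with respect to empty discs.\<close>

lemma delaunay_cell_exists:
  obtains z r where "\<And>p. p \<in> P \<Longrightarrow> r \<le> dist z p" "x \<in> convex hull (P \<inter> sphere z r)"
proof -
  \<comment> \<open>The power of \<open>x\<close> with respect to the largest empty disc about
    \<open>z\<close>.\<close>
  define F where "F z = (dist z x)\<^sup>2 - (infdist z P)\<^sup>2" for z
  have inf_le: "infdist z P \<le> \<delta>" for z
  proof -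
    obtain p where "p \<in> P" "dist z p < \<delta>" using gromov_dense[OF P \<delta>] by metis
    then show ?thesis using infdist_le[of p P z] by linarith
  qed
  have "continuous_on (cball x \<delta>) F" unfolding F_def by (intro continuous_intros)
  moreover have "cball x \<delta> \<noteq> {}" using \<delta> by simp
  ultimately obtain z where z: "z \<in> cball x \<delta>" "\<And>y. y \<in> cball x \<delta> \<Longrightarrow> F z \<le> F y"
    using continuous_attains_inf[OF compact_cball] by metis
  \<comment> \<open>Outside the ball the distance to \<open>x\<close> is at least \<delta>, which
    bounds the radius, so \<open>F\<close> is nonnegative there, whereas \<open>F x\<close> is not
    positive. Minimality on the ball is therefore global.\<close>
  have min: "F z \<le> F y" for y
  proof (cases "y \<in> cball x \<delta>")
    case False
    have "(infdist y P)\<^sup>2 \<le> \<delta>\<^sup>2" using inf_le infdist_nonneg by (intro power_mono)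
    moreover have "\<delta>\<^sup>2 \<le> (dist y x)\<^sup>2" using False \<delta> by (intro power_mono) (auto simp: dist_commute)
    ultimately have "0 \<le> F y" by (simp add: F_def)
    moreover have "F z \<le> F x" using z(2)[of x] \<delta> by simp
    moreover have "F x \<le> 0" by (simp add: F_def)
    ultimately show ?thesis by linarith
  qed (use z in auto)
  define r where "r = infdist z P"
  define Q where "Q = P \<inter> sphere z r"
  have empty: "r \<le> dist z p" if "p \<in> P" for p using infdist_le[OF that] by (simp add: r_def)
  have closedP: "closed P" by (rule separated_closed[OF P_separated \<delta>])
  have "finite Q" unfolding Q_def using separated_finite_bounded[OF P_separated \<delta>] by auto
  obtain q where "q \<in> P" "infdist z P = dist z q" by (rule infdist_attains_inf[OF closedP P_nonempty])
  then have q: "q \<in> Q" by (simp add: Q_def r_def)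
  have "x \<in> convex hull Q"
  proof (rule ccontr)
    assume "x \<notin> convex hull Q"
    moreover have "closed (convex hull Q)"
      using \<open>finite Q\<close> by (simp add: finite_imp_compact_convex_hull compact_imp_closed)
    ultimately obtain u c where u: "u \<bullet> x < c" "\<And>y. y \<in> convex hull Q \<Longrightarrow> c < u \<bullet> y"
      using separating_hyperplane_closed_point[OF convex_convex_hull, of Q x] by metis
    have ux: "u \<bullet> x < u \<bullet> y" if "y \<in> Q" for y using u hull_inc[OF that, of convex] by force
    \<comment> \<open>The points of \<open>P\<close> off the circle keep a positive distance
      \<open>g\<close> from it, since \<open>P - Q\<close> is closed.\<close>
    obtain g where g: "g > 0" "\<And>p. p \<in> P \<Longrightarrow> p \<notin> Q \<Longrightarrow> r + g \<le> dist z p"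
    proof (cases "P - Q = {}")
      case True then show ?thesis using that[of 1] by auto
    next
      case False
      have "separated \<delta> (P - Q)" using P_separated by (auto simp: separated_def)
      then have "closed (P - Q)" using separated_closed \<delta> by metis
      then obtain p' where p': "p' \<in> P - Q" "infdist z (P - Q) = dist z p'"
        by (rule infdist_attains_inf[OF _ False])
      have "dist z p' > r" using p'(1) empty[of p'] by (auto simp: Q_def)
      then show ?thesis
        using that[of "dist z p' - r"] p'(2) infdist_le[of _ "P - Q" z] by auto
    qed
    \<comment> \<open>Moving the centre by less than \<open>g / 2\<close> keeps the points of
      \<open>P\<close> nearest to it in \<open>Q\<close>.\<close>
    define t where "t = g / (2 * norm u + 1) / 2"
    have nu: "2 * norm u + 1 > 0" using norm_ge_zero[of u] by linarith
    have t: "t > 0" using g(1) nu by (simp add: t_def)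
    have "2 * (t * norm u) < g"
    proof -
      have "g * (2 * norm u) < g * (2 * (2 * norm u + 1))" using g(1) nu by (intro mult_strict_left_mono) auto
      then show ?thesis using nu by (simp add: t_def field_simps)
    qed
    \<comment> \<open>As \<open>u\<close> is smaller at \<open>x\<close> than on \<open>Q\<close>,
      moving the centre against \<open>u\<close> lowers the power of \<open>x\<close>, contrary to
      minimality.\<close>
    define y where "y = z - t *\<^sub>R u"
    have yz: "dist z y = t * norm u" using t by (simp add: y_def dist_norm)
    obtain p where p: "p \<in> P" "infdist y P = dist y p"
      by (rule infdist_attains_inf[OF closedP P_nonempty])
    have "p \<in> Q"
    proof (rule ccontr)
      assume "p \<notin> Q"
      have "dist y p \<le> dist y q" using infdist_le[of q P y] q p by (auto simp: Q_def)
      also have "\<dots> \<le> r + t * norm u" using dist_triangle[of y q z] q yz by (auto simp: Q_def dist_commute)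
      finally have "dist z p \<le> r + 2 * (t * norm u)" using dist_triangle[of z p y] yz by linarith
      then show False using g(2)[OF p(1) \<open>p \<notin> Q\<close>] \<open>2 * (t * norm u) < g\<close> by linarith
    qed
    have "F y = (dist y x)\<^sup>2 - (dist y p)\<^sup>2" using p(2) by (simp add: F_def)
    also have "\<dots> = (dist z x)\<^sup>2 - (dist z p)\<^sup>2 + 2 * t * (u \<bullet> x - u \<bullet> p)"
      unfolding y_def dist_norm power2_norm_eq_inner
      by (simp add: inner_diff inner_commute algebra_simps)
    also have "\<dots> = F z + 2 * t * (u \<bullet> x - u \<bullet> p)" using \<open>p \<in> Q\<close> by (simp add: F_def Q_def r_def)
    also have "\<dots> < F z" using ux[OF \<open>p \<in> Q\<close>] t by (simp add: mult_less_0_iff)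
    finally show False using min[of y] by simp
  qed
  then show ?thesis using that empty unfolding Q_def by blast
qed

section \<open>The fan complex is a Delaunay triangulation\<close>

context
  fixes apex :: "(real^2) set \<Rightarrow> real^2"
  assumes apex: "\<And>Q. Q \<noteq> {} \<Longrightarrow> Q \<subseteq> P \<Longrightarrow> apex Q \<in> Q"
begin

text \<open>The ray from the apex through \<open>x\<close> leaves the cell through a boundary chord
  \<open>p q\<close>. Genericity puts \<open>x\<close> into the interior of the cell and keeps the
  triangle \<open>v p q\<close> from degenerating.\<close>

lemma fan_covers_generic:
  assumes generic: "\<And>p q. p \<in> P \<Longrightarrow> q \<in> P \<Longrightarrow> x \<notin> closed_segment p q"
  obtains A where "fan P apex A" "x \<in> convex hull A"
proof -
  obtain z r where zr: "\<And>p. p \<in> P \<Longrightarrow> r \<le> dist z p" "x \<in> convex hull (P \<inter> sphere z r)"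
    using delaunay_cell_exists by metis
  define Q v where "Q = P \<inter> sphere z r" and "v = apex Q"
  have Q: "finite Q" "Q \<subseteq> sphere z r" "Q \<subseteq> P" "x \<in> convex hull Q" "Q \<noteq> {}"
    unfolding Q_def using separated_finite_bounded[OF P_separated \<delta>] zr(2) by auto
  have v: "v \<in> Q" unfolding v_def using apex Q(3,5) by auto
  have "x \<noteq> v" using generic[of v v] v Q(3) by auto
  have int: "x \<in> interior (convex hull Q)"
  proof (rule ccontr)
    assume "x \<notin> interior (convex hull Q)"
    then obtain p q where "p \<in> Q" "q \<in> Q" "x \<in> closed_segment p q"
      using inscribed_polygon_boundary[OF Q(1,2,4)] by metis
    then show False using generic Q(3) by blast
  qed
  have "bounded (convex hull Q)" using Q(1) by (simp add: finite_imp_compact_convex_hull compact_imp_bounded)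
  then obtain d where d: "0 < d" "x + d *\<^sub>R (x - v) \<in> frontier (convex hull Q)"
    using ray_to_frontier[OF _ int, of "x - v"] \<open>x \<noteq> v\<close> by auto
  define y where "y = x + d *\<^sub>R (x - v)"
  have "closed (convex hull Q)"
    using Q(1) by (simp add: finite_imp_compact_convex_hull compact_imp_closed)
  then have y: "y \<in> convex hull Q" "y \<notin> interior (convex hull Q)"
    using d(2) unfolding y_def frontier_def by auto
  obtain p q f where pq: "p \<in> Q" "q \<in> Q" "y \<in> closed_segment p q" "f \<bullet> p = f \<bullet> y" "f \<bullet> q = f \<bullet> y"
    "\<And>s. s \<in> Q \<Longrightarrow> s \<noteq> p \<Longrightarrow> s \<noteq> q \<Longrightarrow> f \<bullet> y < f \<bullet> s"
    using inscribed_polygon_boundary[OF Q(1,2) y] by metis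
  have "x = (1 / (1 + d)) *\<^sub>R y + (d / (1 + d)) *\<^sub>R v"
  proof -
    have "(1 + d) *\<^sub>R x = y + d *\<^sub>R v" by (simp add: y_def algebra_simps)
    then have "(1 / (1 + d)) *\<^sub>R ((1 + d) *\<^sub>R x) = (1 / (1 + d)) *\<^sub>R (y + d *\<^sub>R v)" by simp
    then show ?thesis using d(1) by (simp add: scaleR_add_right)
  qed
  moreover have "y \<in> convex hull {v, p, q}"
    using pq(3) hull_mono[of "{p, q}" "{v, p, q}" convex] by (auto simp: segment_convex_hull)
  moreover have "v \<in> convex hull {v, p, q}" by (simp add: hull_inc)
  moreover have "1 / (1 + d) + d / (1 + d) = 1" using d(1) by (simp add: field_simps)
  ultimately have x: "x \<in> convex hull {v, p, q}"
    using convexD[OF convex_convex_hull, of y "{v, p, q}" v "1 / (1 + d)" "d / (1 + d)"] d(1) by auto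
  have P: "v \<in> P" "p \<in> P" "q \<in> P" using v pq(1,2) Q(3) by auto
  have "p \<noteq> q" using x generic[OF P(1,2)] by (auto simp: segment_convex_hull)
  have "v \<noteq> p" using x generic[OF P(2,3)] by (auto simp: segment_convex_hull)
  have "v \<noteq> q" using x generic[OF P(2,3)] by (auto simp: segment_convex_hull insert_commute)
  have "fan P apex {v, p, q}"
  proof (rule fanI[of P r z v])
    show "f \<bullet> p < f \<bullet> s" if "s \<in> P \<inter> sphere z r" "s \<noteq> p" "s \<noteq> q" for s
      using pq(4) pq(6)[of s] that by (simp add: Q_def)
    show "f \<bullet> p = f \<bullet> q" using pq(4,5) by simp
  qed (use zr(1) v pq(1,2) \<open>p \<noteq> q\<close> \<open>v \<noteq> p\<close> \<open>v \<noteq> q\<close> v_def[unfolded Q_def] in \<open>simp_all only: Q_def not_False_eq_True\<close>)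
  then show ?thesis using that x by blast
qed

lemma fan_triangle_small:
  assumes "fan P apex A" "y \<in> convex hull A"
  shows "A \<subseteq> cball y (2 * \<delta>)"
proof -
  obtain z r where zr: "\<And>p. p \<in> P \<Longrightarrow> r \<le> dist z p" "A \<subseteq> sphere z r"
    using assms(1) unfolding fan_def by blast
  have "A \<subseteq> cball z r" using zr(2) by auto
  then have "convex hull A \<subseteq> cball z r" by (rule hull_minimal) simp
  then have "dist z y \<le> r" using assms(2) by auto
  moreover have "r < \<delta>" by (rule empty_disc_radius[OF zr(1)])
  moreover have "dist z a = r" if "a \<in> A" for a using zr(2) that by auto
  ultimately show ?thesis
    by (smt (verit, best) dist_commute dist_triangle mem_cball subsetI)
qed

lemma fan_locally_finite: "finite {A. fan P apex A \<and> convex hull A \<inter> cball x R \<noteq> {}}"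
proof -
  have "A \<subseteq> P \<inter> cball x (R + 2 * \<delta>)" if A: "fan P apex A" "convex hull A \<inter> cball x R \<noteq> {}" for A
  proof -
    obtain y where y: "y \<in> convex hull A" "dist x y \<le> R" using A(2) by auto
    have "A \<subseteq> cball y (2 * \<delta>)" by (rule fan_triangle_small[OF A(1) y(1)])
    then have "dist x a \<le> R + 2 * \<delta>" if "a \<in> A" for a
      using y(2) dist_triangle[of x a y] that by fastforce
    then show ?thesis using fan_independent(4)[OF A(1)] by auto
  qed
  then have "{A. fan P apex A \<and> convex hull A \<inter> cball x R \<noteq> {}} \<subseteq> Pow (P \<inter> cball x (R + 2 * \<delta>))" by auto
  moreover have "finite (Pow (P \<inter> cball x (R + 2 * \<delta>)))"
    unfolding finite_Pow_iff by (rule separated_finite_Int_cball[OF P_separated \<delta>])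
  ultimately show ?thesis by (rule finite_subset)
qed

text \<open>The points excluded by genericity lie on countably many segments, which form a null set.
  The fan triangles near \<open>x\<close> have a closed union, so missing \<open>x\<close> would
  mean missing a whole ball, up to that null set.\<close>

lemma fan_covers: obtains A where "fan P apex A" "x \<in> convex hull A"
proof (rule ccontr)
  assume no: "\<not> thesis"
  define G where "G = {A. fan P apex A \<and> convex hull A \<inter> cball x 1 \<noteq> {}}"
  have "finite G" unfolding G_def by (rule fan_locally_finite)
  moreover have "closed (convex hull A)" if "A \<in> G" for A
    using that fan_independent(1)[of P apex A]
    by (simp add: G_def finite_imp_compact_convex_hull compact_imp_closed)
  ultimately have "closed (\<Union>A\<in>G. convex hull A)" by (intro closed_UN) auto
  moreover have "x \<in> - (\<Union>A\<in>G. convex hull A)" using no that unfolding G_def by auto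
  ultimately obtain e where e: "e > 0" "ball x e \<subseteq> - (\<Union>A\<in>G. convex hull A)"
    using open_contains_ball open_Compl by metis
  let ?S = "(\<lambda>(p, q). closed_segment p q) ` (P \<times> P)"
  have "ball x (min e 1) \<subseteq> \<Union>?S"
  proof
    fix y assume y: "y \<in> ball x (min e 1)"
    show "y \<in> \<Union>?S"
    proof (rule ccontr)
      assume "y \<notin> \<Union>?S"
      then have "\<And>p q. p \<in> P \<Longrightarrow> q \<in> P \<Longrightarrow> y \<notin> closed_segment p q" by blast
      then obtain A where A: "fan P apex A" "y \<in> convex hull A" using fan_covers_generic by metis
      then have "A \<in> G" using y unfolding G_def by auto
      then show False using e(2) y A(2) by auto
    qed
  qed
  moreover have "negligible (\<Union>?S)"
  proof (rule negligible_countable_Union)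
    show "countable ?S" using separated_countable[OF P_separated \<delta>] by simp
    fix S assume "S \<in> ?S"
    then obtain p q where "S = closed_segment p q" by auto
    then show "negligible S" by (simp add: negligible_convex_interior interior_closed_segment_ge2)
  qed
  ultimately have "negligible (ball x (min e 1))" using negligible_subset by blast
  then show False using open_not_negligible[of "ball x (min e 1)"] e(1) by auto
qed

definition fan_complex :: "(real^2) set set" where
  "fan_complex = {convex hull F |F A. F \<subseteq> A \<and> fan P apex A}"

lemma fan_hull_Int:
  assumes "fan P apex A" "fan P apex B" "F \<subseteq> A" "G \<subseteq> B"
  shows "convex hull F \<inter> convex hull G = convex hull (F \<inter> G)"
proof
  note A = fan_independent(3)[OF assms(1)] and B = fan_independent(3)[OF assms(2)]
  show "convex hull F \<inter> convex hull G \<subseteq> convex hull (F \<inter> G)"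
  proof
    fix x assume x: "x \<in> convex hull F \<inter> convex hull G"
    then have "x \<in> convex hull A \<inter> convex hull B"
      using hull_mono[OF assms(3), of convex] hull_mono[OF assms(4), of convex] by auto
    then have AB: "x \<in> convex hull (A \<inter> B)" using fan_Int_subset[OF assms(1,2)] by auto
    have "x \<in> convex hull (F \<inter> (A \<inter> B))"
      using convex_hull_Int_affine_independent[OF A assms(3), of "A \<inter> B"] x AB by auto
    moreover have "x \<in> convex hull (G \<inter> (A \<inter> B))"
      using convex_hull_Int_affine_independent[OF B assms(4), of "A \<inter> B"] x AB by auto
    ultimately have "x \<in> convex hull ((F \<inter> (A \<inter> B)) \<inter> (G \<inter> (A \<inter> B)))"
      using convex_hull_Int_affine_independent[OF A, of "F \<inter> (A \<inter> B)" "G \<inter> (A \<inter> B)"] by auto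
    then show "x \<in> convex hull (F \<inter> G)"
      using hull_mono[of "(F \<inter> (A \<inter> B)) \<inter> (G \<inter> (A \<inter> B))" "F \<inter> G" convex] by blast
  qed
  show "convex hull (F \<inter> G) \<subseteq> convex hull F \<inter> convex hull G" by (simp add: hull_mono)
qed

lemma fan_complex_cover: "\<Union>fan_complex = UNIV"
proof -
  have "x \<in> \<Union>fan_complex" for x
  proof -
    obtain A where "fan P apex A" "x \<in> convex hull A" by (rule fan_covers)
    then show ?thesis unfolding fan_complex_def by blast
  qed
  then show ?thesis by blast
qed

lemma fan_complex_lf: "lf_simplicial_complex fan_complex"
  unfolding lf_simplicial_complex_def fan_complex_cover
proof (intro conjI ballI allI impI)
  have "\<exists>V. openin euclidean V \<and> x \<in> V \<and> finite {U \<in> fan_complex. U \<inter> V \<noteq> {}}" for x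
  proof (intro exI conjI)
    have "{U \<in> fan_complex. U \<inter> ball x 1 \<noteq> {}} \<subseteq>
        (\<Union>A\<in>{A. fan P apex A \<and> convex hull A \<inter> cball x 1 \<noteq> {}}. (hull) convex ` Pow A)" (is "_ \<subseteq> ?R")
    proof
      fix U assume U: "U \<in> {U \<in> fan_complex. U \<inter> ball x 1 \<noteq> {}}"
      then obtain F A where FA: "U = convex hull F" "F \<subseteq> A" "fan P apex A" unfolding fan_complex_def by auto
      have "convex hull A \<inter> cball x 1 \<noteq> {}"
        using U FA(1) hull_mono[OF FA(2), of convex] ball_subset_cball[of x 1] by auto
      then show "U \<in> ?R" using FA by blast
    qed
    moreover have "finite ?R"
      using fan_locally_finite fan_independent(1) by (intro finite_UN_I) auto
    ultimately show "finite {U \<in> fan_complex. U \<inter> ball x 1 \<noteq> {}}" by (rule finite_subset)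
  qed auto
  then show "locally_finite_in (top_of_set UNIV) fan_complex"
    unfolding locally_finite_in_def by auto
next
  fix S assume "S \<in> fan_complex"
  then obtain F A where FA: "S = convex hull F" "F \<subseteq> A" "fan P apex A" unfolding fan_complex_def by auto
  then have "\<not> affine_dependent F" using fan_independent(3) affine_independent_subset by blast
  then show "\<exists>n. n simplex S"
    using FA(1) by (intro exI[of _ "int (card F) - 1"]) (auto simp: simplex_def)
next
  fix F' S assume F': "S \<in> fan_complex \<and> F' face_of S"
  then obtain F A where FA: "S = convex hull F" "F \<subseteq> A" "fan P apex A" unfolding fan_complex_def by auto
  then have "\<not> affine_dependent F" using fan_independent(3) affine_independent_subset by blast
  then obtain G where "G \<subseteq> F" "F' = convex hull G"
    using F' FA(1) face_of_convex_hull_affine_independent by metis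
  then show "F' \<in> fan_complex" using FA unfolding fan_complex_def by blast
next
  fix S S' assume "S \<in> fan_complex \<and> S' \<in> fan_complex"
  then obtain F A G B where FA: "S = convex hull F" "F \<subseteq> A" "fan P apex A"
      and GB: "S' = convex hull G" "G \<subseteq> B" "fan P apex B" unfolding fan_complex_def by auto
  then have "\<not> affine_dependent F" using fan_independent(3) affine_independent_subset by blast
  moreover have "S \<inter> S' = convex hull (F \<inter> G)" using fan_hull_Int[OF FA(3) GB(3) FA(2) GB(2)] FA GB by simp
  ultimately show "S \<inter> S' face_of S"
    using face_of_convex_hull_affine_independent FA(1) by (metis Int_lower1)
qed

lemma fan_complex_vertices: "vertices fan_complex = P"
proof
  show "vertices fan_complex \<subseteq> P"
  proof
    fix v assume "v \<in> vertices fan_complex"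
    then obtain F A where FA: "{v} = convex hull F" "F \<subseteq> A" "fan P apex A"
      unfolding fan_complex_def vertices_def by auto
    then have "F \<noteq> {}" "F \<subseteq> {v}" using hull_subset[of F convex] by auto
    then show "v \<in> P" using FA(2) fan_independent(4)[OF FA(3)] by auto
  qed
  show "P \<subseteq> vertices fan_complex"
  proof
    fix p assume p: "p \<in> P"
    obtain A where A: "fan P apex A" "p \<in> convex hull A" using fan_covers by metis
    obtain z r where zr: "\<And>p. p \<in> P \<Longrightarrow> r \<le> dist z p" "A \<subseteq> sphere z r"
      using A(1) unfolding fan_def by blast
    \<comment> \<open>The point \<open>p\<close> is not inside the empty disc, but belongs to a
      triangle inscribed in it; hence it lies on the circle and is a vertex of the triangle.\<close>
    have "convex hull A \<subseteq> cball z r" using zr(2) by (intro hull_minimal) auto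
    then have "p \<in> sphere z r" using zr(1)[OF p] A(2) by fastforce
    then have "p \<in> convex hull A \<inter> sphere z r" using A(2) by blast
    then have "p \<in> A" unfolding convex_hull_Int_sphere[OF fan_independent(1)[OF A(1)] zr(2)] .
    then have "convex hull {p} \<in> fan_complex" using A(1) unfolding fan_complex_def by blast
    then show "p \<in> vertices fan_complex" by (simp add: vertices_def)
  qed
qed

lemma fan_complex_delaunay: "delaunay_triangulation P fan_complex"
  unfolding delaunay_triangulation_def triangulation_of_def
proof (intro conjI ballI allI impI)
  show "discrete P" by (rule separated_discrete[OF P_separated \<delta>])
  show "lf_simplicial_complex fan_complex" by (rule fan_complex_lf)
  show "vertices fan_complex = P" by (rule fan_complex_vertices)
  show "\<Union>fan_complex = convex hull P" using fan_complex_cover gromov_convex_hull[OF P \<delta>] by simp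
  fix \<Delta> z r assume \<Delta>: "\<Delta> \<in> triangles fan_complex" "{v. v extreme_point_of \<Delta>} \<subseteq> sphere z r"
  then obtain F A where FA: "\<Delta> = convex hull F" "F \<subseteq> A" "fan P apex A"
    unfolding triangles_def fan_complex_def by auto
  have ind: "\<not> affine_dependent F" using FA fan_independent(3) affine_independent_subset by blast
  have "2 simplex \<Delta>" using \<Delta>(1) by (simp add: triangles_def)
  then obtain C where C: "\<not> affine_dependent C" "int (card C) = 3" "\<Delta> = convex hull C" unfolding simplex_def by auto
  have "F = C" using convex_hull_affine_independent_inject[OF ind C(1)] FA(1) C(3) by simp
  then have "F = A"
    using C(2) FA(2) fan_independent(1,2)[OF FA(3)] card_subset_eq[of A F] by auto
  obtain w s v a b where ws: "\<And>p. p \<in> P \<Longrightarrow> s \<le> dist w p" "{v, a, b} \<subseteq> sphere w s" "A = {v, a, b}"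
      "v \<noteq> a" "v \<noteq> b" "a \<noteq> b"
    using FA(3) unfolding fan_def by blast
  have "A \<subseteq> sphere z r"
    using \<Delta>(2) extreme_point_of_convex_hull_affine_independent[OF ind] \<open>F = A\<close> FA(1) by auto
  then have "z = w \<and> r = s" using circle_unique[of v a b z r w s] ws by auto
  then show "interior (cball z r) \<inter> P = {}" using ws(1) by fastforce
qed

lemma fan_in_complex: "fan P apex A \<Longrightarrow> convex hull A \<in> fan_complex"
  unfolding fan_complex_def by blast

end
end

section \<open>Corners of Delaunay triangles\<close>

text \<open>The squared law of sines for the side \<open>a b\<close> and the angle at
  \<open>v\<close>, with the sine expressed through inner products.\<close>

lemma circumradius_sine:
  fixes a b z v :: "real^2"
  assumes "dist z a = dist z v" "dist z b = dist z v"
  shows "(dist a b)\<^sup>2 * (dist v a)\<^sup>2 * (dist v b)\<^sup>2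
    = 4 * (dist z v)\<^sup>2 * ((dist v a)\<^sup>2 * (dist v b)\<^sup>2 - ((a - v) \<bullet> (b - v))\<^sup>2)"
proof -
  define A B C where "A = a - v" and "B = b - v" and "C = z - v"
  have 1: "A \<bullet> A = 2 * (A \<bullet> C)" "B \<bullet> B = 2 * (B \<bullet> C)"
    using assms unfolding A_def B_def C_def dist_norm norm_eq
    by (simp_all add: inner_diff inner_commute algebra_simps)
  have 2: "(dist a b)\<^sup>2 = (A - B) \<bullet> (A - B)" "(dist v a)\<^sup>2 = A \<bullet> A" "(dist v b)\<^sup>2 = B \<bullet> B" "(dist z v)\<^sup>2 = C \<bullet> C"
    by (simp_all add: A_def B_def C_def dist_norm power2_norm_eq_inner inner_diff inner_commute algebra_simps)
  \<comment> \<open>The inversion identity \<open>|A - B| = |A| |B| |A / |A|^2 - B / |B|^2|\<close>,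
    squared and cleared of denominators.\<close>
  have 3: "(A - B) \<bullet> (A - B) * (A \<bullet> A) * (B \<bullet> B)
      = ((A \<bullet> A) *\<^sub>R B - (B \<bullet> B) *\<^sub>R A) \<bullet> ((A \<bullet> A) *\<^sub>R B - (B \<bullet> B) *\<^sub>R A)"
    by (simp add: inner_diff inner_commute algebra_simps power2_eq_square)
  have "(A - B) \<bullet> (A - B) * (A \<bullet> A) * (B \<bullet> B) = 4 * (C \<bullet> C) * ((A \<bullet> A) * (B \<bullet> B) - (A \<bullet> B)\<^sup>2)"
  proof -
    have "(A \<bullet> A) * (B \<bullet> B) - (A \<bullet> B)\<^sup>2 = (A $ 1 * B $ 2 - A $ 2 * B $ 1)\<^sup>2"
      unfolding inner_real2 by algebra
    moreover have "((A \<bullet> A) *\<^sub>R B - (B \<bullet> B) *\<^sub>R A) \<bullet> ((A \<bullet> A) *\<^sub>R B - (B \<bullet> B) *\<^sub>R A)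
        = 4 * (C \<bullet> C) * (A $ 1 * B $ 2 - A $ 2 * B $ 1)\<^sup>2"
      unfolding 1 unfolding inner_real2 by simp algebra
    ultimately show ?thesis unfolding 3 by simp
  qed
  then show ?thesis unfolding 2 A_def[symmetric] B_def[symmetric] .
qed

text \<open>Setting of the planar lemmas up to \<open>beyond_chord_in_sector\<close>: the centre is
  the origin, the chord has ends \<open>(s, k)\<close> and \<open>(-s, k)\<close>, and
  \<open>(p, q)\<close> is a point of the circle below it. Here \<open>far\<close> says that this
  point is farther than \<open>r\<close> from both ends. As \<open>k\<close> is \<open>r\<close>
  times the cosine of the inscribed angle at \<open>(p, q)\<close>, the claims are that this angle
  is below 120 degrees and that \<open>(p, q)\<close> lies low on its arc if the angle exceeds 60
  degrees.\<close>

lemma chord_height: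
  fixes k p q r s :: real
  assumes r: "0 < r" and sk: "s\<^sup>2 + k\<^sup>2 = r\<^sup>2" and pq: "p\<^sup>2 + q\<^sup>2 = r\<^sup>2" and "0 < s" "q < k"
    and far: "p * s + q * k < r\<^sup>2 / 2" "- p * s + q * k < r\<^sup>2 / 2"
  shows "- r / 2 < k" and "k < r / 2 \<Longrightarrow> q \<le> - r / 2"
proof -
  have far': "\<bar>p\<bar> * s + q * k < r\<^sup>2 / 2" using far by (cases "0 \<le> p") auto
  have sq: "(\<bar>p\<bar> * s)\<^sup>2 = (r\<^sup>2 - q\<^sup>2) * (r\<^sup>2 - k\<^sup>2)"
    using sk pq by (simp add: power_mult_distrib flip: sk pq)
  have "q\<^sup>2 \<le> r\<^sup>2" "k\<^sup>2 \<le> r\<^sup>2" using sk pq zero_le_power2[of p] zero_le_power2[of s] by linarith+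
  then have qr: "\<bar>q\<bar> \<le> r" "\<bar>k\<bar> \<le> r" using r by (simp_all add: abs_le_square_iff[of _ r, symmetric])
  show 1: "- r / 2 < k"
  proof (rule ccontr)
    assume "\<not> - r / 2 < k"
    then have k: "k \<le> - r / 2" by simp
    \<comment> \<open>Prepares \<open>(\<bar>p\<bar> * s)^2 - (k * (r + q))^2 = (r + q) * r * (r^2 -
      q * r - 2 * k^2)\<close>; its sign gives a lower bound for \<open>\<bar>p\<bar> * s\<close>
      that contradicts \<open>far'\<close>.\<close>
    have "0 \<le> (r - 2 * k) * (r + k)" using k qr r by (intro mult_nonneg_nonneg) auto
    moreover have "0 \<le> (k - q) * r" using \<open>q < k\<close> r by simp
    ultimately have "0 \<le> r\<^sup>2 - q * r - 2 * k\<^sup>2" by (simp add: algebra_simps power2_eq_square)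
    then have "0 \<le> (r + q) * (r * (r\<^sup>2 - q * r - 2 * k\<^sup>2))" using r qr by (intro mult_nonneg_nonneg) auto
    also have "\<dots> = (\<bar>p\<bar> * s)\<^sup>2 - (- k * (r + q))\<^sup>2"
      unfolding sq by (simp add: algebra_simps power2_eq_square)
    finally have "(- k * (r + q))\<^sup>2 \<le> (\<bar>p\<bar> * s)\<^sup>2" by simp
    then have "- k * (r + q) \<le> \<bar>p\<bar> * s" using power2_le_imp_le[of "- k * (r + q)" "\<bar>p\<bar> * s"] \<open>0 < s\<close> by simp
    then have "- k * r < r\<^sup>2 / 2" using far' by (simp add: algebra_simps)
    moreover have "r * (r / 2) \<le> r * (- k)" using k r by (intro mult_left_mono) auto
    ultimately show False by (simp add: power2_eq_square algebra_simps)
  qed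
  show "q \<le> - r / 2" if k: "k < r / 2"
  proof (rule ccontr)
    assume "\<not> q \<le> - r / 2"
    then have "\<bar>q\<bar> \<le> r / 2" "\<bar>k\<bar> \<le> r / 2" using k 1 \<open>q < k\<close> by auto
    then have q2: "q\<^sup>2 \<le> (r / 2)\<^sup>2" "k\<^sup>2 \<le> (r / 2)\<^sup>2" "\<bar>q\<bar> * \<bar>k\<bar> \<le> (r / 2) * (r / 2)"
      using r mult_mono[of "\<bar>q\<bar>" "r / 2" "\<bar>k\<bar>" "r / 2"] by (simp_all add: abs_le_square_iff[symmetric])
    have "(r\<^sup>2 * (3/4)) * (r\<^sup>2 * (3/4)) \<le> (r\<^sup>2 - q\<^sup>2) * (r\<^sup>2 - k\<^sup>2)"
      using q2 \<open>q\<^sup>2 \<le> r\<^sup>2\<close> by (intro mult_mono) (auto simp: power_divide)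
    then have "(r\<^sup>2 * (3/4))\<^sup>2 \<le> (\<bar>p\<bar> * s)\<^sup>2" unfolding sq by (simp add: power2_eq_square)
    then have "r\<^sup>2 * (3/4) \<le> \<bar>p\<bar> * s" using power2_le_imp_le[of "r\<^sup>2 * (3/4)" "\<bar>p\<bar> * s"] \<open>0 < s\<close> by simp
    moreover have "- (r\<^sup>2 / 4) \<le> q * k" using q2(3) by (simp add: abs_mult[symmetric] power2_eq_square)
    ultimately show False using far' by simp
  qed
qed

text \<open>By \<open>far\<close> the point \<open>(x, y)\<close> is farther than \<open>r\<close>
  from the chord end \<open>(s, k)\<close>. If it were not between the vertical axis and the ray
  through \<open>(s, k)\<close>, it would leave the disc (\<open>k\<close> nonnegative) or come too
  close to that end (\<open>k\<close> negative).\<close>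

lemma cap_point_in_sector:
  fixes k r s x y :: real
  assumes sk: "s\<^sup>2 + k\<^sup>2 = r\<^sup>2" and "0 < s" and "0 \<le> x" and xy: "x\<^sup>2 + y\<^sup>2 \<le> r\<^sup>2" and "k \<le> y"
    and far: "0 < x\<^sup>2 + y\<^sup>2 - 2 * (x * s + y * k)"
  shows "k * x \<le> s * y"
proof (rule ccontr)
  assume "\<not> k * x \<le> s * y"
  then have lt: "s * y < k * x" by simp
  show False
  proof (cases "0 \<le> k")
    case True
    have "s * k \<le> s * y" using \<open>k \<le> y\<close> \<open>0 < s\<close> by simp
    then have "k * s < k * x" using lt by (simp add: mult.commute)
    then have "s < x" using True by (simp add: mult_less_cancel_left)
    then have "s\<^sup>2 < x\<^sup>2" using \<open>0 < s\<close> by (intro power_strict_mono) auto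
    moreover have "k\<^sup>2 \<le> y\<^sup>2" using True \<open>k \<le> y\<close> by (intro power_mono) auto
    ultimately show False using xy sk by linarith
  next
    case False
    have "k * x \<le> 0" using False \<open>0 \<le> x\<close> by (simp add: mult_nonpos_nonneg)
    then have "s * y < 0" using lt by linarith
    then have "y < 0" using \<open>0 < s\<close> by (simp add: mult_less_0_iff)
    have "k * s \<le> s * y" using \<open>k \<le> y\<close> \<open>0 < s\<close> by (simp add: mult.commute)
    then have "k * s < k * x" using lt by simp
    then have "x < s" using False by (simp add: mult_less_cancel_left)
    then have "x * (x - 2 * s) \<le> 0" using \<open>0 \<le> x\<close> \<open>0 < s\<close> by (intro mult_nonneg_nonpos) auto
    moreover have "y * (y - 2 * k) \<le> 0" using \<open>y < 0\<close> \<open>k \<le> y\<close> False by (intro mult_nonpos_nonneg) auto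
    ultimately show False using far by (simp add: power2_eq_square algebra_simps)
  qed
qed

text \<open>Oblique coordinates along the arc midpoint \<open>(0, r)\<close> and the chord end
  \<open>(s, k)\<close>. The last two identities are the squared norm and the inner product with
  \<open>(s, k)\<close>.\<close>

lemma sector_coordinates:
  fixes k r s x y :: real
  assumes sk: "s\<^sup>2 + k\<^sup>2 = r\<^sup>2" and "0 < s" "0 < r" "0 \<le> x" "k * x \<le> s * y"
  obtains l m where "0 \<le> l" "0 \<le> m" "x = m * s" "y = l * r + m * k"
    "x\<^sup>2 + y\<^sup>2 = r\<^sup>2 * (l\<^sup>2 + m\<^sup>2) + 2 * (l * m) * (r * k)" "x * s + y * k = m * r\<^sup>2 + l * (r * k)"
proof -
  define l m where "l = (s * y - k * x) / (r * s)" and "m = x / s"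
  have lm: "0 \<le> l" "0 \<le> m" using assms by (simp_all add: l_def m_def)
  have x: "x = m * s" using \<open>0 < s\<close> by (simp add: m_def)
  have y: "y = l * r + m * k" using \<open>0 < s\<close> \<open>0 < r\<close> by (simp add: l_def m_def field_simps)
  show ?thesis
  proof (rule that[OF lm x y])
    show "x\<^sup>2 + y\<^sup>2 = r\<^sup>2 * (l\<^sup>2 + m\<^sup>2) + 2 * (l * m) * (r * k)"
      unfolding x y sk[symmetric] by (simp add: power2_eq_square algebra_simps) (use sk in algebra)
    show "x * s + y * k = m * r\<^sup>2 + l * (r * k)"
      unfolding x y sk[symmetric] by (simp add: power2_eq_square algebra_simps)
  qed
qed

text \<open>Suppose the point is farther than \<open>r\<close> from both \<open>(s, k)\<close> and
  \<open>(0, r)\<close>. Weighting the two inequalities with its coordinates \<open>m\<close> and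
  \<open>l\<close> gives \<open>l + m > 2\<close>; as the two vectors enclose less than 120 degrees,
  its norm then exceeds \<open>r\<close>.\<close>

lemma cap_covered_half:
  fixes k r s x y :: real
  assumes sk: "s\<^sup>2 + k\<^sup>2 = r\<^sup>2" and "0 < s" "0 < r" "- r / 2 < k" "0 \<le> x" and xy: "x\<^sup>2 + y\<^sup>2 \<le> r\<^sup>2" and "k \<le> y"
    and far: "0 < x\<^sup>2 + y\<^sup>2 - 2 * (x * s + y * k)"
  shows "x\<^sup>2 + y\<^sup>2 \<le> 2 * (r * y)"
proof (rule ccontr)
  assume "\<not> ?thesis"
  then have far2: "2 * (r * y) < x\<^sup>2 + y\<^sup>2" by simp
  have "k * x \<le> s * y" using cap_point_in_sector assms by blast
  then obtain l m where lm: "0 \<le> l" "0 \<le> m" "x = m * s" "y = l * r + m * k"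
    "x\<^sup>2 + y\<^sup>2 = r\<^sup>2 * (l\<^sup>2 + m\<^sup>2) + 2 * (l * m) * (r * k)" "x * s + y * k = m * r\<^sup>2 + l * (r * k)"
    using sector_coordinates[OF sk \<open>0 < s\<close> \<open>0 < r\<close> \<open>0 \<le> x\<close>] by metis
  define N where "N = x\<^sup>2 + y\<^sup>2"
  have N0: "0 \<le> N" unfolding N_def by simp
  have "N \<noteq> 0" using far2 unfolding N_def by (auto simp: sum_power2_eq_zero_iff)
  then have N: "0 < N" using N0 by linarith
  have "l \<noteq> 0 \<or> m \<noteq> 0" using N lm(5) unfolding N_def by auto
  have "l * (2 * (r * y)) + m * (2 * (x * s + y * k)) = 2 * N"
    unfolding N_def lm(5,6) by (simp add: lm(4) power2_eq_square algebra_simps)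
  moreover have "l * (2 * (r * y)) + m * (2 * (x * s + y * k)) < (l + m) * N"
  proof (cases "l = 0")
    case True
    then have "0 < m" using \<open>l \<noteq> 0 \<or> m \<noteq> 0\<close> lm(2) by auto
    then show ?thesis using True far unfolding N_def by simp
  next
    case False
    then have "l * (2 * (r * y)) < l * N" using far2 lm(1) unfolding N_def by simp
    moreover have "m * (2 * (x * s + y * k)) \<le> m * N" using far lm(2) unfolding N_def by (intro mult_left_mono) auto
    ultimately show ?thesis by (simp add: distrib_right)
  qed
  ultimately have "2 * N < (l + m) * N" by simp
  then have "2 < l + m" using N by simp
  then have "2\<^sup>2 < (l + m)\<^sup>2" by (intro power_strict_mono) auto
  then have "r\<^sup>2 * 4 < r\<^sup>2 * (l + m)\<^sup>2" using \<open>0 < r\<close> by simp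
  moreover have "r\<^sup>2 * (l + m)\<^sup>2 \<le> 4 * (r\<^sup>2 * (l\<^sup>2 + m\<^sup>2 - l * m))"
  proof -
    have "0 \<le> 3 * (r * (l - m))\<^sup>2" by simp
    then show ?thesis by (simp add: power2_eq_square algebra_simps)
  qed
  moreover have "r\<^sup>2 * (l\<^sup>2 + m\<^sup>2 - l * m) \<le> N"
  proof -
    have "(l * m) * (r * (- r / 2)) \<le> (l * m) * (r * k)"
      using assms(3,4) lm(1,2) by (intro mult_left_mono) auto
    then show ?thesis unfolding N_def lm(5) by (simp add: power2_eq_square algebra_simps)
  qed
  ultimately show False using xy unfolding N_def by linarith
qed

lemma cap_covered:
  fixes k r s x y :: real
  assumes "s\<^sup>2 + k\<^sup>2 = r\<^sup>2" "0 < s" "0 < r" "- r / 2 < k" "x\<^sup>2 + y\<^sup>2 \<le> r\<^sup>2" "k \<le> y"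
    and far: "r\<^sup>2 < (x - s)\<^sup>2 + (y - k)\<^sup>2" "r\<^sup>2 < (x + s)\<^sup>2 + (y - k)\<^sup>2"
  shows "x\<^sup>2 + (y - r)\<^sup>2 \<le> r\<^sup>2"
proof -
  have "0 < \<bar>x\<bar>\<^sup>2 + y\<^sup>2 - 2 * (\<bar>x\<bar> * s + y * k)"
    using far assms(1) by (cases "0 \<le> x") (simp_all add: power2_eq_square algebra_simps)
  then have "\<bar>x\<bar>\<^sup>2 + y\<^sup>2 \<le> 2 * (r * y)"
    using cap_covered_half[of s k r "\<bar>x\<bar>" y] assms by simp
  then show ?thesis by (simp add: power2_eq_square algebra_simps)
qed

text \<open>The right-hand side is the squared distance from the arc midpoint \<open>(0, r)\<close>
  to the chord ends: if some point of the cap is at least \<open>d\<close> away from both ends, so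
  is the arc midpoint.\<close>

lemma cap_height_bound:
  fixes d k r s x y :: real
  assumes sk: "s\<^sup>2 + k\<^sup>2 = r\<^sup>2" and s: "0 < s" and r: "0 < r" and xy: "x\<^sup>2 + y\<^sup>2 \<le> r\<^sup>2" and "k \<le> y"
    and "0 < d" "r < d"
    and far: "d\<^sup>2 \<le> (x - s)\<^sup>2 + (y - k)\<^sup>2" "d\<^sup>2 \<le> (x + s)\<^sup>2 + (y - k)\<^sup>2"
  shows "d\<^sup>2 \<le> 2 * r\<^sup>2 - 2 * r * k"
proof -
  define u where "u = \<bar>x\<bar>"
  define N B where "N = sqrt (u\<^sup>2 + y\<^sup>2)" and "B = u * s + y * k"
  have rd: "r\<^sup>2 < d\<^sup>2" using assms by (intro power_strict_mono) auto
  have N2: "N\<^sup>2 = u\<^sup>2 + y\<^sup>2" "0 \<le> N" by (simp_all add: N_def)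
  have f: "d\<^sup>2 - r\<^sup>2 \<le> N\<^sup>2 - 2 * B"
    using far sk unfolding N2 B_def u_def by (cases "0 \<le> x") (simp_all add: power2_eq_square algebra_simps)
  have "k * u \<le> s * y"
    using cap_point_in_sector[OF sk s, of u y] f rd xy \<open>k \<le> y\<close> unfolding N2 B_def u_def by simp
  then obtain l m where lm: "0 \<le> l" "0 \<le> m"
    "u\<^sup>2 + y\<^sup>2 = r\<^sup>2 * (l\<^sup>2 + m\<^sup>2) + 2 * (l * m) * (r * k)" "u * s + y * k = m * r\<^sup>2 + l * (r * k)"
    using sector_coordinates[OF sk s r, of u y] unfolding u_def by (metis abs_ge_zero)
  have "k\<^sup>2 \<le> r\<^sup>2" using sk zero_le_power2[of s] by linarith
  then have kr: "k \<le> r" by (rule power2_le_imp_le) (use r in simp)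
  have "N\<^sup>2 \<le> r\<^sup>2" using xy unfolding N2 u_def by simp
  then have Nr: "N \<le> r" by (rule power2_le_imp_le) (use r in simp)
  \<comment> \<open>In the sector the angle to \<open>(s, k)\<close> is at most the one between
    \<open>(0, r)\<close> and \<open>(s, k)\<close>, whose cosine is \<open>k / r\<close>.\<close>
  have Bk: "N * k \<le> B"
  proof (cases "0 \<le> k")
    case True
    have "l * m * (r * k) \<le> l * m * (r * r)" using kr r lm by (intro mult_left_mono) auto
    then have "N\<^sup>2 \<le> (r * (l + m))\<^sup>2" unfolding N2 lm(3) by (simp add: power2_eq_square algebra_simps)
    then have "N \<le> r * (l + m)" by (rule power2_le_imp_le) (use r lm(1,2) in simp)
    then have "N * k \<le> r * (l + m) * k" using True by (intro mult_right_mono)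
    also have "\<dots> \<le> B"
    proof -
      have "m * (r * k) \<le> m * (r * r)" using kr r lm by (intro mult_left_mono) auto
      then show ?thesis unfolding B_def lm(4) by (simp add: power2_eq_square algebra_simps)
    qed
    finally show ?thesis .
  next
    case False
    have "\<bar>y\<bar> \<le> N" unfolding N_def by (rule real_le_rsqrt) simp
    then have "N * k \<le> y * k" using False by (intro mult_right_mono_neg) auto
    also have "\<dots> \<le> B" using s by (simp add: B_def u_def)
    finally show ?thesis .
  qed
  have "N\<^sup>2 - 2 * B \<le> N\<^sup>2 - 2 * (N * k)" using Bk by simp
  also have "\<dots> = N * (N - 2 * k)" by (simp add: power2_eq_square algebra_simps)
  also have "\<dots> \<le> r * (r - 2 * k)"
  proof (rule mult_mono[OF Nr])
    have "0 < N\<^sup>2 - 2 * (N * k)" using f rd Bk by simp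
    then have "0 < N * (N - 2 * k)" by (simp add: power2_eq_square algebra_simps)
    then show "0 \<le> N - 2 * k" using N2(2) by (simp add: zero_less_mult_iff)
  qed (use Nr r N2 in auto)
  finally show ?thesis using f by (simp add: power2_eq_square algebra_simps)
qed

text \<open>The inequality says that the segment from \<open>(p, q)\<close> to \<open>(0, h)\<close>
  crosses height \<open>k\<close> strictly between the chord ends, so \<open>(0, h)\<close> lies in
  the open sector at \<open>(p, q)\<close>. The difference of the squared sides has the factor
  \<open>k - q\<close>.\<close>

lemma beyond_chord_in_sector:
  fixes h k p q r s :: real
  assumes sk: "s\<^sup>2 + k\<^sup>2 = r\<^sup>2" and pq: "p\<^sup>2 + q\<^sup>2 = r\<^sup>2" and "0 < s" "0 < r" "q < k"
    and k: "- r / 2 < k" "k < r / 2" and q: "q \<le> - r / 2" and h: "r < h"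
  shows "\<bar>p\<bar> * (h - k) < s * (h - q)"
proof -
  have "q\<^sup>2 \<le> r\<^sup>2" using pq zero_le_power2[of p] by linarith
  then have "\<bar>q\<bar> \<le> r" using \<open>0 < r\<close> by (simp add: abs_le_square_iff[of _ r, symmetric])
  then have "\<bar>k\<bar> * \<bar>q\<bar> \<le> r * r" using k \<open>0 < r\<close> by (intro mult_mono) auto
  then have "0 \<le> r\<^sup>2 + k * q" by (simp add: abs_mult[symmetric] power2_eq_square)
  then have "0 \<le> 2 * h * (r\<^sup>2 + k * q)" using h \<open>0 < r\<close> by simp
  moreover have "0 < - (q + k) * (r\<^sup>2 + h\<^sup>2)"
    using k q \<open>0 < r\<close> zero_le_power2[of h] by (intro mult_pos_pos add_pos_nonneg) auto
  ultimately have "0 < (k - q) * (2 * h * (r\<^sup>2 + k * q) - (q + k) * (r\<^sup>2 + h\<^sup>2))"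
    using \<open>q < k\<close> by (intro mult_pos_pos) linarith+
  also have "\<dots> = (r\<^sup>2 - k\<^sup>2) * (h - q)\<^sup>2 - (r\<^sup>2 - q\<^sup>2) * (h - k)\<^sup>2"
    by (simp add: power2_eq_square algebra_simps)
  also have "\<dots> = (s * (h - q))\<^sup>2 - (\<bar>p\<bar> * (h - k))\<^sup>2"
  proof -
    have "r\<^sup>2 - k\<^sup>2 = s\<^sup>2" "r\<^sup>2 - q\<^sup>2 = p\<^sup>2" using sk pq by linarith+
    then show ?thesis by (simp add: power_mult_distrib)
  qed
  finally have "(\<bar>p\<bar> * (h - k))\<^sup>2 < (s * (h - q))\<^sup>2" by simp
  then show ?thesis by (rule power2_less_imp_less) (use \<open>0 < s\<close> q h \<open>0 < r\<close> in simp)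
qed

lemma planar_frame:
  fixes a b v :: "real^2"
  assumes "a \<noteq> b"
  obtains e n :: "real^2" where "\<And>u w. u \<bullet> w = (e \<bullet> u) * (e \<bullet> w) + (n \<bullet> u) * (n \<bullet> w)"
    "e \<bullet> n = 0" "n \<bullet> n = 1" "e \<bullet> a < e \<bullet> b" "n \<bullet> a = n \<bullet> b" "n \<bullet> v \<le> n \<bullet> a"
proof -
  define e m n where "e = sgn (b - a)" and "m = (vector [- (e $ 2), e $ 1] :: real^2)"
    and "n = (if m \<bullet> v \<le> m \<bullet> a then m else - m)"
  have ee: "e \<bullet> e = 1" using assms by (simp add: e_def norm_sgn dot_square_norm)
  then have e1: "e $ 1 * e $ 1 + e $ 2 * e $ 2 = 1" by (simp add: inner_real2)
  have m: "m $ 1 = - (e $ 2)" "m $ 2 = e $ 1" by (simp_all add: m_def)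
  have id: "u \<bullet> w = (e \<bullet> u) * (e \<bullet> w) + (m \<bullet> u) * (m \<bullet> w)" for u w
  proof -
    have "(e \<bullet> u) * (e \<bullet> w) + (m \<bullet> u) * (m \<bullet> w) = (e $ 1 * e $ 1 + e $ 2 * e $ 2) * (u \<bullet> w)"
      unfolding inner_real2 m by (simp add: algebra_simps)
    then show ?thesis using e1 by simp
  qed
  have eb: "e \<bullet> (b - a) > 0"
    using assms unfolding e_def sgn_div_norm by (simp add: dot_square_norm)
  have "norm (b - a) *\<^sub>R e = b - a" using assms by (simp add: e_def sgn_div_norm)
  moreover have "m \<bullet> e = 0" unfolding inner_real2 m by simp
  ultimately have "m \<bullet> (b - a) = 0" by (metis inner_scaleR_right mult_zero_right)
  then have mab: "m \<bullet> a = m \<bullet> b" by (simp add: inner_diff_right)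
  show ?thesis
  proof (rule that[of e n])
    show "u \<bullet> w = (e \<bullet> u) * (e \<bullet> w) + (n \<bullet> u) * (n \<bullet> w)" for u w using id[of u w] by (simp add: n_def)
    show "e \<bullet> n = 0" using \<open>m \<bullet> e = 0\<close> by (simp add: n_def inner_commute)
    have "m \<bullet> m = 1" unfolding inner_real2 m using e1 by simp
    then show "n \<bullet> n = 1" by (simp add: n_def)
    show "e \<bullet> a < e \<bullet> b" using eb by (simp add: inner_diff_right)
    show "n \<bullet> a = n \<bullet> b" using mab by (simp add: n_def)
    show "n \<bullet> v \<le> n \<bullet> a" by (auto simp: n_def)
  qed
qed

text \<open>Otherwise \<open>|p - w|^2 - |z - w|^2\<close>, an affine function of \<open>w\<close>,
  would be positive at all three vertices, whereas at \<open>p\<close> it equals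
  \<open>- |z - p|^2\<close>. It is a power difference for circles of radius 0.\<close>

lemma vertex_within_circumradius:
  fixes z :: "'a::euclidean_space"
  assumes "dist z a = r" "dist z b = r" "dist z c = r" "p \<in> convex hull {a, b, c}"
  shows "\<exists>w\<in>{a, b, c}. dist w p \<le> r"
proof (rule ccontr)
  assume "\<not> ?thesis"
  then have far: "\<And>w. w \<in> {a, b, c} \<Longrightarrow> r < dist w p" by auto
  have r: "0 \<le> r" using assms(1) by auto
  have pos: "0 < (2 *\<^sub>R (z - p)) \<bullet> w + (p \<bullet> p - z \<bullet> z)" if "w \<in> {a, b, c}" for w
  proof -
    have "r\<^sup>2 < (dist p w)\<^sup>2" using far[OF that] r by (intro power_strict_mono) (auto simp: dist_commute)
    moreover have "dist z w = r" using that assms by auto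
    ultimately have "0 < disc_power p 0 w - disc_power z 0 w" by (simp add: disc_power_def)
    then show ?thesis unfolding disc_power_diff by simp
  qed
  have "p \<in> convex hull {w \<in> {a, b, c}. (2 *\<^sub>R (z - p)) \<bullet> w + (p \<bullet> p - z \<bullet> z) = 0}"
  proof (rule convex_hull_zero_face)
    have "(2 *\<^sub>R (z - p)) \<bullet> p + (p \<bullet> p - z \<bullet> z) = - ((dist z p)\<^sup>2)"
      by (simp add: dist_norm power2_norm_eq_inner inner_diff inner_commute algebra_simps)
    then show "(2 *\<^sub>R (z - p)) \<bullet> p + (p \<bullet> p - z \<bullet> z) \<le> 0" by simp
  qed (use pos less_imp_le assms(4) in \<open>auto simp del: inner_scaleR_left\<close>)
  moreover have "{w \<in> {a, b, c}. (2 *\<^sub>R (z - p)) \<bullet> w + (p \<bullet> p - z \<bullet> z) = 0} = {}" using pos by force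
  ultimately have "p \<in> convex hull {}" by (simp only:)
  then show False by simp
qed

text \<open>By the law of sines, \<open>mv\<close> makes the angle at \<open>a\<close> between
  \<open>m\<close> and \<open>v\<close> have sine at least \<open>sqrt 3 / 2\<close>, hence cosine
  at most 1/2 in absolute value. The constants leave a margin for moving \<open>m\<close> by
  \<open>\<delta> / 100\<close>.\<close>

lemma arc_midpoint_far_from_side:
  fixes a m v z :: "real^2"
  assumes z: "dist z m = dist z a" "dist z v = dist z a" and "0 < dist z a" "0 < \<delta>"
    and mv: "3 * (dist z a)\<^sup>2 \<le> (dist m v)\<^sup>2" and ma: "\<delta> \<le> dist a m"
  shows "(86/100) * \<delta> \<le> dist (v + t *\<^sub>R (a - v)) m"
    "dist v a + 11/10 * \<delta> \<le> t * dist v a \<Longrightarrow> (104/100) * \<delta> \<le> dist (v + t *\<^sub>R (a - v)) m"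
proof -
  define r M L i \<tau> where "r = dist z a" and "M = dist a m" and "L = dist a v" and "i = (m - a) \<bullet> (v - a)"
    and "\<tau> = (t - 1) * L"
  have "(dist m v)\<^sup>2 * M\<^sup>2 * L\<^sup>2 = 4 * r\<^sup>2 * (M\<^sup>2 * L\<^sup>2 - i\<^sup>2)"
    using circumradius_sine[of z m a v] z unfolding r_def M_def L_def i_def by simp
  moreover have "3 * r\<^sup>2 * (M\<^sup>2 * L\<^sup>2) \<le> (dist m v)\<^sup>2 * (M\<^sup>2 * L\<^sup>2)"
    using mv unfolding r_def by (intro mult_right_mono) auto
  ultimately have "r\<^sup>2 * (4 * i\<^sup>2) \<le> r\<^sup>2 * (M\<^sup>2 * L\<^sup>2)" by (simp add: algebra_simps)
  then have "(2 * i)\<^sup>2 \<le> (M * L)\<^sup>2" using assms(3) unfolding r_def by (simp add: power_mult_distrib)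
  then have i: "\<bar>2 * i\<bar> \<le> M * L"
    using abs_le_square_iff[of "2 * i" "M * L"] by (simp add: M_def L_def)
  have "m - (v + t *\<^sub>R (a - v)) = (m - a) + (t - 1) *\<^sub>R (v - a)" by (simp add: algebra_simps)
  then have "(dist (v + t *\<^sub>R (a - v)) m)\<^sup>2 = ((m - a) + (t - 1) *\<^sub>R (v - a)) \<bullet> ((m - a) + (t - 1) *\<^sub>R (v - a))"
    by (metis dist_commute dist_norm power2_norm_eq_inner)
  also have "\<dots> = (m - a) \<bullet> (m - a) + 2 * (t - 1) * i + (t - 1)\<^sup>2 * ((v - a) \<bullet> (v - a))"
    unfolding inner_add_left inner_add_right inner_scaleR_left inner_scaleR_right i_def
    by (simp add: inner_commute power2_eq_square algebra_simps)
  also have "\<dots> = M\<^sup>2 + 2 * (t - 1) * i + \<tau>\<^sup>2"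
  proof -
    have "M\<^sup>2 = (m - a) \<bullet> (m - a)" "L\<^sup>2 = (v - a) \<bullet> (v - a)"
      unfolding M_def L_def dist_commute[of a] dist_norm power2_norm_eq_inner
      by (simp_all add: inner_diff inner_commute)
    then show ?thesis by (simp add: \<tau>_def power_mult_distrib)
  qed
  finally have d: "(dist (v + t *\<^sub>R (a - v)) m)\<^sup>2 = M\<^sup>2 + 2 * (t - 1) * i + \<tau>\<^sup>2" .
  have "\<bar>(t - 1) * (2 * i)\<bar> \<le> \<bar>t - 1\<bar> * (M * L)" unfolding abs_mult[of "t - 1" "2 * i"] using i by (intro mult_left_mono) auto
  then have "\<bar>2 * (t - 1) * i\<bar> \<le> \<bar>\<tau>\<bar> * M" by (simp add: \<tau>_def abs_mult L_def mult_ac)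
  then have d': "M\<^sup>2 - \<bar>\<tau>\<bar> * M + \<tau>\<^sup>2 \<le> (dist (v + t *\<^sub>R (a - v)) m)\<^sup>2" unfolding d by linarith
  have M: "\<delta> \<le> M" using ma by (simp add: M_def)
  show "(86/100) * \<delta> \<le> dist (v + t *\<^sub>R (a - v)) m"
  proof (rule power2_le_imp_le)
    have "0 \<le> (\<bar>\<tau>\<bar> - M / 2)\<^sup>2" by simp
    then have "3/4 * M\<^sup>2 \<le> M\<^sup>2 - \<bar>\<tau>\<bar> * M + \<tau>\<^sup>2" by (simp add: power2_eq_square algebra_simps)
    moreover have "\<delta>\<^sup>2 \<le> M\<^sup>2" using M assms(4) by (intro power_mono) auto
    ultimately have "3/4 * \<delta>\<^sup>2 \<le> (dist (v + t *\<^sub>R (a - v)) m)\<^sup>2" using d' by linarith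
    moreover have "((86/100) * \<delta>)\<^sup>2 \<le> 3/4 * \<delta>\<^sup>2" by (simp add: power_mult_distrib power_divide)
    ultimately show "((86/100) * \<delta>)\<^sup>2 \<le> (dist (v + t *\<^sub>R (a - v)) m)\<^sup>2" by linarith
  qed simp
  show "(104/100) * \<delta> \<le> dist (v + t *\<^sub>R (a - v)) m" if "dist v a + 11/10 * \<delta> \<le> t * dist v a"
  proof (rule power2_le_imp_le)
    have \<tau>: "11/10 * \<delta> \<le> \<tau>" using that by (simp add: \<tau>_def L_def dist_commute algebra_simps)
    \<comment> \<open>In terms of the excesses over the least values \<delta> and
      \<open>11/10 * \<delta>\<close>, the constant and linear coefficients are positive; the
      constant one is \<open>1 - 11/10 + 121/100\<close>.\<close>
    define x y where "x = M - \<delta>" and "y = \<tau> - 11/10 * \<delta>"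
    have xy: "0 \<le> x" "0 \<le> y" using M \<tau> by (auto simp: x_def y_def)
    have "M\<^sup>2 - \<bar>\<tau>\<bar> * M + \<tau>\<^sup>2 = 111/100 * \<delta>\<^sup>2 + 9/10 * (\<delta> * x) + 12/10 * (\<delta> * y) + (x\<^sup>2 + y\<^sup>2 - x * y)"
    proof -
      have "M = \<delta> + x" "\<bar>\<tau>\<bar> = 11/10 * \<delta> + y" "\<tau> = 11/10 * \<delta> + y"
        using \<tau> assms(4) by (simp_all add: x_def y_def)
      then show ?thesis by (simp only:) (simp add: power2_eq_square field_simps)
    qed
    moreover have "0 \<le> x\<^sup>2 + y\<^sup>2 - x * y"
    proof -
      have "0 \<le> (x - y)\<^sup>2 + x * y" using xy by simp
      then show ?thesis by (simp add: power2_eq_square algebra_simps)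
    qed
    moreover have "0 \<le> \<delta> * x" "0 \<le> \<delta> * y" using xy assms(4) by simp_all
    ultimately have "111/100 * \<delta>\<^sup>2 \<le> (dist (v + t *\<^sub>R (a - v)) m)\<^sup>2" using d' by linarith
    moreover have "((104/100) * \<delta>)\<^sup>2 \<le> 111/100 * \<delta>\<^sup>2" by (simp add: power_mult_distrib power_divide)
    ultimately show "((104/100) * \<delta>)\<^sup>2 \<le> (dist (v + t *\<^sub>R (a - v)) m)\<^sup>2" by linarith
  qed simp
qed

text \<open>For every corner of a Delaunay triangle one extra point \<open>x\<close> makes the part of the circumscribed disc
  lying in the sector of the corner within distance \<open>\<delta>\<close> of chosen points, so that a maximal separated set
  containing these points avoids that disc; \<open>x = v\<close> encodes that no extra point is needed. Otherwise
  \<open>x\<close> is the midpoint of the arc beyond \<open>a b\<close>, pushed slightly out of the disc.\<close>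

definition corner_extra :: "real \<Rightarrow> real^2 \<Rightarrow> real^2 \<Rightarrow> real^2 \<Rightarrow> real^2 \<Rightarrow> bool" where
  "corner_extra \<delta> v a b x \<longleftrightarrow>
     (\<exists>l>0. \<exists>m>0. x = v + l *\<^sub>R (a - v) + m *\<^sub>R (b - v)) \<and>
     dist v x < 2 * \<delta> \<and> \<delta> \<le> dist v x \<and> \<delta> \<le> dist a x \<and> \<delta> \<le> dist b x \<and>
     (\<forall>w\<in>{a, b}. \<forall>t. \<delta> / 2 \<le> dist (v + t *\<^sub>R (w - v)) x \<and>
        (dist v w + 11/10 * \<delta> \<le> t * dist v w \<longrightarrow> \<delta> \<le> dist (v + t *\<^sub>R (w - v)) x)) \<and>
     (\<forall>z. dist z a = dist z v \<longrightarrow> dist z b = dist z v \<longrightarrow> dist z v < dist z x)"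

definition corner_covering :: "real \<Rightarrow> real^2 \<Rightarrow> real^2 \<Rightarrow> real^2 \<Rightarrow> real^2 \<Rightarrow> bool" where
  "corner_covering \<delta> v a b x \<longleftrightarrow>
     (\<forall>z l m p. dist z a = dist z v \<longrightarrow> dist z b = dist z v \<longrightarrow> 0 \<le> l \<longrightarrow> 0 \<le> m \<longrightarrow>
        p = v + l *\<^sub>R (a - v) + m *\<^sub>R (b - v) \<longrightarrow> dist z p \<le> dist z v \<longrightarrow> (\<exists>w\<in>{v, a, b, x}. dist w p < \<delta>))"

text \<open>A disc point of the sector lies either in the triangle, where some vertex is within the
  circumradius, or in the cap beyond \<open>a b\<close>. If the \<delta>-discs about
  \<open>a\<close> and \<open>b\<close> cover the cap, \<open>x = v\<close> works; otherwise the
  pushed arc midpoint covers the rest.\<close>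

lemma corner_point_exists:
  fixes v a b z :: "real^2"
  assumes \<delta>: "0 < \<delta>" and sides: "\<delta> \<le> dist v a" "\<delta> \<le> dist v b" "\<delta> \<le> dist a b"
    and z: "dist z a = dist z v" "dist z b = dist z v" and small: "dist z v < \<delta>"
  shows "\<exists>x. (x = v \<or> corner_extra \<delta> v a b x) \<and> corner_covering \<delta> v a b x"
proof -
  define r where "r = dist z v"
  have ne: "v \<noteq> a" "v \<noteq> b" "a \<noteq> b" using \<delta> sides by auto
  have r: "0 < r" "r < \<delta>" using z ne small zero_le_dist[of z v] unfolding r_def by (auto simp: less_le)
  obtain e n :: "real^2" where en: "\<And>u w. u \<bullet> w = (e \<bullet> u) * (e \<bullet> w) + (n \<bullet> u) * (n \<bullet> w)"
    "e \<bullet> n = 0" "n \<bullet> n = 1" "e \<bullet> a < e \<bullet> b" "n \<bullet> a = n \<bullet> b" "n \<bullet> v \<le> n \<bullet> a"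
    using planar_frame[OF ne(3), of v] by blast
  define X Y where "X u = e \<bullet> (u - z)" and "Y u = n \<bullet> (u - z)" for u
  have D: "(dist u w)\<^sup>2 = (X u - X w)\<^sup>2 + (Y u - Y w)\<^sup>2" for u w
    unfolding dist_norm power2_norm_eq_inner en(1)[of "u - w" "u - w"] X_def Y_def
    by (simp add: inner_diff_right power2_eq_square)
  have Xz: "X z = 0" "Y z = 0" by (simp_all add: X_def Y_def)
  have Dz: "(dist z u)\<^sup>2 = (X u)\<^sup>2 + (Y u)\<^sup>2" for u unfolding D Xz by simp
  have XY_eq: "u = w" if "X u = X w" "Y u = Y w" for u w using D[of u w] that by simp
  have lin: "X (v + l *\<^sub>R (a - v) + m *\<^sub>R (b - v)) = X v + l * (X a - X v) + m * (X b - X v)"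
    "Y (v + l *\<^sub>R (a - v) + m *\<^sub>R (b - v)) = Y v + l * (Y a - Y v) + m * (Y b - Y v)" for l m
    by (simp_all add: X_def Y_def inner_diff_right inner_add_right)
  define s k p q where "s = X b" and "k = Y b" and "p = X v" and "q = Y v"
  have Ya: "Y a = k" using en(5) by (simp add: k_def Y_def inner_diff_right)
  have "X a < X b" using en(4) by (simp add: X_def inner_diff_right)
  moreover have "(X a)\<^sup>2 = (X b)\<^sup>2" using Dz[of a] Dz[of b] z Ya unfolding k_def by simp
  ultimately have Xa: "X a = - s" and s: "0 < s" unfolding s_def by (auto simp: power2_eq_iff)
  have sk: "s\<^sup>2 + k\<^sup>2 = r\<^sup>2" using Dz[of b] z(2) by (simp add: s_def k_def r_def)
  have pq: "p\<^sup>2 + q\<^sup>2 = r\<^sup>2" using Dz[of v] by (simp add: p_def q_def r_def)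
  have "q \<noteq> k"
  proof
    assume "q = k"
    then have "p\<^sup>2 = s\<^sup>2" using sk pq by simp
    then have "p = s \<or> p = - s" by (simp add: power2_eq_iff)
    then have "v = b \<or> v = a"
      using XY_eq[of v b] XY_eq[of v a] \<open>q = k\<close> Xa Ya unfolding p_def q_def s_def k_def by auto
    then show False using ne by auto
  qed
  moreover have "q \<le> k" using en(5,6) by (simp add: q_def k_def Y_def inner_diff_right)
  ultimately have qk: "q < k" by simp
  have r2: "r\<^sup>2 < \<delta>\<^sup>2" using r by (intro power_strict_mono) auto
  have far: "p * s + q * k < r\<^sup>2 / 2" "- p * s + q * k < r\<^sup>2 / 2"
  proof -
    have "\<delta>\<^sup>2 \<le> (dist v b)\<^sup>2" "\<delta>\<^sup>2 \<le> (dist v a)\<^sup>2" using sides \<delta> by (auto intro!: power_mono)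
    then have "\<delta>\<^sup>2 \<le> (p - s)\<^sup>2 + (q - k)\<^sup>2" "\<delta>\<^sup>2 \<le> (p + s)\<^sup>2 + (q - k)\<^sup>2"
      unfolding D Xa Ya p_def q_def s_def k_def by simp_all
    then show "p * s + q * k < r\<^sup>2 / 2" "- p * s + q * k < r\<^sup>2 / 2"
      using sk pq r2 by (simp_all add: power2_eq_square algebra_simps)
  qed
  note height = chord_height[OF r(1) sk pq s qk far]
  have zuniq: "z' = z" if "dist z' a = dist z' v" "dist z' b = dist z' v" for z'
    using circle_unique[of v a b z' "dist z' v" z r] that z ne unfolding r_def by simp
  have covering: "corner_covering \<delta> v a b x"
    if cap: "\<And>u. dist z u \<le> r \<Longrightarrow> k < Y u \<Longrightarrow> \<exists>w\<in>{v, a, b, x}. dist w u < \<delta>" for x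
    unfolding corner_covering_def
  proof (intro allI impI)
    fix z' l m u assume u: "dist z' a = dist z' v" "dist z' b = dist z' v" "0 \<le> l" "0 \<le> m"
      "u = v + l *\<^sub>R (a - v) + m *\<^sub>R (b - v)" "dist z' u \<le> dist z' v"
    have "z' = z" using zuniq u by simp
    then have zu: "dist z u \<le> r" using u by (simp add: r_def)
    show "\<exists>w\<in>{v, a, b, x}. dist w u < \<delta>"
    proof (cases "l + m \<le> 1")
      case True
      then have "u \<in> convex hull {v, a, b}" using u convex_hull_3_alt[of v a b] by auto
      then have "\<exists>w\<in>{v, a, b}. dist w u \<le> r"
        using vertex_within_circumradius[of z v r a b u] z by (simp add: r_def)
      then show ?thesis using r(2) by force
    next
      case False
      have "Y u = q + (l + m) * (k - q)"
        unfolding u(5) lin Ya by (simp add: q_def k_def algebra_simps)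
      moreover have "k - q < (l + m) * (k - q)" using False qk by simp
      ultimately show ?thesis using cap[OF zu] by simp
    qed
  qed
  show ?thesis
  proof (cases "\<exists>u. dist z u \<le> r \<and> k < Y u \<and> \<delta> \<le> dist a u \<and> \<delta> \<le> dist b u")
    case False
    then have "corner_covering \<delta> v a b v" by (intro covering) force
    then show ?thesis by blast
  next
    case True
    then obtain u where u: "dist z u \<le> r" "k < Y u" "\<delta> \<le> dist a u" "\<delta> \<le> dist b u" by auto
    have cap: "(X u)\<^sup>2 + (Y u)\<^sup>2 \<le> r\<^sup>2" if "dist z u \<le> r" for u
      using that Dz[of u] power_mono[of "dist z u" r 2] by simp
    have da: "(dist a u)\<^sup>2 = (X u + s)\<^sup>2 + (Y u - k)\<^sup>2" for u
      unfolding D Xa Ya by (simp add: power2_eq_square algebra_simps)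
    have db: "(dist b u)\<^sup>2 = (X u - s)\<^sup>2 + (Y u - k)\<^sup>2" for u
      unfolding D s_def k_def by (simp add: power2_eq_square algebra_simps)
    have "\<delta>\<^sup>2 \<le> (dist a u)\<^sup>2" "\<delta>\<^sup>2 \<le> (dist b u)\<^sup>2" using u \<delta> by (auto intro!: power_mono)
    then have M: "\<delta>\<^sup>2 \<le> 2 * r\<^sup>2 - 2 * r * k"
      using cap_height_bound[OF sk s r(1) cap[OF u(1)] _ \<delta> r(2)] u(2) unfolding da db by simp
    \<comment> \<open>An uncovered cap point forces the angle at \<open>v\<close> above 60 degrees,
      and this puts \<open>v\<close> low on the circle.\<close>
    then have "r * k < r * (r / 2)" using r2 by (simp add: power2_eq_square)
    then have k: "k < r / 2" using mult_less_cancel_left_pos[OF r(1)] by blast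
    have q: "q \<le> - r / 2" by (rule height(2)[OF k])
    \<comment> \<open>The push places \<open>x\<close> strictly outside the disc, but still within
      \<delta> of \<open>z\<close> and within \<open>\<delta> / 100\<close> of the arc midpoint
      \<open>m0\<close>.\<close>
    define h where "h = r + min ((\<delta> - r) / 2) (\<delta> / 100)"
    have h: "r < h" "h < \<delta>" "h \<le> r + \<delta> / 100" using r \<delta> by (auto simp: h_def min_def field_simps)
    define x m0 where "x = z + h *\<^sub>R n" and "m0 = z + r *\<^sub>R n"
    have Xx: "X x = 0" "Y x = h" "X m0 = 0" "Y m0 = r"
      using en(2,3) by (simp_all add: X_def Y_def x_def m0_def)
    have "norm n = 1" using en(3) by (simp add: norm_eq_1)
    have "x - m0 = (h - r) *\<^sub>R n" by (simp add: x_def m0_def algebra_simps)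
    then have xm: "dist x m0 = h - r" using h(1) \<open>norm n = 1\<close> by (simp add: dist_norm)
    have zx: "dist z x = h" "dist z m0 = r" using h(1) r(1) \<open>norm n = 1\<close> by (simp_all add: x_def m0_def dist_norm)
    have "corner_covering \<delta> v a b x"
    proof (rule covering)
      fix u assume u: "dist z u \<le> r" "k < Y u"
      show "\<exists>w\<in>{v, a, b, x}. dist w u < \<delta>"
      proof (cases "dist a u < \<delta> \<or> dist b u < \<delta>")
        case False
        then have "\<delta>\<^sup>2 \<le> (dist a u)\<^sup>2" "\<delta>\<^sup>2 \<le> (dist b u)\<^sup>2" using \<delta> by (auto intro!: power_mono)
        then have "(X u)\<^sup>2 + (Y u - r)\<^sup>2 \<le> r\<^sup>2"
          using cap_covered[OF sk s r(1) height(1) cap[OF u(1)]] u(2) r2 unfolding da db by simp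
        then have "(dist m0 u)\<^sup>2 \<le> r\<^sup>2" unfolding D Xx by (simp add: power2_commute)
        then have "dist m0 u \<le> r" by (rule power2_le_imp_le) (use r in simp)
        then have "dist x u \<le> h" using dist_triangle[of x u m0] xm by linarith
        then show ?thesis using h(2) by auto
      qed auto
    qed
    moreover have "corner_extra \<delta> v a b x"
      unfolding corner_extra_def
    proof (intro conjI ballI allI impI)
      \<comment> \<open>The sum and the difference of the two coefficients of \<open>x\<close> in
        the sector, read off from its height and its horizontal position.\<close>
      define \<sigma> \<epsilon> where "\<sigma> = (h - q) / (k - q)" and "\<epsilon> = p * ((h - k) / (k - q)) / s"
      have hk: "\<bar>p\<bar> * (h - k) < s * (h - q)"
        by (rule beyond_chord_in_sector[OF sk pq s r(1) qk height(1) k q h(1)])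
      have "\<bar>p\<bar> * ((h - k) / (k - q)) < s * \<sigma>"
        using divide_strict_right_mono[OF hk, of "k - q"] qk by (simp add: \<sigma>_def)
      moreover have "0 \<le> (h - k) / (k - q)" using h(1) k r(1) qk by simp
      ultimately have "\<bar>p * ((h - k) / (k - q))\<bar> < s * \<sigma>"
        by (simp only: abs_mult[of p] abs_of_nonneg)
      then have "\<bar>p * ((h - k) / (k - q))\<bar> / s < \<sigma>" using s by (simp only: pos_divide_less_eq mult.commute)
      then have \<epsilon>: "\<bar>\<epsilon>\<bar> < \<sigma>" unfolding \<epsilon>_def abs_div_pos[OF s] .
      have \<sigma>1: "\<sigma> * (k - q) = h - q" using qk by (simp add: \<sigma>_def)
      have \<epsilon>s: "\<epsilon> * s = p * (\<sigma> - 1)"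
        using s qk by (simp add: \<epsilon>_def \<sigma>_def field_simps)
      have "x = v + ((\<sigma> - \<epsilon>) / 2) *\<^sub>R (a - v) + ((\<sigma> + \<epsilon>) / 2) *\<^sub>R (b - v)"
      proof (rule XY_eq)
        show "X x = X (v + ((\<sigma> - \<epsilon>) / 2) *\<^sub>R (a - v) + ((\<sigma> + \<epsilon>) / 2) *\<^sub>R (b - v))"
          unfolding lin Xx Xa s_def[symmetric] p_def[symmetric] using \<epsilon>s by (simp add: field_simps)
        show "Y x = Y (v + ((\<sigma> - \<epsilon>) / 2) *\<^sub>R (a - v) + ((\<sigma> + \<epsilon>) / 2) *\<^sub>R (b - v))"
          unfolding lin Xx Ya k_def[symmetric] q_def[symmetric] using \<sigma>1 by (simp add: field_simps)
      qed
      moreover have "0 < (\<sigma> - \<epsilon>) / 2" "0 < (\<sigma> + \<epsilon>) / 2" using \<epsilon> by auto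
      ultimately show "\<exists>l>0. \<exists>m>0. x = v + l *\<^sub>R (a - v) + m *\<^sub>R (b - v)" by blast
      show "dist v x < 2 * \<delta>" using dist_triangle[of v x z] zx h(2) r(2) by (simp add: r_def dist_commute)
      \<comment> \<open>Since \<open>k < r / 2\<close>, moving outwards from \<open>m0\<close> to
        \<open>x\<close> does not decrease the distance to the chord ends.\<close>
      have "0 \<le> (h - r) * (h + r - 2 * k)" using h(1) k r(1) by (intro mult_nonneg_nonneg) auto
      then have hk2: "2 * r\<^sup>2 - 2 * r * k \<le> r\<^sup>2 + h\<^sup>2 - 2 * h * k" by (simp add: power2_eq_square algebra_simps)
      have dv: "(dist v x)\<^sup>2 = r\<^sup>2 + h\<^sup>2 - 2 * h * q"
        unfolding D Xx p_def[symmetric] q_def[symmetric] pq[symmetric] by (simp add: power2_eq_square algebra_simps)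
      have "2 * h * q \<le> 2 * h * k" using h(1) r(1) qk by simp
      then have "\<delta>\<^sup>2 \<le> (dist v x)\<^sup>2" using M hk2 dv by linarith
      then show "\<delta> \<le> dist v x" by (rule power2_le_imp_le) simp
      have "(dist a x)\<^sup>2 = r\<^sup>2 + h\<^sup>2 - 2 * h * k"
        unfolding da Xx sk[symmetric] by (simp add: power2_eq_square algebra_simps)
      then have "\<delta>\<^sup>2 \<le> (dist a x)\<^sup>2" using M hk2 by linarith
      then show "\<delta> \<le> dist a x" by (rule power2_le_imp_le) simp
      have "(dist b x)\<^sup>2 = r\<^sup>2 + h\<^sup>2 - 2 * h * k"
        unfolding db Xx sk[symmetric] by (simp add: power2_eq_square algebra_simps)
      then have "\<delta>\<^sup>2 \<le> (dist b x)\<^sup>2" using M hk2 by linarith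
      then show "\<delta> \<le> dist b x" by (rule power2_le_imp_le) simp
      have "(dist m0 v)\<^sup>2 = 2 * r\<^sup>2 - 2 * r * q"
        unfolding D Xx p_def[symmetric] q_def[symmetric] using pq by (simp add: power2_eq_square algebra_simps)
      moreover have "r * q \<le> r * (- r / 2)" using q r(1) by (intro mult_left_mono) auto
      ultimately have mv: "3 * r\<^sup>2 \<le> (dist m0 v)\<^sup>2" by (simp add: power2_eq_square)
      fix w t assume w: "w \<in> {a, b}"
      have "(dist w m0)\<^sup>2 = 2 * r\<^sup>2 - 2 * r * k"
      proof -
        have "(dist a m0)\<^sup>2 = 2 * r\<^sup>2 - 2 * r * k" "(dist b m0)\<^sup>2 = 2 * r\<^sup>2 - 2 * r * k"
          unfolding da db Xx using sk by (simp_all add: power2_eq_square algebra_simps)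
        then show ?thesis using w by auto
      qed
      then have "\<delta>\<^sup>2 \<le> (dist w m0)\<^sup>2" using M by simp
      then have mw: "\<delta> \<le> dist w m0" by (rule power2_le_imp_le) simp
      have zw: "dist z w = r" using w z by (auto simp: r_def)
      note far = arc_midpoint_far_from_side[of z m0 w v \<delta>, unfolded zw zx r_def[symmetric], OF refl refl r(1) \<delta> mv mw, of t]
      have tri: "dist (v + t *\<^sub>R (w - v)) m0 \<le> dist (v + t *\<^sub>R (w - v)) x + \<delta> / 100"
        using dist_triangle[of "v + t *\<^sub>R (w - v)" m0 x] xm h(3) by linarith
      show "\<delta> / 2 \<le> dist (v + t *\<^sub>R (w - v)) x" using far(1) tri \<delta> by linarith
      show "\<delta> \<le> dist (v + t *\<^sub>R (w - v)) x" if "dist v w + 11/10 * \<delta> \<le> t * dist v w"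
        using far(2)[OF that] tri \<delta> by linarith
    next
      fix z' assume "dist z' a = dist z' v" "dist z' b = dist z' v"
      then have "z' = z" by (rule zuniq)
      then show "dist z' v < dist z' x" using zx h(1) by (simp add: r_def)
    qed
    ultimately show ?thesis by blast
  qed
qed

section \<open>The subdivision points of an edge\<close>

text \<open>The number of middle pieces is chosen such that their length lies in \<open>[1.1 \<delta>, 1.26 \<delta>]\<close>: the upper bound gives
  stability, and the lower bound leaves room for the extra points at the corners.\<close>

definition cut_count :: "real \<Rightarrow> real \<Rightarrow> nat" where
  "cut_count \<delta> L = nat \<lfloor>8 * L / (11 * \<delta>)\<rfloor>"

text \<open>With \<open>n = cut_count \<delta> L\<close> the pieces are numbered from 0 to
  \<open>n + 1\<close>, the first and the last being the end pieces. All indices above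
  \<open>n + 1\<close> give the second end, so facts about cut points need no range
  condition.\<close>

definition cut_param :: "real \<Rightarrow> real \<Rightarrow> nat \<Rightarrow> real" where
  "cut_param \<delta> L j = (if j = 0 then 0
     else if j \<le> cut_count \<delta> L + 1 then 1/10 + 8/10 * ((real j - 1) / real (cut_count \<delta> L)) else 1)"

context
  fixes \<delta> L :: real
  assumes \<delta>: "0 < \<delta>" and L: "10 * \<delta> \<le> L"
begin

lemma cut_count_bounds:
  "7 \<le> cut_count \<delta> L" "11 * \<delta> * real (cut_count \<delta> L) \<le> 8 * L" "8 * L < 11 * \<delta> * (real (cut_count \<delta> L) + 1)"
proof -
  \<comment> \<open>From \<open>L \<ge> 10 * \<delta>\<close> and
    \<open>80 / 11 > 7\<close>.\<close>
  have "7 \<le> 8 * L / (11 * \<delta>)" using \<delta> L by (simp add: field_simps)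
  then have f: "7 \<le> \<lfloor>8 * L / (11 * \<delta>)\<rfloor>" by (simp add: le_floor_iff)
  then show "7 \<le> cut_count \<delta> L" unfolding cut_count_def by linarith
  have n: "real (cut_count \<delta> L) = of_int \<lfloor>8 * L / (11 * \<delta>)\<rfloor>" using f by (simp add: cut_count_def)
  have "real (cut_count \<delta> L) \<le> 8 * L / (11 * \<delta>)" "8 * L / (11 * \<delta>) < real (cut_count \<delta> L) + 1"
    unfolding n by linarith+
  then show "11 * \<delta> * real (cut_count \<delta> L) \<le> 8 * L" "8 * L < 11 * \<delta> * (real (cut_count \<delta> L) + 1)"
    using \<delta> by (simp_all add: field_simps)
qed

lemma cut_param_step:
  "j = 0 \<or> j = cut_count \<delta> L + 1 \<Longrightarrow> cut_param \<delta> L (Suc j) - cut_param \<delta> L j = 1 / 10"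
  "0 < j \<Longrightarrow> j \<le> cut_count \<delta> L \<Longrightarrow>
    cut_param \<delta> L (Suc j) - cut_param \<delta> L j = 8 / 10 / real (cut_count \<delta> L)"
  using cut_count_bounds(1) by (auto simp: cut_param_def field_simps)

lemma cut_param_end: "cut_count \<delta> L + 2 \<le> j \<Longrightarrow> cut_param \<delta> L j = 1"
  by (auto simp: cut_param_def)

lemma cut_middle_length:
  "11/10 * \<delta> \<le> 8 / 10 / real (cut_count \<delta> L) * L" "8 / 10 / real (cut_count \<delta> L) * L \<le> 126/100 * \<delta>"
proof -
  have n: "7 \<le> real (cut_count \<delta> L)" using cut_count_bounds(1) by linarith
  show "11/10 * \<delta> \<le> 8 / 10 / real (cut_count \<delta> L) * L"
    using cut_count_bounds(2) n by (simp add: field_simps)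
  \<comment> \<open>With \<open>n \<ge> 7\<close> pieces the length is at most
    \<open>11/10 * (n + 1) / n \<le> 88/70 < 126/100\<close> times \<delta>.\<close>
  have "11 * \<delta> \<le> 160/100 * \<delta> * real (cut_count \<delta> L)"
    using mult_left_mono[OF n, of \<delta>] \<delta> by simp
  then have "8 * L \<le> 1260/100 * \<delta> * real (cut_count \<delta> L)"
    using cut_count_bounds(3) by (simp add: algebra_simps)
  then show "8 / 10 / real (cut_count \<delta> L) * L \<le> 126/100 * \<delta>" using n by (simp add: field_simps)
qed

lemma cut_param_step_length:
  assumes "j \<le> cut_count \<delta> L + 1"
  shows "\<delta> \<le> (cut_param \<delta> L (Suc j) - cut_param \<delta> L j) * L"
proof (cases "j = 0 \<or> j = cut_count \<delta> L + 1")
  case True then show ?thesis unfolding cut_param_step(1)[OF True] using L by simp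
next
  case False
  then have "0 < j" "j \<le> cut_count \<delta> L" using assms by auto
  then have "cut_param \<delta> L (Suc j) - cut_param \<delta> L j = 8 / 10 / real (cut_count \<delta> L)"
    by (rule cut_param_step(2))
  then show ?thesis using cut_middle_length(1) \<delta> by simp
qed

lemma cut_param_mono: "i \<le> j \<Longrightarrow> cut_param \<delta> L i \<le> cut_param \<delta> L j"
proof (rule lift_Suc_mono_le)
  fix j
  have "0 < L" using \<delta> L by linarith
  show "cut_param \<delta> L j \<le> cut_param \<delta> L (Suc j)"
  proof (cases "j \<le> cut_count \<delta> L + 1")
    case True
    have "0 \<le> (cut_param \<delta> L (Suc j) - cut_param \<delta> L j) * L" using cut_param_step_length[OF True] \<delta> by linarith
    then show ?thesis using \<open>0 < L\<close> by (simp add: zero_le_mult_iff)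
  next
    case False then show ?thesis using cut_param_end[of j] cut_param_end[of "Suc j"] by simp
  qed
qed

lemma cut_param_bounds: "0 \<le> cut_param \<delta> L j" "cut_param \<delta> L j \<le> 1"
proof -
  show "0 \<le> cut_param \<delta> L j" using cut_param_mono[of 0 j] by (simp add: cut_param_def)
  show "cut_param \<delta> L j \<le> 1"
    using cut_param_mono[of j "j + cut_count \<delta> L + 2"] cut_param_end[of "j + cut_count \<delta> L + 2"] by simp
qed

lemma cut_param_separated:
  assumes "cut_param \<delta> L i < cut_param \<delta> L j"
  shows "\<delta> \<le> (cut_param \<delta> L j - cut_param \<delta> L i) * L"
proof -
  have "0 < L" using \<delta> L by linarith
  have "i < j" using assms cut_param_mono[of j i] by (meson not_le)
  have "i \<le> cut_count \<delta> L + 1"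
  proof (rule ccontr)
    assume "\<not> ?thesis"
    then show False using cut_param_end[of i] cut_param_bounds(2)[of j] assms by simp
  qed
  then have "\<delta> \<le> (cut_param \<delta> L (Suc i) - cut_param \<delta> L i) * L" by (rule cut_param_step_length)
  also have "\<dots> \<le> (cut_param \<delta> L j - cut_param \<delta> L i) * L"
    using cut_param_mono[of "Suc i" j] \<open>i < j\<close> \<open>0 < L\<close> by (intro mult_right_mono) auto
  finally show ?thesis .
qed

text \<open>At a corner only the vertex and the first cut need individual treatment; the room of
  \<open>11/10 * \<delta>\<close> handles all other cut points at once.\<close>

lemma cut_param_cases:
  "cut_param \<delta> L j = 0 \<or> cut_param \<delta> L j = 1/10 \<or> L / 10 + 11/10 * \<delta> \<le> cut_param \<delta> L j * L"
proof -
  have n: "7 \<le> cut_count \<delta> L" by (rule cut_count_bounds(1))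
  have 1: "cut_param \<delta> L 1 = 1/10" by (simp add: cut_param_def)
  have "cut_param \<delta> L (Suc 1) - cut_param \<delta> L 1 = 8 / 10 / real (cut_count \<delta> L)"
    using n by (intro cut_param_step(2)) auto
  then have "cut_param \<delta> L 2 = 1/10 + 8 / 10 / real (cut_count \<delta> L)" using 1 by (simp add: numeral_2_eq_2)
  then have 2: "L / 10 + 11/10 * \<delta> \<le> cut_param \<delta> L 2 * L"
    using cut_middle_length(1) by (simp add: algebra_simps)
  consider "j = 0" | "j = 1" | "2 \<le> j" by linarith
  then show ?thesis
  proof cases
    case 3
    have "cut_param \<delta> L 2 * L \<le> cut_param \<delta> L j * L"
      using cut_param_mono[OF 3] \<delta> L by (intro mult_right_mono) auto
    then show ?thesis using 2 by linarith
  qed (use 1 in \<open>auto simp: cut_param_def\<close>)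
qed

text \<open>The subdivision is symmetric, so reversing an edge gives the same set of cut
  points.\<close>

lemma cut_param_flip: "\<exists>i. cut_param \<delta> L i = 1 - cut_param \<delta> L j"
proof -
  let ?n = "cut_count \<delta> L"
  have n: "0 < real ?n" using cut_count_bounds(1) by linarith
  consider "j = 0" | "1 \<le> j" "j \<le> ?n + 1" | "?n + 2 \<le> j" by linarith
  then show ?thesis
  proof cases
    case 1 then show ?thesis by (intro exI[of _ "?n + 2"]) (simp add: cut_param_def)
  next
    case 2
    then have "real (?n + 2 - j) = real ?n + 2 - real j" by (simp add: of_nat_diff)
    then show ?thesis
      using 2 n by (intro exI[of _ "?n + 2 - j"]) (auto simp: cut_param_def field_simps)
  next
    case 3 then show ?thesis using cut_param_end[OF 3] by (intro exI[of _ 0]) (simp add: cut_param_def)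
  qed
qed

lemma cut_param_interval:
  assumes "0 \<le> t" "t \<le> 1"
  obtains j where "j \<le> cut_count \<delta> L + 1" "cut_param \<delta> L j \<le> t" "t \<le> cut_param \<delta> L (Suc j)"
proof -
  define j where "j = (LEAST i. t \<le> cut_param \<delta> L (Suc i))"
  have ex: "t \<le> cut_param \<delta> L (Suc (cut_count \<delta> L + 1))" using cut_param_end assms by simp
  have up: "t \<le> cut_param \<delta> L (Suc j)" unfolding j_def by (rule LeastI[where P = "\<lambda>i. t \<le> cut_param \<delta> L (Suc i)", OF ex])
  have "j \<le> cut_count \<delta> L + 1" unfolding j_def by (rule Least_le[where P = "\<lambda>i. t \<le> cut_param \<delta> L (Suc i)", OF ex])
  moreover have "cut_param \<delta> L j \<le> t"
  proof (cases j)
    case 0 then show ?thesis using assms by (simp add: cut_param_def)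
  next
    case (Suc i)
    then show ?thesis using not_less_Least[of i "\<lambda>i. t \<le> cut_param \<delta> L (Suc i)"] unfolding j_def by simp
  qed
  ultimately show ?thesis using that up by blast
qed

end

definition cut_point :: "real \<Rightarrow> real^2 \<Rightarrow> real^2 \<Rightarrow> nat \<Rightarrow> real^2" where
  "cut_point \<delta> c d j = c + cut_param \<delta> (dist c d) j *\<^sub>R (d - c)"

abbreviation cut_segment :: "real \<Rightarrow> real^2 \<Rightarrow> real^2 \<Rightarrow> nat \<Rightarrow> (real^2) set" where
  "cut_segment \<delta> c d j \<equiv> closed_segment (cut_point \<delta> c d j) (cut_point \<delta> c d (Suc j))"

lemma cut_point_flip:
  assumes "0 < \<delta>" "10 * \<delta> \<le> dist c d"
  shows "\<exists>i. cut_point \<delta> c d j = cut_point \<delta> d c i"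
proof -
  obtain i where "cut_param \<delta> (dist c d) i = 1 - cut_param \<delta> (dist c d) j" using cut_param_flip[OF assms] by metis
  then have j: "cut_param \<delta> (dist c d) j = 1 - cut_param \<delta> (dist c d) i" by simp
  show ?thesis
    unfolding cut_point_def dist_commute[of d c] j by (intro exI[of _ i]) (simp add: algebra_simps)
qed

lemma dist_on_ray: "dist (c + s *\<^sub>R (d - c)) (c + t *\<^sub>R (d - c)) = \<bar>s - t\<bar> * dist c (d :: 'a::real_normed_vector)"
proof -
  have "(c + s *\<^sub>R (d - c)) - (c + t *\<^sub>R (d - c)) = (s - t) *\<^sub>R (d - c)" by (simp add: scaleR_diff_left)
  then show ?thesis by (simp add: dist_norm norm_minus_commute)
qed

lemma cut_points_separated:
  assumes "0 < \<delta>" "10 * \<delta> \<le> dist c d" "cut_point \<delta> c d i \<noteq> cut_point \<delta> c d j"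
  shows "\<delta> \<le> dist (cut_point \<delta> c d i) (cut_point \<delta> c d j)"
proof -
  have "cut_param \<delta> (dist c d) i \<noteq> cut_param \<delta> (dist c d) j" using assms(3) by (auto simp: cut_point_def)
  then have "\<delta> \<le> \<bar>cut_param \<delta> (dist c d) i - cut_param \<delta> (dist c d) j\<bar> * dist c d"
    using cut_param_separated[OF assms(1,2), of i j] cut_param_separated[OF assms(1,2), of j i]
    by (cases "cut_param \<delta> (dist c d) i < cut_param \<delta> (dist c d) j") auto
  then show ?thesis unfolding cut_point_def dist_on_ray .
qed

lemma cut_point_in_segment:
  assumes "0 < \<delta>" "10 * \<delta> \<le> dist c d"
  shows "cut_point \<delta> c d j \<in> closed_segment c d"
  unfolding in_segment cut_point_def using cut_param_bounds[OF assms, of j]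
  by (intro exI[of _ "cut_param \<delta> (dist c d) j"]) (auto simp: algebra_simps)

section \<open>The separated set of prescribed points\<close>

definition shrink :: "real^2 \<Rightarrow> real^2 \<Rightarrow> real^2" where
  "shrink v x = v + (1/10) *\<^sub>R (x - v)"

definition corner_point :: "real \<Rightarrow> real^2 \<Rightarrow> real^2 \<Rightarrow> real^2 \<Rightarrow> real^2 \<Rightarrow> bool" where
  "corner_point \<delta> v a b x \<longleftrightarrow> (x = v \<or> corner_extra \<delta> v (shrink v a) (shrink v b) x) \<and>
     corner_covering \<delta> v (shrink v a) (shrink v b) x"

text \<open>The choice depends on the unordered pair \<open>{a, b}\<close> only, so every corner receives a single point.\<close>

definition chosen_point :: "real \<Rightarrow> real^2 \<Rightarrow> (real^2) set \<Rightarrow> real^2" where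
  "chosen_point \<delta> v A = (SOME x. \<exists>a b. A = {a, b} \<and> corner_point \<delta> v a b x)"

definition edge_points :: "real \<Rightarrow> (real^2) set set \<Rightarrow> (real^2) set" where
  "edge_points \<delta> K = {cut_point \<delta> c d j |c d j. c \<noteq> d \<and> closed_segment c d \<in> K}"

definition prescribed_points :: "real \<Rightarrow> (real^2) set set \<Rightarrow> (real^2) set" where
  "prescribed_points \<delta> K = edge_points \<delta> K \<union> {chosen_point \<delta> v {a, b} |v a b. tri K v a b}"

lemma corner_extra_sym:
  assumes "corner_extra \<delta> v a b x" shows "corner_extra \<delta> v b a x"
proof -
  note * = assms[unfolded corner_extra_def]
  obtain l m where "0 < l" "0 < m" "x = v + l *\<^sub>R (a - v) + m *\<^sub>R (b - v)" using * by blast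
  moreover from this have "x = v + m *\<^sub>R (b - v) + l *\<^sub>R (a - v)" by simp
  ultimately have 1: "\<exists>l>0. \<exists>m>0. x = v + l *\<^sub>R (b - v) + m *\<^sub>R (a - v)" by blast
  have 2: "\<forall>z. dist z b = dist z v \<longrightarrow> dist z a = dist z v \<longrightarrow> dist z v < dist z x" using * by simp
  have 3: "{b, a} = {a, b}" by auto
  show ?thesis
    unfolding corner_extra_def 3 using 1 2 * by (elim conjE, intro conjI)
qed

lemma corner_covering_sym:
  assumes "corner_covering \<delta> v a b x" shows "corner_covering \<delta> v b a x"
  unfolding corner_covering_def
proof (intro allI impI)
  fix z l m p assume *: "dist z b = dist z v" "dist z a = dist z v" "0 \<le> l" "0 \<le> m"
    "p = v + l *\<^sub>R (b - v) + m *\<^sub>R (a - v)" "dist z p \<le> dist z v"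
  then have "p = v + m *\<^sub>R (a - v) + l *\<^sub>R (b - v)" by simp
  then have "\<exists>w\<in>{v, a, b, x}. dist w p < \<delta>"
    using assms * unfolding corner_covering_def by blast
  then show "\<exists>w\<in>{v, b, a, x}. dist w p < \<delta>" by auto
qed

lemma corner_point_sym: "corner_point \<delta> v a b x \<Longrightarrow> corner_point \<delta> v b a x"
  unfolding corner_point_def using corner_extra_sym corner_covering_sym by blast

lemma dist_shrink:
  "dist v (shrink v a) = dist v a / 10" "dist (shrink v a) (shrink v b) = dist a b / 10"
  "dist (shrink v z) v = dist z v / 10"
proof -
  show "dist v (shrink v a) = dist v a / 10"
    using dist_on_ray[of v 0 a "1/10"] by (simp add: shrink_def)
  then show "dist (shrink v z) v = dist z v / 10"
    using dist_on_ray[of v "1/10" z 0] by (simp add: shrink_def dist_commute)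
  have "shrink v a - shrink v b = (1/10) *\<^sub>R (a - b)" by (simp add: shrink_def algebra_simps)
  then show "dist (shrink v a) (shrink v b) = dist a b / 10" by (simp add: dist_norm)
qed

section \<open>Metric estimates in the old Delaunay triangles and separation of the prescribed
  points\<close>

context
  fixes S :: "(real^2) set" and K :: "(real^2) set set" and \<delta> :: real
  assumes \<delta>: "0 < \<delta>" and S: "gromov (10 * \<delta>) S" and K: "delaunay_triangulation S K"
begin

lemma K_lf: "lf_simplicial_complex K" and K_cover: "\<Union>K = UNIV"
  using delaunay_triangulationD[OF K] gromov_convex_hull[OF S] \<delta> by auto

lemma tri_sides:
  assumes "tri K a b c"
  shows "10 * \<delta> \<le> dist a b" "10 * \<delta> \<le> dist a c" "10 * \<delta> \<le> dist b c"
proof -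
  have s: "10 * \<delta> \<le> dist x y" if "x \<in> S" "y \<in> S" "x \<noteq> y" for x y
    using S that unfolding gromov_def separated_def by blast
  show "10 * \<delta> \<le> dist a b" "10 * \<delta> \<le> dist a c" "10 * \<delta> \<le> dist b c"
    using s delaunay_tri_in[OF K assms] assms unfolding tri_def by auto
qed

lemma edge_length:
  assumes "closed_segment c d \<in> K" "c \<noteq> d"
  shows "10 * \<delta> \<le> dist c d"
  using edge_in_tri[OF K_lf K_cover assms] tri_sides(1) by metis

lemma tri_circumcentre:
  assumes "tri K v a b"
  obtains z where "dist z a = dist z v" "dist z b = dist z v" "0 < dist z v" "dist z v < 10 * \<delta>"
    "\<And>p. p \<in> S \<Longrightarrow> dist z v \<le> dist z p"
proof -
  obtain z r where z: "r > 0" "dist z v = r" "dist z a = r" "dist z b = r" "\<And>p. p \<in> S \<Longrightarrow> r \<le> dist z p"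
    using delaunay_circumcircle[OF K assms] by metis
  have "0 < 10 * \<delta>" using \<delta> by simp
  then obtain p where p: "p \<in> S" "dist z p < 10 * \<delta>" by (rule gromov_dense[OF S])
  then have "r < 10 * \<delta>" using z(5)[OF p(1)] by simp
  then show ?thesis using that[of z] z by simp
qed

text \<open>The side \<open>a b\<close> is at least \<open>10 * \<delta>\<close> and the
  circumradius is smaller, so the sine at \<open>v\<close> is at least 1/2 and the squared cosine at
  most 3/4.\<close>

lemma tri_angle:
  assumes "tri K v a b"
  shows "4 * ((a - v) \<bullet> (b - v))\<^sup>2 \<le> 3 * ((dist v a)\<^sup>2 * (dist v b)\<^sup>2)"
proof -
  obtain z where z: "dist z a = dist z v" "dist z b = dist z v" "0 < dist z v" "dist z v < 10 * \<delta>"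
    using tri_circumcentre[OF assms] by metis
  let ?A = "(dist v a)\<^sup>2 * (dist v b)\<^sup>2" and ?i = "((a - v) \<bullet> (b - v))\<^sup>2"
  have "(dist z v)\<^sup>2 \<le> (dist a b)\<^sup>2" using z(4) tri_sides(3)[OF assms] by (intro power_mono) auto
  then have "(dist z v)\<^sup>2 * ?A \<le> (dist a b)\<^sup>2 * ?A" by (intro mult_right_mono) auto
  also have "\<dots> = (dist z v)\<^sup>2 * (4 * (?A - ?i))" using circumradius_sine[OF z(1,2)] by (simp add: mult_ac)
  finally have "?A \<le> 4 * (?A - ?i)" using z(3) by simp
  then show ?thesis by simp
qed

text \<open>As the sine at \<open>v\<close> is at least 1/2, a point on the ray towards
  \<open>a\<close> has distance at least half its distance from \<open>v\<close> to the whole line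
  through \<open>v\<close> and \<open>b\<close>.\<close>

lemma tri_ray_dist:
  assumes "tri K v a b" "0 \<le> s"
  shows "s * dist v a / 2 \<le> dist (v + s *\<^sub>R (a - v)) (v + t *\<^sub>R (b - v))"
proof (rule power2_le_imp_le)
  define A B i where "A = dist v a" and "B = dist v b" and "i = (a - v) \<bullet> (b - v)"
  have B: "0 < B" using tri_sides(2)[OF assms(1)] \<delta> unfolding B_def by linarith
  \<comment> \<open>Completing the square in \<open>t\<close>; the remaining term is nonnegative by
    \<open>tri_angle\<close>.\<close>
  have "B\<^sup>2 * (4 * (s\<^sup>2 * A\<^sup>2 - 2 * s * t * i + t\<^sup>2 * B\<^sup>2) - s\<^sup>2 * A\<^sup>2)
      = s\<^sup>2 * (3 * (A\<^sup>2 * B\<^sup>2) - 4 * i\<^sup>2) + 4 * (s * i - t * B\<^sup>2)\<^sup>2"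
    by (simp add: power2_eq_square algebra_simps)
  moreover have "0 \<le> s\<^sup>2 * (3 * (A\<^sup>2 * B\<^sup>2) - 4 * i\<^sup>2)"
    using tri_angle[OF assms(1)] by (intro mult_nonneg_nonneg) (auto simp: A_def B_def i_def)
  ultimately have "0 \<le> B\<^sup>2 * (4 * (s\<^sup>2 * A\<^sup>2 - 2 * s * t * i + t\<^sup>2 * B\<^sup>2) - s\<^sup>2 * A\<^sup>2)" by simp
  then have "s\<^sup>2 * A\<^sup>2 \<le> 4 * (s\<^sup>2 * A\<^sup>2 - 2 * s * t * i + t\<^sup>2 * B\<^sup>2)" using B by (simp add: zero_le_mult_iff)
  moreover have "(dist (v + s *\<^sub>R (a - v)) (v + t *\<^sub>R (b - v)))\<^sup>2 = s\<^sup>2 * A\<^sup>2 - 2 * s * t * i + t\<^sup>2 * B\<^sup>2"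
  proof -
    have "A\<^sup>2 = (a - v) \<bullet> (a - v)" "B\<^sup>2 = (b - v) \<bullet> (b - v)"
      unfolding A_def B_def dist_commute[of v] dist_norm power2_norm_eq_inner
      by (simp_all add: inner_diff inner_commute)
    moreover have "(s *\<^sub>R U - t *\<^sub>R W) \<bullet> (s *\<^sub>R U - t *\<^sub>R W)
        = s\<^sup>2 * (U \<bullet> U) - 2 * s * t * (U \<bullet> W) + t\<^sup>2 * (W \<bullet> W)" for U W :: "real^2"
      by (simp add: inner_diff inner_commute power2_eq_square algebra_simps)
    moreover have "v + s *\<^sub>R (a - v) - (v + t *\<^sub>R (b - v)) = s *\<^sub>R (a - v) - t *\<^sub>R (b - v)" by simp
    ultimately show ?thesis unfolding dist_norm power2_norm_eq_inner i_def by simp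
  qed
  ultimately show "(s * dist v a / 2)\<^sup>2 \<le> (dist (v + s *\<^sub>R (a - v)) (v + t *\<^sub>R (b - v)))\<^sup>2"
    by (simp add: A_def power_mult_distrib power_divide)
qed simp

lemma tri_altitude:
  assumes "tri K v a b" "w \<in> closed_segment a b"
  shows "5 * \<delta> \<le> dist v w"
proof -
  obtain t where t: "w = (1 - t) *\<^sub>R a + t *\<^sub>R b" using assms(2) by (auto simp: in_segment)
  have "1 * dist a v / 2 \<le> dist (a + 1 *\<^sub>R (v - a)) (a + t *\<^sub>R (b - a))"
    by (rule tri_ray_dist[OF tri_perm(1)[OF assms(1)]]) simp
  moreover have "a + t *\<^sub>R (b - a) = w" unfolding t by (simp add: algebra_simps)
  ultimately show ?thesis using tri_sides(1)[OF assms(1)] by (simp add: dist_commute)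
qed

lemma chosen_point_corner:
  assumes "tri K v a b"
  shows "corner_point \<delta> v a b (chosen_point \<delta> v {a, b})"
proof -
  obtain z where z: "dist z a = dist z v" "dist z b = dist z v" "dist z v < 10 * \<delta>"
    using tri_circumcentre[OF assms] by metis
  have "dist (shrink v z) (shrink v w) = dist (shrink v z) v" if "dist z w = dist z v" for w
    using that by (simp add: dist_shrink)
  then obtain x where "corner_point \<delta> v a b x"
    using corner_point_exists[OF \<delta>, of v "shrink v a" "shrink v b" "shrink v z"] tri_sides[OF assms] z
    unfolding corner_point_def by (auto simp: dist_shrink)
  then have "\<exists>x a' b'. {a, b} = {a', b'} \<and> corner_point \<delta> v a' b' x" by blast
  then have "\<exists>a' b'. {a, b} = {a', b'} \<and> corner_point \<delta> v a' b' (chosen_point \<delta> v {a, b})"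
    unfolding chosen_point_def by (rule someI_ex)
  then show ?thesis using corner_point_sym by (auto simp: doubleton_eq_iff)
qed

lemma tri_hull_inject:
  assumes "tri K a b c" "tri K a' b' c'" "convex hull {a, b, c} = convex hull {a', b', c'}"
  shows "{a, b, c} = {a', b', c'}"
  by (rule convex_hull_affine_independent_inject[OF assms(1)[unfolded tri_def, THEN conjunct1]
        assms(2)[unfolded tri_def, THEN conjunct1] assms(3)])

lemma edge_point_in_tri:
  assumes "y \<in> edge_points \<delta> K" "tri K u v w" "y \<in> convex hull {u, v, w}"
  obtains c d e j where "tri K c d e" "{c, d, e} = {u, v, w}" "y = cut_point \<delta> c d j"
proof -
  obtain c d j where y: "y = cut_point \<delta> c d j" "c \<noteq> d" "closed_segment c d \<in> K"
    using assms(1) unfolding edge_points_def by auto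
  have "y \<in> closed_segment c d" unfolding y(1) by (rule cut_point_in_segment[OF \<delta> edge_length[OF y(3,2)]])
  then consider "{c, d} \<subseteq> {u, v, w}" | "y \<in> {u, v, w}"
    using edge_Int_tri[OF K_lf assms(2) y(3) _ assms(3)] by blast
  then show ?thesis
  proof cases
    case 1
    then obtain e where "tri K c d e" "{c, d, e} = {u, v, w}"
      using assms(2) tri_perm[OF assms(2)] y(2) by (auto simp: insert_commute)
    then show ?thesis using that y(1) by blast
  next
    case 2
    then obtain d e where "tri K y d e" "{y, d, e} = {u, v, w}"
      using assms(2) tri_perm[OF assms(2)] by (auto simp: insert_commute)
    moreover have "y = cut_point \<delta> y d 0" by (simp add: cut_point_def cut_param_def)
    ultimately show ?thesis using that by blast
  qed
qed

text \<open>The point lies in the open sector within \<open>2 * \<delta>\<close> of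
  \<open>v\<close>, whereas the opposite side is at least \<open>5 * \<delta>\<close> away.\<close>

lemma corner_extra_interior:
  assumes "tri K v a b" "corner_extra \<delta> v (shrink v a) (shrink v b) x"
  shows "x \<in> interior (convex hull {v, a, b})"
proof -
  obtain l m where lm: "0 < l" "0 < m" "x = v + l *\<^sub>R (shrink v a - v) + m *\<^sub>R (shrink v b - v)"
    and near: "dist v x < 2 * \<delta>" using assms(2) unfolding corner_extra_def by blast
  define s where "s = (l + m) / 10"
  have s: "0 < s" using lm by (simp add: s_def)
  have x: "x = v + (l / 10) *\<^sub>R (a - v) + (m / 10) *\<^sub>R (b - v)" using lm(3) by (simp add: shrink_def)
  define w where "w = (l / (l + m)) *\<^sub>R a + (m / (l + m)) *\<^sub>R b"
  have lm1: "l / (l + m) + m / (l + m) = 1" using lm(1,2) by (simp add: add_divide_distrib[symmetric])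
  have "w \<in> closed_segment a b"
    unfolding in_segment w_def using lm(1,2) lm1
    by (intro exI[of _ "m / (l + m)"]) (simp add: eq_diff_eq)
  then have "5 * \<delta> \<le> dist v w" by (rule tri_altitude[OF assms(1)])
  moreover have "x = v + s *\<^sub>R (w - v)"
  proof -
    have "s *\<^sub>R w = (l / 10) *\<^sub>R a + (m / 10) *\<^sub>R b"
    proof -
      have "s * (l / (l + m)) = l / 10" "s * (m / (l + m)) = m / 10" using lm(1,2) by (simp_all add: s_def field_simps)
      then show ?thesis by (simp only: w_def scaleR_add_right scaleR_scaleR)
    qed
    then show ?thesis unfolding x by (simp add: s_def algebra_simps add_divide_distrib)
  qed
  then have "dist v x = s * dist v w" using dist_on_ray[of v 0 w s] s by simp
  ultimately have "s * (5 * \<delta>) < 2 * \<delta>" using near s by (metis mult_left_mono less_imp_le order_le_less_trans)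
  then have s1: "s < 1" using \<delta> by (simp add: mult.assoc[symmetric])
  have "\<not> collinear {v, a, b}" using assms(1) by (auto simp: tri_def collinear_3_eq_affine_dependent)
  moreover have "\<exists>x' y' z'. 0 < x' \<and> 0 < y' \<and> 0 < z' \<and> x' + y' + z' = 1 \<and> x' *\<^sub>R v + y' *\<^sub>R a + z' *\<^sub>R b = x"
    using lm(1,2) s1 unfolding x
    by (intro exI[of _ "1 - s"] exI[of _ "l / 10"] exI[of _ "m / 10"]) (simp add: s_def algebra_simps add_divide_distrib)
  ultimately show ?thesis by (subst interior_convex_hull_3_minimal) auto
qed

text \<open>Extra points are interior to their triangle, so a triangle contains only its own; edge
  points in it lie on its own edges.\<close>

lemma prescribed_point_cases:
  assumes "y \<in> prescribed_points \<delta> K" "tri K u v w" "y \<in> convex hull {u, v, w}"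
  obtains (edge) c d e j where "tri K c d e" "{c, d, e} = {u, v, w}" "y = cut_point \<delta> c d j"
  | (extra) c d e where "tri K c d e" "{c, d, e} = {u, v, w}" "y = chosen_point \<delta> c {d, e}"
      "corner_extra \<delta> c (shrink c d) (shrink c e) y"
proof (cases "y \<in> edge_points \<delta> K")
  case True
  then show ?thesis using edge_point_in_tri[OF True assms(2,3)] edge by blast
next
  case False
  then obtain c d e where t: "tri K c d e" "y = chosen_point \<delta> c {d, e}"
    using assms(1) unfolding prescribed_points_def by auto
  \<comment> \<open>The default value \<open>c\<close> of the chosen point is an old vertex and
    therefore already an edge point, with index 0.\<close>
  have "y \<noteq> c"
  proof
    assume "y = c"
    then have "y = cut_point \<delta> c d 0" by (simp add: cut_point_def cut_param_def)
    moreover have "c \<noteq> d" "closed_segment c d \<in> K" using t(1) tri_faces(4)[OF K_lf t(1)] by (auto simp: tri_def)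
    ultimately show False using False unfolding edge_points_def by blast
  qed
  then have x: "corner_extra \<delta> c (shrink c d) (shrink c e) y"
    using chosen_point_corner[OF t(1)] t(2) unfolding corner_point_def by auto
  have "y \<in> interior (convex hull {c, d, e})" by (rule corner_extra_interior[OF t(1) x])
  moreover have "convex hull {c, d, e} \<in> triangles K" "convex hull {u, v, w} \<in> triangles K"
    using t(1) assms(2) by (auto simp: triangles_iff_tri)
  ultimately have "convex hull {c, d, e} = convex hull {u, v, w}"
    using triangle_eq_if_interior_meets[OF K_lf] assms(3) by blast
  then have "{c, d, e} = {u, v, w}" by (rule tri_hull_inject[OF t(1) assms(2)])
  then show ?thesis using extra t x by blast
qed

lemma tri_edge_cases:
  assumes "tri K a b c" "tri K u v w" "{u, v, w} = {a, b, c}"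
  shows "{a, b} = {u, v} \<or> {a, b} = {u, w} \<or> {a, b} = {v, w}"
proof -
  have d: "a \<noteq> c" "b \<noteq> c" "u \<noteq> v" "u \<noteq> w" "v \<noteq> w" using assms(1,2) by (auto simp: tri_def)
  have "{a, b} = {u, v, w} - {c}" unfolding assms(3) using d by auto
  moreover have "c = u \<or> c = v \<or> c = w" using assms(3) by blast
  ultimately show ?thesis using d by (auto simp: insert_Diff_if)
qed

lemma cut_point_reorient:
  assumes "tri K c d e" "{c', d'} = {c, d}" "y = cut_point \<delta> c' d' j"
  shows "\<exists>i. y = cut_point \<delta> c d i"
proof -
  have "(c' = c \<and> d' = d) \<or> (c' = d \<and> d' = c)" using assms(2) by (auto simp: doubleton_eq_iff)
  then show ?thesis
  proof
    assume "c' = d \<and> d' = c"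
    then show ?thesis
      using cut_point_flip[OF \<delta>, of d c j] tri_sides(1)[OF assms(1)] assms(3) by (simp add: dist_commute)
  qed (use assms(3) in blast)
qed

lemma cut_point_far_from_edge:
  assumes "tri K c d e" "q \<in> closed_segment c e" "cut_point \<delta> c d j \<notin> closed_segment c e"
  shows "\<delta> / 2 \<le> dist (cut_point \<delta> c d j) q"
proof -
  note L = tri_sides(1)[OF assms(1)]
  define t where "t = cut_param \<delta> (dist c d) j"
  have "t \<noteq> 0" using assms(3) by (auto simp: cut_point_def t_def)
  then have "cut_param \<delta> (dist c d) 0 < t" using cut_param_bounds(1)[OF \<delta> L, of j] by (simp add: t_def cut_param_def)
  then have "\<delta> \<le> t * dist c d" "0 < t"
    using cut_param_separated[OF \<delta> L, of 0 j] by (auto simp: t_def cut_param_def)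
  moreover obtain u where "q = (1 - u) *\<^sub>R c + u *\<^sub>R e" using assms(2) by (auto simp: in_segment)
  then have "q = c + u *\<^sub>R (e - c)" by (simp add: algebra_simps)
  ultimately show ?thesis
    using tri_ray_dist[OF assms(1), of t u] by (simp add: cut_point_def t_def)
qed

lemma shrink_ray: "v + t *\<^sub>R (a - v) = v + (10 * t) *\<^sub>R (shrink v a - v)"
  by (simp add: shrink_def)

lemma corner_extra_far:
  assumes "corner_extra \<delta> c (shrink c d) (shrink c e) x" "w \<in> {d, e}"
  shows "\<delta> / 2 \<le> dist (c + t *\<^sub>R (w - c)) x"
  unfolding shrink_ray[of c t w] using assms unfolding corner_extra_def by blast

text \<open>This is the hypothesis \<open>far\<close> of \<open>ball_in_star\<close> for
  \<open>r = \<delta> / 2\<close>. A cut point is at least \<delta> from the end it shares with the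
  edge, and the sine bound halves this; for extra points the bound comes from their definition or
  from the altitude.\<close>

lemma prescribed_point_far:
  assumes "y \<in> prescribed_points \<delta> K" "tri K a b c" "y \<in> convex hull {a, b, c}"
    and q: "q \<in> closed_segment a b" and y: "y \<notin> closed_segment a b"
  shows "\<delta> / 2 \<le> dist y q"
  using assms(1-3)
proof (cases rule: prescribed_point_cases)
  case (edge u v w j)
  have "{a, b} \<noteq> {u, v}"
  proof
    assume "{a, b} = {u, v}"
    then have "y \<in> closed_segment a b"
      using cut_point_in_segment[OF \<delta> tri_sides(1)[OF edge(1)], of j] edge(3) by (simp add: segment_convex_hull)
    then show False using y by simp
  qed
  then consider "{a, b} = {u, w}" | "{a, b} = {v, w}" using tri_edge_cases[OF assms(2) edge(1,2)] by blast
  then show ?thesis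
  proof cases
    case 1
    then show ?thesis
      using cut_point_far_from_edge[OF edge(1), of q j] q y edge(3) by (simp add: segment_convex_hull)
  next
    case 2
    obtain i where "y = cut_point \<delta> v u i"
      using cut_point_reorient[OF tri_perm(1)[OF edge(1)] _ edge(3)] by (auto simp: insert_commute)
    then show ?thesis
      using cut_point_far_from_edge[OF tri_perm(1)[OF edge(1)], of q i] q y 2 by (simp add: segment_convex_hull)
  qed
next
  case (extra u v w)
  have far: "\<delta> / 2 \<le> dist y q" if v': "q \<in> closed_segment u v'" "v' \<in> {v, w}" for v'
  proof -
    obtain t where "q = (1 - t) *\<^sub>R u + t *\<^sub>R v'" using v'(1) by (auto simp: in_segment)
    then have "q = u + t *\<^sub>R (v' - u)" by (simp add: algebra_simps)
    then show ?thesis using corner_extra_far[OF extra(4) v'(2), of t] by (simp add: dist_commute)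
  qed
  consider "{a, b} = {u, v}" | "{a, b} = {u, w}" | "{a, b} = {v, w}"
    using tri_edge_cases[OF assms(2) extra(1,2)] by blast
  then show ?thesis
  proof cases
    case 1 then show ?thesis using far[of v] q by (simp add: segment_convex_hull)
  next
    case 2 then show ?thesis using far[of w] q by (simp add: segment_convex_hull)
  next
    case 3
    then have "5 * \<delta> \<le> dist u q" using tri_altitude[OF extra(1)] q by (simp add: segment_convex_hull)
    moreover have "dist u y < 2 * \<delta>" using extra(4) by (simp add: corner_extra_def)
    ultimately show ?thesis using dist_triangle[of u q y] \<delta> by linarith
  qed
qed

text \<open>The sine bound settles the case of a cut point at least \<open>2 * \<delta>\<close> away
  from \<open>u\<close>. Second cuts are at least \<open>21/10 * \<delta>\<close> away, so otherwise
  both points are \<open>u\<close> or first cuts, which are homothetic images of \<open>p\<close>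
  and \<open>q\<close>.\<close>

lemma cut_points_adjacent_edges:
  assumes "tri K u p q" "cut_point \<delta> u p i \<noteq> cut_point \<delta> u q j"
  shows "\<delta> \<le> dist (cut_point \<delta> u p i) (cut_point \<delta> u q j)"
proof -
  note L = tri_sides(1,2)[OF assms(1)]
  define s t where "s = cut_param \<delta> (dist u p) i" and "t = cut_param \<delta> (dist u q) j"
  have st: "0 \<le> s" "0 \<le> t" using cut_param_bounds(1)[OF \<delta>] L by (auto simp: s_def t_def)
  have y: "cut_point \<delta> u p i = u + s *\<^sub>R (p - u)" "cut_point \<delta> u q j = u + t *\<^sub>R (q - u)"
    by (simp_all add: cut_point_def s_def t_def)
  have 1: "s * dist u p / 2 \<le> dist (u + s *\<^sub>R (p - u)) (u + t *\<^sub>R (q - u))" by (rule tri_ray_dist[OF assms(1) st(1)])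
  have 2: "t * dist u q / 2 \<le> dist (u + t *\<^sub>R (q - u)) (u + s *\<^sub>R (p - u))"
    by (rule tri_ray_dist[OF tri_perm(2)[OF assms(1)] st(2)])
  have s: "s = 0 \<or> s = 1/10 \<or> dist u p / 10 + 11/10 * \<delta> \<le> s * dist u p"
    using cut_param_cases[OF \<delta> L(1)] by (simp add: s_def)
  have t: "t = 0 \<or> t = 1/10 \<or> dist u q / 10 + 11/10 * \<delta> \<le> t * dist u q"
    using cut_param_cases[OF \<delta> L(2)] by (simp add: t_def)
  show ?thesis
  proof (cases "2 * \<delta> \<le> s * dist u p \<or> 2 * \<delta> \<le> t * dist u q")
    case True
    then show ?thesis
    proof
      assume "2 * \<delta> \<le> s * dist u p" then show ?thesis unfolding y using 1 by linarith
    next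
      assume "2 * \<delta> \<le> t * dist u q"
      then have "\<delta> \<le> dist (u + t *\<^sub>R (q - u)) (u + s *\<^sub>R (p - u))" using 2 by linarith
      then show ?thesis unfolding y by (subst dist_commute)
    qed
  next
    case False
    then have s: "s = 0 \<or> s = 1/10" and t: "t = 0 \<or> t = 1/10" using s t L \<delta> by auto
    consider "s = 0" "t = 1/10" | "s = 1/10" "t = 0" | "s = 1/10" "t = 1/10"
      using s t assms(2) unfolding y by auto
    then show ?thesis
    proof cases
      case 1 show ?thesis unfolding y 1 using dist_on_ray[of u 0 q "1/10"] L(2) by simp
    next
      case 2 show ?thesis unfolding y 2 using dist_on_ray[of u "1/10" p 0] L(1) by simp
    next
      case 3 show ?thesis unfolding y 3 using dist_shrink(2)[of u p q] tri_sides(3)[OF assms(1)] by (simp add: shrink_def)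
    qed
  qed
qed

lemma corner_extra_edge_separated:
  assumes "tri K c d e" "corner_extra \<delta> c (shrink c d) (shrink c e) x"
  shows "\<delta> \<le> dist (cut_point \<delta> c d j) x"
proof -
  define t where "t = cut_param \<delta> (dist c d) j"
  have y: "cut_point \<delta> c d j = c + t *\<^sub>R (d - c)" by (simp add: cut_point_def t_def)
  consider "t = 0" | "t = 1/10" | "dist c d / 10 + 11/10 * \<delta> \<le> t * dist c d"
    using cut_param_cases[OF \<delta> tri_sides(1)[OF assms(1)]] unfolding t_def by blast
  then show ?thesis
  proof cases
    case 1 then show ?thesis unfolding y using assms(2) by (simp add: corner_extra_def)
  next
    case 2
    then have "cut_point \<delta> c d j = shrink c d" by (simp add: y shrink_def)
    then show ?thesis using assms(2) by (simp add: corner_extra_def)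
  next
    case 3
    then have "dist c (shrink c d) + 11/10 * \<delta> \<le> (10 * t) * dist c (shrink c d)" by (simp add: dist_shrink)
    then show ?thesis unfolding y shrink_ray[of c t d] using assms(2) unfolding corner_extra_def by blast
  qed
qed

lemma corner_extra_opposite_separated:
  assumes "tri K c d e" "corner_extra \<delta> c (shrink c d) (shrink c e) x" "y \<in> closed_segment d e"
  shows "\<delta> \<le> dist y x"
proof -
  have "5 * \<delta> \<le> dist c y" by (rule tri_altitude[OF assms(1,3)])
  moreover have "dist c x < 2 * \<delta>" using assms(2) by (simp add: corner_extra_def)
  ultimately show ?thesis using dist_triangle[of c y x] \<delta> by (simp add: dist_commute)
qed

lemma extra_edge_point_separated:
  assumes x: "tri K c d e" "corner_extra \<delta> c (shrink c d) (shrink c e) x"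
    and y: "tri K c' d' e'" "{c', d', e'} = {c, d, e}" "y = cut_point \<delta> c' d' j"
  shows "\<delta> \<le> dist y x"
proof -
  consider "{c', d'} = {c, d}" | "{c', d'} = {c, e}" | "{c', d'} = {d, e}"
    using tri_edge_cases[OF y(1) x(1) y(2)[symmetric]] by blast
  then show ?thesis
  proof cases
    case 1
    then obtain i where "y = cut_point \<delta> c d i" using cut_point_reorient[OF x(1) _ y(3)] by blast
    then show ?thesis using corner_extra_edge_separated[OF x] by simp
  next
    case 2
    then obtain i where "y = cut_point \<delta> c e i" using cut_point_reorient[OF tri_perm(2)[OF x(1)] _ y(3)] by blast
    then show ?thesis
      using corner_extra_edge_separated[OF tri_perm(2)[OF x(1)] corner_extra_sym[OF x(2)]] by simp
  next
    case 3
    then have "y \<in> closed_segment d e"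
      using cut_point_in_segment[OF \<delta> tri_sides(1)[OF y(1)], of j] y(3) by (simp add: segment_convex_hull)
    then show ?thesis by (rule corner_extra_opposite_separated[OF x])
  qed
qed

lemma prescribed_separated_in_tri:
  assumes y: "y \<in> prescribed_points \<delta> K" "y \<in> convex hull {a, b, c}"
    and w: "w \<in> prescribed_points \<delta> K" "w \<in> convex hull {a, b, c}" and t: "tri K a b c" and "y \<noteq> w"
  shows "\<delta> \<le> dist y w"
  using y(1) t y(2)
proof (cases rule: prescribed_point_cases)
  case Y: (edge c d e j)
  show ?thesis
    using w(1) t w(2)
  proof (cases rule: prescribed_point_cases)
    case W: (edge c' d' e' j')
    have "{c, d, e} = {c', d', e'}" using Y(2) W(2) by simp
    then consider "{c', d'} = {c, d}" | "{c', d'} = {c, e}" | "{c', d'} = {d, e}"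
      using tri_edge_cases[OF W(1) Y(1)] by blast
    then show ?thesis
    proof cases
      case 1
      then obtain i where "w = cut_point \<delta> c d i" using cut_point_reorient[OF Y(1) _ W(3)] by blast
      then show ?thesis using cut_points_separated[OF \<delta> tri_sides(1)[OF Y(1)], of j i] Y(3) \<open>y \<noteq> w\<close> by simp
    next
      case 2
      then obtain i where "w = cut_point \<delta> c e i" using cut_point_reorient[OF tri_perm(2)[OF Y(1)] _ W(3)] by blast
      then show ?thesis using cut_points_adjacent_edges[OF Y(1), of j i] Y(3) \<open>y \<noteq> w\<close> by simp
    next
      case 3
      then obtain i where i: "w = cut_point \<delta> d e i" using cut_point_reorient[OF tri_perm(4)[OF Y(1)] _ W(3)] by blast
      obtain i' where "y = cut_point \<delta> d c i'"
        using cut_point_reorient[OF tri_perm(1)[OF Y(1)] _ Y(3)] by (auto simp: insert_commute)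
      then show ?thesis using cut_points_adjacent_edges[OF tri_perm(1)[OF Y(1)], of i' i] i \<open>y \<noteq> w\<close> by simp
    qed
  next
    case W: (extra c' d' e')
    show ?thesis by (rule extra_edge_point_separated[OF W(1,4) Y(1) _ Y(3)]) (use Y(2) W(2) in simp)
  qed
next
  case Y: (extra c d e)
  show ?thesis
    using w(1) t w(2)
  proof (cases rule: prescribed_point_cases)
    case W: (edge c' d' e' j')
    have "\<delta> \<le> dist w y" by (rule extra_edge_point_separated[OF Y(1,4) W(1) _ W(3)]) (use Y(2) W(2) in simp)
    then show ?thesis by (simp add: dist_commute)
  next
    case W: (extra c' d' e')
    have eq: "{c, d, e} = {c', d', e'}" using Y(2) W(2) by simp
    have "c \<noteq> c'"
    proof
      assume "c = c'"
      have A: "{d, e} = {c, d, e} - {c}" and B: "{d', e'} = {c', d', e'} - {c'}"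
        using Y(1) W(1) by (auto simp: tri_def)
      have "{c, d, e} - {c} = {c', d', e'} - {c'}" unfolding eq by (simp only: \<open>c = c'\<close>)
      then have "{d, e} = {d', e'}" by (rule trans[OF A trans[OF _ B[symmetric]]])
      then show False using Y(3) W(3) \<open>c = c'\<close> \<open>y \<noteq> w\<close> by simp
    qed
    moreover have "c' \<in> {c, d, e}" unfolding eq by simp
    ultimately have "c' = d \<or> c' = e" by auto
    then have "10 * \<delta> \<le> dist c c'" using tri_sides(1,2)[OF Y(1)] by auto
    moreover have "dist c y < 2 * \<delta>" "dist c' w < 2 * \<delta>" using Y(4) W(4) by (simp_all add: corner_extra_def)
    ultimately show ?thesis
      using dist_triangle[of c c' y] dist_triangle[of y c' w] \<delta> by (simp add: dist_commute)
  qed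
qed

text \<open>If two points were closer than \<delta>, a triangle containing their midpoint would
  contain both by the star argument, and within one triangle only finitely many kinds of pairs
  occur.\<close>

lemma prescribed_points_separated: "separated \<delta> (prescribed_points \<delta> K)"
  unfolding separated_def
proof (intro ballI impI)
  fix y w assume y: "y \<in> prescribed_points \<delta> K" and w: "w \<in> prescribed_points \<delta> K" and "y \<noteq> w"
  show "\<delta> \<le> dist y w"
  proof (rule ccontr)
    assume "\<not> \<delta> \<le> dist y w"
    then have m: "dist y (midpoint y w) < \<delta> / 2" "dist w (midpoint y w) < \<delta> / 2"
      by (simp_all add: dist_midpoint)
    obtain \<Delta> where \<Delta>: "\<Delta> \<in> triangles K" "midpoint y w \<in> \<Delta>" using triangles_cover[OF K_lf K_cover] by metis
    have in\<Delta>: "x \<in> \<Delta>" if "x \<in> prescribed_points \<delta> K" "dist x (midpoint y w) < \<delta> / 2" for x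
      by (rule ball_in_star[OF K_lf K_cover _ \<Delta> that(2)]) (rule prescribed_point_far[OF that(1)])
    obtain a b c where abc: "tri K a b c" "\<Delta> = convex hull {a, b, c}" using \<Delta>(1) by (auto simp: triangles_iff_tri)
    have "\<delta> \<le> dist y w"
      using prescribed_separated_in_tri[OF y _ w _ abc(1) \<open>y \<noteq> w\<close>] in\<Delta>[OF y m(1)] in\<Delta>[OF w m(2)] abc(2) by simp
    then show False using \<open>\<not> \<delta> \<le> dist y w\<close> by simp
  qed
qed

end

section \<open>Short edges\<close>

text \<open>By the parallelogram law, twice the power of \<open>x\<close> for the diametral circle
  is \<open>|x - p|^2 + |x - q|^2 - |p - q|^2\<close>, which is positive for all other
  points.\<close>

lemma short_edge_forced:
  assumes K: "delaunay_triangulation P K" "\<Union>K = UNIV" and pq: "p \<in> P" "q \<in> P" "p \<noteq> q"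
    and far: "\<And>x. x \<in> P \<Longrightarrow> x \<noteq> p \<Longrightarrow> x \<noteq> q \<Longrightarrow> \<beta> \<le> dist x p \<and> \<beta> \<le> dist x q"
    and "0 \<le> \<beta>" and short: "(dist p q)\<^sup>2 < 2 * \<beta>\<^sup>2"
  shows "closed_segment p q \<in> K"
proof -
  define m s where "m = midpoint p q" and "s = dist p q / 2"
  have power: "2 * disc_power m s x = (dist x p)\<^sup>2 + (dist x q)\<^sup>2 - (dist p q)\<^sup>2" for x
  proof -
    have m: "m = (1/2) *\<^sub>R (p + q)" by (simp add: m_def midpoint_def)
    show ?thesis
      unfolding disc_power_def s_def power_divide dist_norm power2_norm_eq_inner m
      by (simp add: inner_diff inner_add inner_commute field_simps)
  qed
  show ?thesis
  proof (rule delaunay_forced_edge[OF K pq, of m s])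
    show "disc_power m s p = 0" "disc_power m s q = 0"
      using power[of p] power[of q] by (simp_all add: dist_commute)
    fix x assume x: "x \<in> P" "x \<noteq> p" "x \<noteq> q"
    have "\<beta>\<^sup>2 \<le> (dist x p)\<^sup>2" "\<beta>\<^sup>2 \<le> (dist x q)\<^sup>2" using far[OF x] \<open>0 \<le> \<beta>\<close> by (auto intro: power_mono)
    then show "0 < disc_power m s x" using power[of x] short by linarith
  qed
qed

text \<open>After the perturbation the points are at least \<open>98/100 * \<delta>\<close> apart
  and the edge has length at most \<open>128/100 * \<delta>\<close>; the claim follows from
  \<open>(128/100)^2 < 2 * (98/100)^2\<close>. The image is still coarsely dense, so its Delaunay
  triangulations cover the plane.\<close>

lemma short_edge_stable:
  assumes P: "gromov \<delta> P" and \<delta>: "0 < \<delta>" and ab: "a \<in> P" "b \<in> P" "a \<noteq> b" and short: "dist a b \<le> 126/100 * \<delta>"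
  shows "stable_segment (1 / 100 * \<delta>) P a b"
  unfolding stable_segment_def
proof (intro conjI allI impI)
  have sep: "separated \<delta> P" using P by (simp add: gromov_def)
  show "discrete P" by (rule separated_discrete[OF sep \<delta>])
  show "a \<in> P" "b \<in> P" by fact+
  fix \<iota> assume "embedding_map (top_of_set P) euclidean \<iota> \<and> (\<forall>x\<in>P. norm (\<iota> x - x) < 1 / 100 * \<delta>)"
  then have \<iota>: "dist (\<iota> x) x < \<delta> / 100" if "x \<in> P" for x using that by (simp add: dist_norm)
  have far: "98/100 * \<delta> \<le> dist (\<iota> x) (\<iota> y)" if "x \<in> P" "y \<in> P" "x \<noteq> y" for x y
  proof -
    have "\<delta> \<le> dist x y" using sep that unfolding separated_def by blast
    moreover have "dist x y \<le> dist x (\<iota> x) + dist (\<iota> x) (\<iota> y) + dist (\<iota> y) y"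
      using dist_triangle[of x y "\<iota> x"] dist_triangle[of "\<iota> x" y "\<iota> y"] by linarith
    ultimately show ?thesis using \<iota>[OF that(1)] \<iota>[OF that(2)] by (simp add: dist_commute)
  qed
  have cover: "convex hull (\<iota> ` P) = UNIV"
  proof (rule convex_hull_coarsely_dense)
    fix x
    obtain p where p: "p \<in> P" "dist x p < \<delta>" by (rule gromov_dense[OF P \<delta>])
    have "dist x (\<iota> p) \<le> 2 * \<delta>"
      using dist_triangle[of x "\<iota> p" p] p(2) \<iota>[OF p(1)] \<delta> by (simp add: dist_commute)
    then show "\<exists>q\<in>\<iota> ` P. dist x q \<le> 2 * \<delta>" using p(1) by blast
  qed
  have ne: "\<iota> a \<noteq> \<iota> b" using far[OF ab] \<delta> by auto
  show "in_delaunay_graph (\<iota> ` P) (\<iota> a) (\<iota> b)"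
    unfolding in_delaunay_graph_def
  proof (intro conjI allI impI)
    show "\<iota> a \<in> \<iota> ` P" "\<iota> b \<in> \<iota> ` P" using ab by auto
    fix K assume K: "delaunay_triangulation (\<iota> ` P) K"
    have "closed_segment (\<iota> a) (\<iota> b) \<in> K"
    proof (rule short_edge_forced[OF K _ _ _ ne, of "98/100 * \<delta>"])
      show "\<Union>K = UNIV" using delaunay_triangulationD(3)[OF K] cover by simp
      show "\<iota> a \<in> \<iota> ` P" "\<iota> b \<in> \<iota> ` P" using ab by auto
      show "98/100 * \<delta> \<le> dist x (\<iota> a) \<and> 98/100 * \<delta> \<le> dist x (\<iota> b)"
        if x: "x \<in> \<iota> ` P" "x \<noteq> \<iota> a" "x \<noteq> \<iota> b" for x
      proof -
        obtain y where "x = \<iota> y" "y \<in> P" "y \<noteq> a" "y \<noteq> b" using x by auto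
        then show ?thesis using far[of y a] far[of y b] ab by simp
      qed
      have "dist (\<iota> a) (\<iota> b) \<le> dist (\<iota> a) a + dist a b + dist b (\<iota> b)"
        using dist_triangle[of "\<iota> a" "\<iota> b" a] dist_triangle[of a "\<iota> b" b] by linarith
      also have "\<dots> \<le> 128/100 * \<delta>" using \<iota>[OF ab(1)] \<iota>[OF ab(2)] short by (simp add: dist_commute)
      finally have "(dist (\<iota> a) (\<iota> b))\<^sup>2 \<le> (128/100 * \<delta>)\<^sup>2" by (intro power_mono) auto
      also have "\<dots> < 2 * (98/100 * \<delta>)\<^sup>2" using \<delta> by (simp add: power_mult_distrib power_divide)
      finally show "(dist (\<iota> a) (\<iota> b))\<^sup>2 < 2 * (98/100 * \<delta>)\<^sup>2" .
    qed (use \<delta> in simp)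
    then show "closed_segment (\<iota> a) (\<iota> b) \<in> edges K" using ne edges_iff_segment by blast
  qed
qed

lemma ray_segment_iff:
  fixes c d :: "'a::real_normed_vector"
  assumes "c \<noteq> d" "s \<le> t"
  shows "c + u *\<^sub>R (d - c) \<in> closed_segment (c + s *\<^sub>R (d - c)) (c + t *\<^sub>R (d - c)) \<longleftrightarrow> s \<le> u \<and> u \<le> t"
proof -
  have "c + u *\<^sub>R (d - c) = (1 - w) *\<^sub>R (c + s *\<^sub>R (d - c)) + w *\<^sub>R (c + t *\<^sub>R (d - c))
      \<longleftrightarrow> u = (1 - w) * s + w * t" for w
  proof -
    have "(1 - w) *\<^sub>R (c + s *\<^sub>R (d - c)) + w *\<^sub>R (c + t *\<^sub>R (d - c)) = c + ((1 - w) * s + w * t) *\<^sub>R (d - c)"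
      by (simp add: algebra_simps)
    then show ?thesis using assms(1) by (simp only: add_left_cancel scaleR_cancel_right) auto
  qed
  then have "c + u *\<^sub>R (d - c) \<in> closed_segment (c + s *\<^sub>R (d - c)) (c + t *\<^sub>R (d - c)) \<longleftrightarrow> u \<in> closed_segment s t"
    unfolding in_segment by simp
  then show ?thesis using assms(2) by (simp add: closed_segment_eq_real_ivl)
qed

section \<open>The refined Delaunay triangulation\<close>

definition corner_apex :: "(real^2) set \<Rightarrow> (real^2) set \<Rightarrow> real^2" where
  "corner_apex S Q = (if Q \<inter> S \<noteq> {} then SOME v. v \<in> Q \<inter> S else SOME v. v \<in> Q)"

lemma corner_apex_in: "Q \<noteq> {} \<Longrightarrow> corner_apex S Q \<in> Q"
  unfolding corner_apex_def by (metis IntD1 ex_in_conv someI_ex)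

lemma disc_power_shrink:
  "disc_power (shrink v z) (dist (shrink v z) v) (shrink v x) = disc_power z (dist z v) x / 100"
  unfolding disc_power_def dist_shrink by (simp add: power_divide)

lemma affine_on_sector:
  fixes u :: "'a::real_inner"
  assumes "u \<bullet> v + k = 0" "0 \<le> u \<bullet> c + k" "0 \<le> u \<bullet> d + k" "0 \<le> l" "0 \<le> m"
  shows "0 \<le> u \<bullet> (v + l *\<^sub>R (c - v) + m *\<^sub>R (d - v)) + k"
proof -
  have "u \<bullet> (v + l *\<^sub>R (c - v) + m *\<^sub>R (d - v)) + k
      = (u \<bullet> v + k) + l * ((u \<bullet> c + k) - (u \<bullet> v + k)) + m * ((u \<bullet> d + k) - (u \<bullet> v + k))"
    by (simp add: inner_add_right inner_diff_right algebra_simps)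
  then show ?thesis using assms by simp
qed

text \<open>Here \<open>v\<close> is the origin, \<open>A\<close> and \<open>B\<close> are the chord
  ends and \<open>C\<close> is the centre. Two expressions for the squared norm \<open>N\<close> of
  the point give \<open>(l + m - 1) * N = l * m * |A - B|^2\<close>, so a point of the circle beyond
  the chord lies in the sector.\<close>

lemma circle_beyond_chord:
  fixes A B C :: "'a::real_inner"
  assumes C: "A \<bullet> A = 2 * (A \<bullet> C)" "B \<bullet> B = 2 * (B \<bullet> C)" and "A \<noteq> B"
    and q: "(l *\<^sub>R A + m *\<^sub>R B) \<bullet> (l *\<^sub>R A + m *\<^sub>R B) = 2 * ((l *\<^sub>R A + m *\<^sub>R B) \<bullet> C)" and "1 \<le> l + m"
  shows "0 \<le> l" "0 \<le> m"
proof -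
  define N where "N = (l *\<^sub>R A + m *\<^sub>R B) \<bullet> (l *\<^sub>R A + m *\<^sub>R B)"
  have N: "N = l * (A \<bullet> A) + m * (B \<bullet> B)"
    unfolding N_def q C by (simp add: inner_add_left algebra_simps)
  have N2: "N = l * l * (A \<bullet> A) + 2 * (l * m) * (A \<bullet> B) + m * m * (B \<bullet> B)"
    unfolding N_def by (simp add: inner_add_left inner_add_right inner_commute algebra_simps)
  have "(l + m - 1) * N = (l + m) * N - N" by (simp add: algebra_simps)
  also have "\<dots> = (l + m) * (l * (A \<bullet> A) + m * (B \<bullet> B))
      - (l * l * (A \<bullet> A) + 2 * (l * m) * (A \<bullet> B) + m * m * (B \<bullet> B))"
    by (simp only: N[symmetric] N2[symmetric])
  also have "\<dots> = (l * m) * ((A - B) \<bullet> (A - B))"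
    by (simp add: inner_diff inner_commute algebra_simps)
  finally have "(l + m - 1) * N = (l * m) * ((A - B) \<bullet> (A - B))" .
  moreover have "0 \<le> N" unfolding N_def by simp
  ultimately have "0 \<le> (l * m) * ((A - B) \<bullet> (A - B))" using assms(5) by (metis diff_ge_0_iff_ge mult_nonneg_nonneg)
  moreover have "0 < (A - B) \<bullet> (A - B)" using \<open>A \<noteq> B\<close> by simp
  ultimately have "0 \<le> l * m" by (simp add: zero_le_mult_iff)
  then show "0 \<le> l" "0 \<le> m" using assms(5) by (auto simp: zero_le_mult_iff)
qed

section \<open>Corners, edges and triangles of the refined complex\<close>

context
  fixes S :: "(real^2) set" and K :: "(real^2) set set" and \<delta> :: real and P :: "(real^2) set"
  assumes \<delta>: "0 < \<delta>" and S: "gromov (10 * \<delta>) S" and K: "delaunay_triangulation S K"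
    and P: "gromov \<delta> P" and prescribed: "prescribed_points \<delta> K \<subseteq> P"
begin

definition refined :: "(real^2) set set" where
  "refined = fan_complex P (corner_apex S)"

lemmas lfK = K_lf[OF \<delta> S K] and coverK = K_cover[OF \<delta> S K]

lemma refined_delaunay: "delaunay_triangulation P refined"
  unfolding refined_def by (rule fan_complex_delaunay[OF P \<delta> corner_apex_in])

lemma refined_cover: "\<Union>refined = UNIV"
  using delaunay_triangulationD(3)[OF refined_delaunay] gromov_convex_hull[OF P \<delta>] by simp

lemmas refined_lf = delaunay_triangulationD(1)[OF refined_delaunay]

lemma P_dist:
  assumes "x \<in> P" "y \<in> P" "dist x y < \<delta>" shows "x = y"
  using P assms unfolding gromov_def separated_def by force

lemma cut_point_in_P:
  assumes "closed_segment c d \<in> K" "c \<noteq> d" shows "cut_point \<delta> c d j \<in> P"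
  using assms prescribed unfolding prescribed_points_def edge_points_def by blast

lemma cut_point_0: "cut_point \<delta> c d 0 = c"
  by (simp add: cut_point_def cut_param_def)

lemma cut_point_1: "cut_point \<delta> c d (Suc 0) = shrink c d"
  by (simp add: cut_point_def cut_param_def shrink_def)

lemma corner_in_P:
  assumes "tri K v a b"
  shows "v \<in> P" "shrink v a \<in> P" "shrink v b \<in> P" "chosen_point \<delta> v {a, b} \<in> P"
proof -
  have "v \<noteq> a" "v \<noteq> b" using assms by (auto simp: tri_def)
  note e = tri_faces(4,5)[OF lfK assms]
  show "v \<in> P" "shrink v a \<in> P" "shrink v b \<in> P"
    using cut_point_in_P[OF e(1) \<open>v \<noteq> a\<close>, of 0] cut_point_in_P[OF e(1) \<open>v \<noteq> a\<close>, of "Suc 0"]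
      cut_point_in_P[OF e(2) \<open>v \<noteq> b\<close>, of "Suc 0"] by (simp_all add: cut_point_0 cut_point_1)
  show "chosen_point \<delta> v {a, b} \<in> P" using assms prescribed unfolding prescribed_points_def by blast
qed

text \<open>The covering property puts one of the four corner points within \<delta> of
  \<open>q\<close>, and separation of \<open>P\<close> makes it equal to \<open>q\<close>. An extra
  point is excluded because it lies outside the disc.\<close>

lemma sector_disc_points:
  assumes "tri K v a b" and z: "dist z a = dist z v" "dist z b = dist z v"
    and q: "q \<in> P" "q = v + l *\<^sub>R (shrink v a - v) + m *\<^sub>R (shrink v b - v)" "0 \<le> l" "0 \<le> m"
      "dist (shrink v z) q \<le> dist (shrink v z) v"
  shows "q \<in> {v, shrink v a, shrink v b}"
proof -
  define x where "x = chosen_point \<delta> v {a, b}"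
  have c: "corner_point \<delta> v a b x" unfolding x_def by (rule chosen_point_corner[OF \<delta> S K assms(1)])
  have z': "dist (shrink v z) (shrink v a) = dist (shrink v z) v" "dist (shrink v z) (shrink v b) = dist (shrink v z) v"
    using z by (simp_all add: dist_shrink)
  have "\<exists>w\<in>{v, shrink v a, shrink v b, x}. dist w q < \<delta>"
    using c z' q unfolding corner_point_def corner_covering_def by blast
  then have "q \<in> {v, shrink v a, shrink v b, x}"
    using P_dist[OF _ q(1)] corner_in_P[OF assms(1)] unfolding x_def by blast
  moreover have "x = v \<or> dist (shrink v z) v < dist (shrink v z) x"
    using c z' unfolding corner_point_def corner_extra_def by blast
  ultimately show ?thesis using q(5) by auto
qed

text \<open>Let \<open>q\<close> be in the sector of the triangle \<open>v c d\<close>. The power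
  for the disc of \<open>v a b\<close> minus the power for the disc of \<open>v c d\<close>, both
  shrunk, is zero at \<open>v\<close> and nonnegative at the first cuts towards \<open>c\<close> and
  \<open>d\<close>, hence nonnegative on the sector. So \<open>q\<close> would be inside the disc of
  \<open>v c d\<close>, where \<open>sector_disc_points\<close> leaves only points of the
  circle.\<close>

lemma corner_disc_empty:
  assumes "tri K v a b" and z: "dist z a = dist z v" "dist z b = dist z v" "\<And>p. p \<in> S \<Longrightarrow> dist z v \<le> dist z p"
    and q: "q \<in> P"
  shows "dist (shrink v z) v \<le> dist (shrink v z) q"
proof (rule ccontr)
  assume "\<not> ?thesis"
  then have qz: "disc_power (shrink v z) (dist (shrink v z) v) q < 0" by (simp add: disc_power_neg_iff)
  have "{v} \<in> K" using tri_faces(1)[OF lfK assms(1)] .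
  then obtain c d k m where t: "tri K v c d" "0 \<le> k" "0 \<le> m" "q = v + k *\<^sub>R (c - v) + m *\<^sub>R (d - v)"
    by (rule vertex_star_sector[OF lfK coverK])
  obtain y where y: "dist y c = dist y v" "dist y d = dist y v" using tri_circumcentre[OF \<delta> S K t(1)] by metis
  define z' y' r s where "z' = shrink v z" and "y' = shrink v y" and "r = dist z' v" and "s = dist y' v"
  have q': "q = v + (10 * k) *\<^sub>R (shrink v c - v) + (10 * m) *\<^sub>R (shrink v d - v)"
    unfolding t(4) by (simp add: shrink_def)
  define u e where "u = 2 *\<^sub>R (y' - z')" and "e = z' \<bullet> z' - y' \<bullet> y' - r\<^sup>2 + s\<^sup>2"
  have g: "u \<bullet> p + e = disc_power z' r p - disc_power y' s p" for p
    unfolding u_def e_def disc_power_diff by simp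
  \<comment> \<open>Shrinking about \<open>v\<close> divides all powers by 100, so the signs carry
    over from the old triangulation.\<close>
  have pos: "0 \<le> u \<bullet> shrink v p + e" if "p \<in> S" "dist y p = dist y v" for p
  proof -
    have "0 \<le> disc_power z (dist z v) p" using z(3)[OF that(1)] by (simp add: disc_power_def)
    moreover have "disc_power y (dist y v) p = 0" using that(2) by (simp add: disc_power_def)
    ultimately show ?thesis
      unfolding g r_def s_def z'_def y'_def disc_power_shrink by simp
  qed
  have "u \<bullet> v + e = 0" unfolding g by (simp add: disc_power_def r_def s_def)
  then have "0 \<le> u \<bullet> q + e"
    unfolding q' by (rule affine_on_sector) (use t pos y delaunay_tri_in[OF K t(1)] in auto)
  then have "disc_power y' s q < 0" using qz unfolding g z'_def r_def by simp
  then have lt: "dist y' q < dist y' v" by (simp add: disc_power_neg_iff s_def)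
  then have "q \<in> {v, shrink v c, shrink v d}"
    using sector_disc_points[OF t(1) y q q'] t(2,3) unfolding y'_def by simp
  moreover have "dist y' (shrink v c) = dist y' v" "dist y' (shrink v d) = dist y' v"
    using y by (simp_all add: y'_def dist_shrink)
  ultimately show False using lt by auto
qed

lemma shrink_inject: "shrink v a = shrink v b \<longleftrightarrow> a = b" "v = shrink v a \<longleftrightarrow> v = a"
  by (auto simp: shrink_def)

text \<open>The shrunk disc is empty and so determines a cell of \<open>P\<close>. The apex of this
  cell is its only old vertex \<open>v\<close>, and the chord between the two first cuts is one of
  its edges.\<close>

lemma corner_triangle_refined:
  assumes "tri K v a b"
  shows "tri refined v (shrink v a) (shrink v b)"
proof -
  obtain z where z: "dist z a = dist z v" "dist z b = dist z v" "dist z v < 10 * \<delta>" "\<And>p. p \<in> S \<Longrightarrow> dist z v \<le> dist z p"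
    using tri_circumcentre[OF \<delta> S K assms] by metis
  define a' b' z' r where "a' = shrink v a" and "b' = shrink v b" and "z' = shrink v z" and "r = dist z' v"
  have r: "r < \<delta>" using z(3) by (simp add: r_def z'_def dist_shrink)
  have ne: "v \<noteq> a'" "v \<noteq> b'" "a' \<noteq> b'"
    using assms unfolding tri_def a'_def b'_def shrink_inject by auto
  have on: "dist z' v = r" "dist z' a' = r" "dist z' b' = r"
    using z by (simp_all add: r_def z'_def a'_def b'_def dist_shrink)
  have ind: "\<not> affine_dependent {v, a', b'}"
    by (rule sphere_affine_independent[of _ z' r]) (use on ne in auto)
  obtain g h where gh: "\<And>p. p = v + (g \<bullet> (p - v)) *\<^sub>R (a' - v) + (h \<bullet> (p - v)) *\<^sub>R (b' - v)"
    "g \<bullet> (a' - v) = 1" "h \<bullet> (a' - v) = 0" "g \<bullet> (b' - v) = 0" "h \<bullet> (b' - v) = 1"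
    using dual_basis[OF ind ne] by blast
  have vS: "v \<in> S" by (rule delaunay_tri_in(1)[OF K assms])
  define Q where "Q = P \<inter> sphere z' r"
  have Q: "v \<in> Q" "a' \<in> Q" "b' \<in> Q"
    using on corner_in_P[OF assms] by (auto simp: Q_def a'_def b'_def)
  \<comment> \<open>Points of the cell are less than \<open>2 * \<delta>\<close> apart, distinct old
    vertices at least \<open>10 * \<delta>\<close>.\<close>
  have uniq: "x = v" if "x \<in> Q \<inter> S" for x
  proof (rule ccontr)
    assume "x \<noteq> v"
    then have "10 * \<delta> \<le> dist x v" using S vS that unfolding gromov_def separated_def by blast
    moreover have "dist x v \<le> 2 * r" using dist_triangle[of x v z'] that on(1) by (simp add: Q_def dist_commute)
    ultimately show False using r \<delta> by linarith
  qed
  have "Q \<inter> S \<subseteq> {v}"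
  proof
    fix x assume "x \<in> Q \<inter> S"
    then have "x = v" by (rule uniq)
    then show "x \<in> {v}" by simp
  qed
  moreover have "{v} \<subseteq> Q \<inter> S" using Q(1) vS by simp
  ultimately have "Q \<inter> S = {v}" by (rule equalityI)
  then have apex: "v = corner_apex S Q" by (simp add: corner_apex_def)
  have fan: "fan P (corner_apex S) {v, a', b'}"
  proof (rule fanI[of P r z' v])
    show "r \<le> dist z' p" if "p \<in> P" for p
      unfolding r_def z'_def by (rule corner_disc_empty[OF assms z(1,2,4) that])
    show "v = corner_apex S (P \<inter> sphere z' r)" using apex by (simp add: Q_def)
    show "v \<in> P \<inter> sphere z' r" "a' \<in> P \<inter> sphere z' r" "b' \<in> P \<inter> sphere z' r" using Q by (simp_all add: Q_def)
    \<comment> \<open>The sum of the two coordinates is 0 at \<open>v\<close> and 1 on the line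
      through \<open>a'\<close> and \<open>b'\<close>; its negative witnesses that the chord is an
      edge of the cell.\<close>
    have f: "(- g - h) \<bullet> p = (- g - h) \<bullet> v - (g \<bullet> (p - v) + h \<bullet> (p - v))" for p
      by (simp add: inner_diff_left inner_diff_right)
    have fa: "(- g - h) \<bullet> a' = (- g - h) \<bullet> v - 1" using f[of a'] gh(2,3) by simp
    have fb: "(- g - h) \<bullet> b' = (- g - h) \<bullet> v - 1" using f[of b'] gh(4,5) by simp
    show "(- g - h) \<bullet> a' = (- g - h) \<bullet> b'" unfolding fa fb by simp
    fix q assume q: "q \<in> P \<inter> sphere z' r" "q \<noteq> a'" "q \<noteq> b'"
    define l m where "l = g \<bullet> (q - v)" and "m = h \<bullet> (q - v)"
    have ql: "q = v + l *\<^sub>R (a' - v) + m *\<^sub>R (b' - v)" unfolding l_def m_def by (rule gh(1))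
    \<comment> \<open>A cell point on or beyond the chord would lie in the sector, where only the
      three corners are left.\<close>
    have "l + m < 1"
    proof (rule ccontr)
      assume "\<not> l + m < 1"
      then have lm: "1 \<le> l + m" by simp
      have circ: "(p - v) \<bullet> (p - v) = 2 * ((p - v) \<bullet> (z' - v))" if "dist z' p = r" for p
      proof -
        have "(dist z' p)\<^sup>2 = (dist z' v)\<^sup>2" using that on(1) by simp
        then show ?thesis
          unfolding dist_norm power2_norm_eq_inner by (simp add: inner_diff inner_commute algebra_simps)
      qed
      have qv: "l *\<^sub>R (a' - v) + m *\<^sub>R (b' - v) = q - v" using ql by simp
      have "0 \<le> l" "0 \<le> m"
        using circle_beyond_chord[of "a' - v" "z' - v" "b' - v" l m] circ[OF on(2)] circ[OF on(3)] circ[of q] q(1) ne(3) lm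
        unfolding qv by auto
      then have "q \<in> {v, a', b'}"
        using sector_disc_points[OF assms z(1,2) _ ql[unfolded a'_def b'_def]] q(1) on(1)
        by (simp add: a'_def b'_def z'_def)
      then have "q = v" using q by simp
      then have "l = 0" "m = 0" by (simp_all add: l_def m_def)
      then show False using lm by simp
    qed
    then show "(- g - h) \<bullet> a' < (- g - h) \<bullet> q" unfolding fa f[of q] l_def m_def by simp
  qed (use ne in auto)
  have "convex hull {v, a', b'} \<in> refined"
    unfolding refined_def by (rule fan_in_complex[OF P \<delta> _ fan]) (rule corner_apex_in)
  then show ?thesis using ind ne unfolding tri_def a'_def b'_def by blast
qed

lemma cut_points_neq:
  assumes "closed_segment c d \<in> K" "c \<noteq> d" "j \<le> cut_count \<delta> (dist c d) + 1"
  shows "cut_point \<delta> c d j \<noteq> cut_point \<delta> c d (Suc j)"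
proof -
  note L = edge_length[OF \<delta> S K assms(1,2)]
  have "\<delta> \<le> (cut_param \<delta> (dist c d) (Suc j) - cut_param \<delta> (dist c d) j) * dist c d"
    by (rule cut_param_step_length[OF \<delta> L assms(3)])
  then show ?thesis using \<delta> assms(2) by (auto simp: cut_point_def)
qed

lemma cut_points_dist:
  assumes "closed_segment c d \<in> K" "c \<noteq> d"
  shows "j = 0 \<or> j = cut_count \<delta> (dist c d) + 1 \<Longrightarrow> dist (cut_point \<delta> c d j) (cut_point \<delta> c d (Suc j)) = dist c d / 10"
    "0 < j \<Longrightarrow> j \<le> cut_count \<delta> (dist c d) \<Longrightarrow> dist (cut_point \<delta> c d j) (cut_point \<delta> c d (Suc j)) \<le> 126/100 * \<delta>"
proof -
  note L = edge_length[OF \<delta> S K assms]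
  have d: "dist (cut_point \<delta> c d j) (cut_point \<delta> c d (Suc j))
      = \<bar>cut_param \<delta> (dist c d) (Suc j) - cut_param \<delta> (dist c d) j\<bar> * dist c d"
    unfolding cut_point_def dist_on_ray by (simp add: abs_minus_commute)
  show "dist (cut_point \<delta> c d j) (cut_point \<delta> c d (Suc j)) = dist c d / 10"
    if "j = 0 \<or> j = cut_count \<delta> (dist c d) + 1"
    unfolding d cut_param_step(1)[OF \<delta> L that] by simp
  show "dist (cut_point \<delta> c d j) (cut_point \<delta> c d (Suc j)) \<le> 126/100 * \<delta>"
    if "0 < j" "j \<le> cut_count \<delta> (dist c d)"
    unfolding d cut_param_step(2)[OF \<delta> L that] using cut_middle_length(2)[OF \<delta> L] by simp
qed

lemma short_segment_refined:
  assumes "p \<in> P" "q \<in> P" "p \<noteq> q" "dist p q \<le> 126/100 * \<delta>"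
  shows "closed_segment p q \<in> refined"
proof (rule short_edge_forced[OF refined_delaunay refined_cover assms(1-3), of \<delta>])
  show "\<delta> \<le> dist x p \<and> \<delta> \<le> dist x q" if "x \<in> P" "x \<noteq> p" "x \<noteq> q" for x
    using P that assms(1,2) unfolding gromov_def separated_def by blast
  have "(dist p q)\<^sup>2 \<le> (126/100 * \<delta>)\<^sup>2" using assms(4) by (intro power_mono) auto
  also have "\<dots> < 2 * \<delta>\<^sup>2" using \<delta> by (simp add: power_mult_distrib power_divide)
  finally show "(dist p q)\<^sup>2 < 2 * \<delta>\<^sup>2" .
qed (use \<delta> in simp)

lemma corner_segment_refined:
  assumes "closed_segment c d \<in> K" "c \<noteq> d"
  shows "closed_segment c (shrink c d) \<in> refined"
proof -
  obtain e where "tri K c d e" by (rule edge_in_tri[OF lfK coverK assms])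
  then have "tri refined c (shrink c d) (shrink c e)" by (rule corner_triangle_refined)
  then show ?thesis by (rule tri_faces(4)[OF refined_lf])
qed

text \<open>Middle pieces are short enough for the diametral disc. End pieces, of length
  \<open>dist c d / 10\<close>, may exceed \<open>sqrt 2 * \<delta>\<close>; they are sides of
  corner triangles.\<close>

lemma cut_segment_refined:
  assumes cd: "closed_segment c d \<in> K" "c \<noteq> d" and j: "j \<le> cut_count \<delta> (dist c d) + 1"
  shows "cut_segment \<delta> c d j \<in> refined"
proof -
  note L = edge_length[OF \<delta> S K cd]
  consider "j = 0" | "0 < j" "j \<le> cut_count \<delta> (dist c d)" | "j = cut_count \<delta> (dist c d) + 1" using j by linarith
  then show ?thesis
  proof cases
    case 1
    then show ?thesis using corner_segment_refined[OF cd] by (simp add: cut_point_0 cut_point_1)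
  next
    case 2
    then show ?thesis
      using cut_points_dist(2)[OF cd 2] cut_points_neq[OF cd j] cut_point_in_P[OF cd] by (intro short_segment_refined)
  next
    case 3
    have e: "cut_param \<delta> (dist c d) (Suc j) = 1" using cut_param_end[OF \<delta> L, of "Suc j"] 3 by simp
    then have p: "cut_param \<delta> (dist c d) j = 9/10" using cut_param_step(1)[OF \<delta> L, of j] 3 by simp
    have "cut_point \<delta> c d j = shrink d c"
      unfolding cut_point_def shrink_def p by (simp add: vec_eq_iff field_simps)
    moreover have "cut_point \<delta> c d (Suc j) = d" unfolding cut_point_def e by simp
    moreover have "closed_segment d c \<in> K" using cd(1) by (simp add: closed_segment_commute)
    then have "closed_segment d (shrink d c) \<in> refined" using corner_segment_refined cd(2) by metis
    ultimately show ?thesis by (simp add: closed_segment_commute)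
  qed
qed

lemma edge_covered_by_cuts:
  assumes cd: "closed_segment c d \<in> K" "c \<noteq> d" and x: "x \<in> closed_segment c d"
  obtains j where "j \<le> cut_count \<delta> (dist c d) + 1"
    "x \<in> cut_segment \<delta> c d j"
proof -
  note L = edge_length[OF \<delta> S K cd]
  obtain t where t: "0 \<le> t" "t \<le> 1" "x = (1 - t) *\<^sub>R c + t *\<^sub>R d" using x unfolding in_segment by blast
  obtain j where j: "j \<le> cut_count \<delta> (dist c d) + 1" "cut_param \<delta> (dist c d) j \<le> t" "t \<le> cut_param \<delta> (dist c d) (Suc j)"
    using cut_param_interval[OF \<delta> L t(1,2)] by metis
  have "x = c + t *\<^sub>R (d - c)" unfolding t(3) by (simp add: algebra_simps)
  then have "x \<in> cut_segment \<delta> c d j"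
    unfolding cut_point_def using ray_segment_iff[OF cd(2), of "cut_param \<delta> (dist c d) j" "cut_param \<delta> (dist c d) (Suc j)" t] j
    by simp
  then show ?thesis using that j(1) by blast
qed

text \<open>Edges of \<open>K\<close> are unions of edges of the refined complex, so the connected
  interior of \<open>\<sigma>\<close> misses them and cannot leave a triangle of
  \<open>K\<close>.\<close>

lemma refined_triangle_in_triangle:
  assumes \<sigma>: "\<sigma> \<in> triangles refined"
  obtains \<Delta> where "\<Delta> \<in> triangles K" "\<sigma> \<subseteq> \<Delta>"
proof -
  have \<sigma>': "\<sigma> \<in> refined" "2 simplex \<sigma>" using \<sigma> by (auto simp: triangles_def)
  have miss: "x \<notin> interior \<sigma>" if cd: "closed_segment c d \<in> K" "c \<noteq> d" and x: "x \<in> closed_segment c d" for c d x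
  proof
    assume xi: "x \<in> interior \<sigma>"
    obtain j where j: "j \<le> cut_count \<delta> (dist c d) + 1"
      "x \<in> cut_segment \<delta> c d j"
      by (rule edge_covered_by_cuts[OF cd x])
    let ?s = "cut_segment \<delta> c d j"
    have "\<sigma> face_of ?s"
      using lf_rel_interior_face[OF refined_lf \<sigma>'(1) cut_segment_refined[OF cd j(1)] _ j(2)] xi
        interior_subset_rel_interior by blast
    then have "\<sigma> \<subseteq> ?s" by (rule face_of_imp_subset)
    then have "x \<in> interior ?s" using xi interior_mono by blast
    then show False by (simp add: interior_closed_segment_ge2)
  qed
  obtain x where x: "x \<in> interior \<sigma>" using triangle_interior_nonempty[OF \<sigma>] by blast
  obtain \<Delta> where \<Delta>: "\<Delta> \<in> triangles K" "x \<in> \<Delta>" using triangles_cover[OF lfK coverK] by metis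
  obtain a b c where abc: "tri K a b c" "\<Delta> = convex hull {a, b, c}" using \<Delta>(1) by (auto simp: triangles_iff_tri)
  have "a \<noteq> b" "b \<noteq> c" "c \<noteq> a" using abc(1) by (auto simp: tri_def)
  note e = tri_faces(4-6)[OF lfK abc(1)]
  have "frontier \<Delta> = closed_segment a b \<union> closed_segment b c \<union> closed_segment c a"
    unfolding abc(2) by (rule frontier_of_triangle) simp
  then have "interior \<sigma> \<inter> frontier \<Delta> = {}"
    using miss[OF e(1) \<open>a \<noteq> b\<close>] miss[OF e(3) \<open>b \<noteq> c\<close>] miss[of c a] e(2) \<open>c \<noteq> a\<close>
    by (auto simp: closed_segment_commute)
  moreover have "connected (interior \<sigma>)"
    using convex_simplex[OF \<sigma>'(2)] by (simp add: convex_connected convex_interior)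
  ultimately have "interior \<sigma> - \<Delta> = {}"
    using connected_Int_frontier[of "interior \<sigma>" \<Delta>] x \<Delta>(2) by blast
  then have "closure (interior \<sigma>) \<subseteq> \<Delta>"
    using closed_simplex \<Delta>(1) by (intro closure_minimal) (auto simp: triangles_def)
  moreover have "closure (interior \<sigma>) = \<sigma>"
    using convex_closure_interior[OF convex_simplex[OF \<sigma>'(2)] triangle_interior_nonempty[OF \<sigma>]]
      closed_simplex[OF \<sigma>'(2)] by simp
  ultimately show ?thesis using that \<Delta>(1) by blast
qed

lemma triangle_is_union:
  assumes "\<Delta> \<in> triangles K"
  shows "finite {\<sigma> \<in> triangles refined. \<sigma> \<subseteq> \<Delta>}" "\<Delta> = \<Union>{\<sigma> \<in> triangles refined. \<sigma> \<subseteq> \<Delta>}"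
proof -
  let ?F = "{\<sigma> \<in> triangles refined. \<sigma> \<subseteq> \<Delta>}"
  have s: "2 simplex \<Delta>" using assms by (simp add: triangles_def)
  have "?F \<subseteq> {\<sigma> \<in> refined. \<sigma> \<inter> \<Delta> \<noteq> {}}"
    using triangle_interior_nonempty interior_subset by (fastforce simp: triangles_def)
  moreover have "finite {\<sigma> \<in> refined. \<sigma> \<inter> \<Delta> \<noteq> {}}"
    by (rule lf_finite_compact[OF refined_lf refined_cover compact_simplex[OF s]])
  ultimately show "finite ?F" by (rule finite_subset)
  have "interior \<Delta> \<subseteq> \<Union>?F"
  proof
    fix x assume x: "x \<in> interior \<Delta>"
    obtain \<sigma> where \<sigma>: "\<sigma> \<in> triangles refined" "x \<in> \<sigma>" using triangles_cover[OF refined_lf refined_cover] by metis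
    obtain \<Delta>2 where \<Delta>2: "\<Delta>2 \<in> triangles K" "\<sigma> \<subseteq> \<Delta>2" by (rule refined_triangle_in_triangle[OF \<sigma>(1)])
    then have "\<Delta> = \<Delta>2" using triangle_eq_if_interior_meets[OF lfK assms \<Delta>2(1) x] \<sigma>(2) by blast
    then show "x \<in> \<Union>?F" using \<sigma> \<Delta>2 by blast
  qed
  moreover have "closed (\<Union>?F)"
    by (rule lf_closed_Union[OF refined_lf refined_cover]) (auto simp: triangles_def)
  ultimately have "closure (interior \<Delta>) \<subseteq> \<Union>?F" by (rule closure_minimal)
  moreover have "closure (interior \<Delta>) = \<Delta>"
    using convex_closure_interior[OF convex_simplex[OF s] triangle_interior_nonempty[OF assms]] closed_simplex[OF s] by simp
  ultimately show "\<Delta> = \<Union>?F" by blast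
qed

lemma edge_is_union:
  assumes cd: "closed_segment c d \<in> K" "c \<noteq> d"
  shows "closed_segment c d = (\<Union>j\<le>cut_count \<delta> (dist c d) + 1. cut_segment \<delta> c d j)"
proof
  show "closed_segment c d \<subseteq> (\<Union>j\<le>cut_count \<delta> (dist c d) + 1. cut_segment \<delta> c d j)"
  proof
    fix x assume "x \<in> closed_segment c d"
    then obtain j where "j \<le> cut_count \<delta> (dist c d) + 1"
      "x \<in> cut_segment \<delta> c d j" by (rule edge_covered_by_cuts[OF cd])
    then show "x \<in> (\<Union>j\<le>cut_count \<delta> (dist c d) + 1. cut_segment \<delta> c d j)"
      by blast
  qed
  have "cut_point \<delta> c d j \<in> closed_segment c d" for j
    by (rule cut_point_in_segment[OF \<delta> edge_length[OF \<delta> S K cd]])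
  then show "(\<Union>j\<le>cut_count \<delta> (dist c d) + 1. cut_segment \<delta> c d j) \<subseteq> closed_segment c d"
    by (simp add: UN_subset_iff subset_closed_segment)
qed

text \<open>The midpoint of \<open>a b\<close> lies in some cut piece. Both segments are simplices
  of one complex, so \<open>a b\<close> is a face of that piece and hence the whole piece.\<close>

lemma refined_subedge:
  assumes ab: "closed_segment a b \<in> refined" "a \<noteq> b" and cd: "closed_segment c d \<in> K" "c \<noteq> d"
    and sub: "closed_segment a b \<subseteq> closed_segment c d"
  obtains j where "j \<le> cut_count \<delta> (dist c d) + 1" "{a, b} = {cut_point \<delta> c d j, cut_point \<delta> c d (Suc j)}"
proof -
  have "midpoint a b \<in> rel_interior (closed_segment a b)"
    using ab(2) by (simp add: rel_interior_closed_segment)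
  moreover have "midpoint a b \<in> closed_segment c d" using sub by auto
  then obtain j where j: "j \<le> cut_count \<delta> (dist c d) + 1"
    "midpoint a b \<in> cut_segment \<delta> c d j"
    by (rule edge_covered_by_cuts[OF cd])
  define p q where "p = cut_point \<delta> c d j" and "q = cut_point \<delta> c d (Suc j)"
  have ind: "\<not> affine_dependent {p, q}" "\<not> affine_dependent {a, b}" by (simp_all add: affine_independent_2)
  have "p \<noteq> q" unfolding p_def q_def by (rule cut_points_neq[OF cd j(1)])
  have "closed_segment a b face_of closed_segment p q"
    using lf_rel_interior_face[OF refined_lf ab(1) cut_segment_refined[OF cd j(1)] _ j(2)] calculation
    unfolding p_def q_def by blast
  then obtain F where F: "F \<subseteq> {p, q}" "convex hull {a, b} = convex hull F"
    using face_of_convex_hull_affine_independent[OF ind(1)] by (auto simp: segment_convex_hull)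
  have "{a, b} = F"
    by (rule convex_hull_affine_independent_inject[OF ind(2) affine_independent_subset[OF ind(1) F(1)] F(2)])
  then have "{a, b} = {p, q}" using F(1) ab(2) by auto
  then show ?thesis using that j(1) unfolding p_def q_def by blast
qed

text \<open>It suffices that \<open>\<sigma>\<close> and the corner of \<open>\<Delta>\<close> at
  \<open>v\<close> overlap, since overlapping triangles of one complex coincide.\<close>

lemma corner_triangle_unique:
  assumes "\<sigma> \<in> triangles refined" "v extreme_point_of \<sigma>" "{v} \<in> K" "\<Delta> \<in> triangles K" "\<sigma> \<subseteq> \<Delta>"
  obtains a b where "tri K v a b" "\<Delta> = convex hull {v, a, b}" "\<sigma> = convex hull {v, shrink v a, shrink v b}"
proof -
  have v: "v \<in> \<sigma>" using assms(2) by (simp add: extreme_point_of_def)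
  obtain x y z where xyz: "tri K x y z" "\<Delta> = convex hull {x, y, z}" using assms(4) by (auto simp: triangles_iff_tri)
  have "v \<in> {x, y, z}" by (rule vertex_in_tri[OF lfK xyz(1) assms(3)]) (use v assms(5) xyz(2) in blast)
  then obtain a b where ab: "tri K v a b" "\<Delta> = convex hull {v, a, b}"
    using xyz tri_perm[OF xyz(1)] by (auto simp: insert_commute)
  have C: "tri refined v (shrink v a) (shrink v b)" by (rule corner_triangle_refined[OF ab(1)])
  obtain w where w: "w \<in> interior \<sigma>" using triangle_interior_nonempty[OF assms(1)] by blast
  then have "w \<in> interior (convex hull {v, a, b})" using interior_mono[OF assms(5)] ab(2) by blast
  moreover have "\<not> collinear {v, a, b}" "\<not> collinear {v, shrink v a, shrink v b}"
    using ab(1) C unfolding tri_def collinear_3_eq_affine_dependent by auto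
  note int = interior_convex_hull_3_minimal[OF this(1)] interior_convex_hull_3_minimal[OF this(2)]
  ultimately obtain k l m where klm: "0 < k" "0 < l" "0 < m" "k + l + m = 1" "w = k *\<^sub>R v + l *\<^sub>R a + m *\<^sub>R b"
    unfolding int(1)[simplified] by blast
  \<comment> \<open>Contracting an interior point of \<open>\<sigma>\<close> towards
    \<open>v\<close> stays in \<open>\<sigma>\<close> by convexity, and the factor 1/10 carries the
    interior of \<open>\<Delta>\<close> into the interior of the corner.\<close>
  define p where "p = v + (1/10) *\<^sub>R (w - v)"
  have k: "k = 1 - l - m" using klm(4) by simp
  have "k *\<^sub>R v + l *\<^sub>R shrink v a + m *\<^sub>R shrink v b = p"
    unfolding p_def klm(5) k shrink_def by (simp add: algebra_simps)
  then have "p \<in> interior (convex hull {v, shrink v a, shrink v b})"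
    unfolding int(2)[simplified] using klm(1-4) by blast
  moreover have "p \<in> \<sigma>"
  proof -
    have "p = (9/10) *\<^sub>R v + (1/10) *\<^sub>R w"
      unfolding p_def by (simp add: vec_eq_iff field_simps)
    moreover have "w \<in> \<sigma>" using w interior_subset by blast
    moreover have "convex \<sigma>" using assms(1) convex_simplex by (auto simp: triangles_def)
    ultimately show ?thesis using v convexD[of \<sigma> v w "9/10" "1/10"] by simp
  qed
  moreover have "convex hull {v, shrink v a, shrink v b} \<in> triangles refined"
    using C triangles_iff_tri by blast
  ultimately have "convex hull {v, shrink v a, shrink v b} = \<sigma>"
    using triangle_eq_if_interior_meets[OF refined_lf _ assms(1)] by blast
  then show ?thesis using that ab by blast
qed

end

section \<open>Passage to the subcomplex and conclusion\<close>

lemma similar_shrunk_hull: "similar (convex hull {v, shrink v a, shrink v b}) (convex hull {v, a, b})"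
proof -
  \<comment> \<open>The homothety with centre \<open>v\<close> and factor 10, inverse to
    \<open>shrink v\<close>.\<close>
  define f where "f x = (v - 10 *\<^sub>R v) + 10 *\<^sub>R x" for x :: "real^2"
  have "f ` {v, shrink v a, shrink v b} = {v, a, b}"
    by (simp add: f_def shrink_def algebra_simps)
  then have "f ` (convex hull {v, shrink v a, shrink v b}) = convex hull {v, a, b}"
    using convex_hull_affinity[of "v - 10 *\<^sub>R v" 10 "{v, shrink v a, shrink v b}"] unfolding f_def by simp
  moreover have "dist (f x) (f y) = 10 * dist x y" for x y
  proof -
    have "f x - f y = 10 *\<^sub>R (x - y)" by (simp add: f_def algebra_simps)
    then show ?thesis by (simp add: dist_norm)
  qed
  ultimately show ?thesis unfolding similar_def by (intro exI[of _ 10]) auto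
qed

lemma lf_subcomplex:
  assumes "lf_simplicial_complex K" "\<Union>K = UNIV" "T \<subseteq> K" "\<And>\<sigma> \<tau>. \<sigma> \<in> T \<Longrightarrow> \<tau> face_of \<sigma> \<Longrightarrow> \<tau> \<in> T"
  shows "lf_simplicial_complex T"
proof -
  have "locally_finite_in euclidean K" using assms(1,2) unfolding lf_simplicial_complex_def by simp
  then have "locally_finite_in euclidean T" using assms(3) by (rule locally_finite_in_subset)
  then have "locally_finite_in (top_of_set (\<Union>T)) T" by (rule locally_finite_in_subtopology) simp
  then show ?thesis
    using assms(1,3,4) unfolding lf_simplicial_complex_def by (metis subsetD)
qed

lemma simplex_plane_cases:
  fixes \<sigma> :: "(real^2) set"
  assumes "\<sigma> \<in> K" "n simplex \<sigma>"
  obtains "\<sigma> = {}" | v where "\<sigma> = {v}" | "\<sigma> \<in> edges K" | "\<sigma> \<in> triangles K"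
proof -
  have "-1 \<le> n" by (rule simplex_dim_ge[OF assms(2)])
  moreover have "n \<le> 2" using aff_dim_le_DIM[of \<sigma>] aff_dim_simplex[OF assms(2)] by simp
  ultimately consider "n = -1" | "n = 0" | "n = 1" | "n = 2" by linarith
  then show ?thesis
    using that assms by cases (auto simp: simplex_zero edges_def triangles_def)
qed

theorem theorem7:
  fixes \<eta> :: real and T :: "(real^2) set set"
  assumes "\<eta> > 0" and "cdg \<eta> T"
  shows "\<exists>T' S'.
    subdivision T' T \<and> cdg_in (\<eta> / 10) S' T' \<and>
    (\<forall>a b c d.
       closed_segment a b \<in> edges T' \<and> closed_segment c d \<in> edges T \<and>
       closed_segment a b \<subseteq> closed_segment c d \<longrightarrow>
         (c \<notin> closed_segment a b \<and> d \<notin> closed_segment a b \<longrightarrow>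
            stable_segment (1 / 100 * (\<eta> / 10)) S' a b) \<and>
         (c \<in> closed_segment a b \<or> d \<in> closed_segment a b \<longrightarrow>
            dist a b = dist c d / 10)) \<and>
    (\<forall>\<Delta>'\<in>triangles T'. (\<exists>v\<in>vertices T. v extreme_point_of \<Delta>') \<longrightarrow>
       (\<exists>!\<Delta>. \<Delta> \<in> triangles T \<and> \<Delta>' \<subseteq> \<Delta>) \<and>
       (\<forall>\<Delta>\<in>triangles T. \<Delta>' \<subseteq> \<Delta> \<longrightarrow> similar \<Delta>' \<Delta>))"
proof -
  define \<delta> where "\<delta> = \<eta> / 10"
  have \<delta>: "0 < \<delta>" using assms(1) by (simp add: \<delta>_def)
  obtain S K where S: "gromov (10 * \<delta>) S" and K: "delaunay_triangulation S K" and T: "lf_simplicial_complex T" "T \<subseteq> K"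
    using assms(2) unfolding cdg_def cdg_in_def subcomplex_def by (auto simp: \<delta>_def)
  obtain P where P: "gromov \<delta> P" and prescribed: "prescribed_points \<delta> K \<subseteq> P"
    by (rule gromov_extension[OF prescribed_points_separated[OF \<delta> S K]])
  note A = \<delta> S K P prescribed
  define R where "R = refined S P"
  have R: "delaunay_triangulation P R" "\<Union>R = UNIV"
    unfolding R_def by (rule refined_delaunay[OF A], rule refined_cover[OF A])
  note lfR = delaunay_triangulationD(1)[OF R(1)] and lfK = K_lf[OF \<delta> S K]
  \<comment> \<open>The refined simplices lying inside simplices of \<open>T\<close>; this set
    inherits closure under faces from \<open>R\<close>.\<close>
  define T' where "T' = {\<sigma> \<in> R. \<exists>s\<in>T. \<sigma> \<subseteq> s}"
  have T': "T' \<subseteq> R" by (auto simp: T'_def)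
  have lfT': "lf_simplicial_complex T'"
  proof (rule lf_subcomplex[OF lfR R(2) T'])
    fix \<sigma> \<tau> assume "\<sigma> \<in> T'" "\<tau> face_of \<sigma>"
    then show "\<tau> \<in> T'" using lf_face[OF lfR] face_of_imp_subset unfolding T'_def by blast
  qed
  have triT: "triangles T \<subseteq> triangles K" "triangles T' \<subseteq> triangles R"
    using T(2) T' by (auto simp: triangles_def)
  have edgeT: "closed_segment c d \<in> K \<and> c \<noteq> d" if "closed_segment c d \<in> edges T" for c d
    using that T(2) aff_dim_simplex[of 1 "closed_segment c d"] by (auto simp: edges_def)
  have "subdivision T' T"
    unfolding subdivision_def
  proof (intro conjI ballI lfT')
    show "\<exists>S\<in>T. S' \<subseteq> S" if "S' \<in> T'" for S' using that by (auto simp: T'_def)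
    fix s assume s: "s \<in> T"
    obtain n where n: "n simplex s" using lf_simplex(1)[OF T(1) s] by blast
    have union: "\<exists>F. finite F \<and> F \<subseteq> T' \<and> s = \<Union>F" if F: "finite F" "F \<subseteq> R" "s = \<Union>F" for F
    proof -
      have "F \<subseteq> T'"
      proof
        fix \<sigma> assume "\<sigma> \<in> F"
        then have "\<sigma> \<in> R" "\<sigma> \<subseteq> s" using F(2,3) by auto
        then show "\<sigma> \<in> T'" using s unfolding T'_def by blast
      qed
      then show ?thesis using F by blast
    qed
    show "\<exists>F. finite F \<and> F \<subseteq> T' \<and> s = \<Union>F"
      using s n
    proof (cases rule: simplex_plane_cases)
      case 1 then show ?thesis by (intro exI[of _ "{}"]) auto
    next
      case (2 v)
      have "v \<in> S" using delaunay_triangulationD(2)[OF K] s T(2) 2 by (auto simp: vertices_def)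
      \<comment> \<open>Even a vertex of \<open>T\<close> lying in no triangle of \<open>T\<close>
        is a corner of a triangle of \<open>K\<close>, and thus a point of \<open>P\<close>.\<close>
      obtain \<Delta> where "\<Delta> \<in> triangles K" "{v} face_of \<Delta>"
        using face_of_triangle_exists[OF lfK K_cover[OF \<delta> S K], of "{v}"] s T(2) 2 by auto
      then obtain x y z where xyz: "tri K x y z" "v \<in> convex hull {x, y, z}"
        using face_of_imp_subset by (fastforce simp: triangles_iff_tri)
      then have "v \<in> {x, y, z}" using vertex_in_tri[OF lfK xyz(1), of v] s T(2) 2 by auto
      then have "v \<in> P"
        using corner_in_P(1)[OF A xyz(1)] corner_in_P(1)[OF A tri_perm(1)[OF xyz(1)]]
          corner_in_P(1)[OF A tri_perm(3)[OF xyz(1)]] by auto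
      then have "{v} \<in> R" using delaunay_triangulationD(2)[OF R(1)] by (auto simp: vertices_def)
      then show ?thesis using union[of "{{v}}"] 2 by auto
    next
      case 3
      then obtain c d where cd: "c \<noteq> d" "s = closed_segment c d" by (auto simp: edges_iff_segment)
      then have cdK: "closed_segment c d \<in> K" using s T(2) by auto
      let ?F = "(\<lambda>j. cut_segment \<delta> c d j) ` {..cut_count \<delta> (dist c d) + 1}"
      have "?F \<subseteq> R" using cut_segment_refined[OF A cdK cd(1)] by (auto simp: R_def)
      moreover have "s = \<Union>?F" using edge_is_union[OF A cdK cd(1)] cd(2) by simp
      ultimately show ?thesis by (intro union[of ?F]) auto
    next
      case 4
      then have "s \<in> triangles K" using triT by blast
      note u = triangle_is_union[OF A this, folded R_def]
      show ?thesis by (rule union[OF u(1) _ u(2)]) (auto simp: triangles_def)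
    qed
  qed
  moreover have "cdg_in (\<eta> / 10) P T'"
    unfolding cdg_in_def subcomplex_def using P R(1) lfT' T' by (auto simp: \<delta>_def)
  moreover have "(c \<notin> closed_segment a b \<and> d \<notin> closed_segment a b \<longrightarrow> stable_segment (1 / 100 * \<delta>) P a b) \<and>
      (c \<in> closed_segment a b \<or> d \<in> closed_segment a b \<longrightarrow> dist a b = dist c d / 10)"
    if ab: "closed_segment a b \<in> edges T'" and cd: "closed_segment c d \<in> edges T"
      and sub: "closed_segment a b \<subseteq> closed_segment c d" for a b c d
  proof -
    have "a \<noteq> b" using ab aff_dim_simplex[of 1 "closed_segment a b"] by (auto simp: edges_def)
    have abR: "closed_segment a b \<in> refined S P" using ab T' by (auto simp: edges_def R_def)
    have cdK: "closed_segment c d \<in> K" "c \<noteq> d" using edgeT[OF cd] by auto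
    let ?n = "cut_count \<delta> (dist c d)"
    obtain j where j: "j \<le> ?n + 1" "{a, b} = {cut_point \<delta> c d j, cut_point \<delta> c d (Suc j)}"
      by (rule refined_subedge[OF A abR \<open>a \<noteq> b\<close> cdK sub])
    note L = edge_length[OF \<delta> S K cdK]
    have seg: "closed_segment a b = cut_segment \<delta> c d j"
      using j(2) by (simp add: segment_convex_hull)
    have dist: "dist a b = dist (cut_point \<delta> c d j) (cut_point \<delta> c d (Suc j))"
      using j(2) by (auto simp: doubleton_eq_iff dist_commute)
    have mem: "c + u *\<^sub>R (d - c) \<in> closed_segment a b \<longleftrightarrow>
        cut_param \<delta> (dist c d) j \<le> u \<and> u \<le> cut_param \<delta> (dist c d) (Suc j)" for u
      unfolding seg cut_point_def by (rule ray_segment_iff[OF cdK(2) cut_param_mono[OF \<delta> L]]) simp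
    show ?thesis
    \<comment> \<open>Exactly the end pieces, with indices 0 and \<open>?n + 1\<close>, contain
      \<open>c\<close> or \<open>d\<close>, so each index makes one of the two implications
      vacuous.\<close>
    proof (cases "j = 0 \<or> j = ?n + 1")
      case True
      have "c \<in> closed_segment a b \<or> d \<in> closed_segment a b"
        using True mem[of 0] mem[of 1] cut_param_bounds[OF \<delta> L] cut_param_end[OF \<delta> L, of "Suc j"]
        by (auto simp: cut_param_def)
      moreover have "dist a b = dist c d / 10" unfolding dist by (rule cut_points_dist(1)[OF A cdK True])
      ultimately show ?thesis by blast
    next
      case False
      then have j': "0 < j" "j \<le> ?n" using j(1) by auto
      have "cut_param \<delta> (dist c d) (Suc 0) \<le> cut_param \<delta> (dist c d) j"
        using j' by (intro cut_param_mono[OF \<delta> L]) simp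
      then have "c \<notin> closed_segment a b" using mem[of 0] by (auto simp: cut_param_def)
      moreover have "cut_param \<delta> (dist c d) (Suc j) \<le> cut_param \<delta> (dist c d) (?n + 1)"
        using j' by (intro cut_param_mono[OF \<delta> L]) simp
      then have "d \<notin> closed_segment a b"
        using mem[of 1] cut_param_step(1)[OF \<delta> L, of "?n + 1"] cut_param_end[OF \<delta> L, of "Suc (?n + 1)"] by auto
      moreover have "a \<in> P" "b \<in> P"
        using j(2) cut_point_in_P[OF A cdK] by (auto simp: doubleton_eq_iff)
      then have "stable_segment (1 / 100 * \<delta>) P a b"
        using short_edge_stable[OF P \<delta> _ _ \<open>a \<noteq> b\<close>] cut_points_dist(2)[OF A cdK j'] dist by simp
      ultimately show ?thesis by blast
    qed
  qed
  moreover have "(\<exists>!\<Delta>. \<Delta> \<in> triangles T \<and> \<Delta>' \<subseteq> \<Delta>) \<and> (\<forall>\<Delta>\<in>triangles T. \<Delta>' \<subseteq> \<Delta> \<longrightarrow> similar \<Delta>' \<Delta>)"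
    if \<Delta>': "\<Delta>' \<in> triangles T'" and v: "v \<in> vertices T" "v extreme_point_of \<Delta>'" for \<Delta>' v
  proof -
    have \<Delta>'R: "\<Delta>' \<in> triangles R" using \<Delta>' triT by auto
    obtain s where s: "s \<in> T" "\<Delta>' \<subseteq> s" using \<Delta>' by (auto simp: triangles_def T'_def)
    obtain n where n: "n simplex s" using lf_simplex(1)[OF T(1) s(1)] by blast
    have "2 simplex \<Delta>'" using \<Delta>' by (simp add: triangles_def)
    \<comment> \<open>A simplex of \<open>T\<close> containing a triangle is itself a triangle, and
      two such simplices overlap, hence coincide.\<close>
    then have "2 \<le> n" using aff_dim_subset[OF s(2)] aff_dim_simplex[OF n] aff_dim_simplex[of 2 \<Delta>'] by simp
    moreover have "n \<le> 2" using aff_dim_le_DIM[of s] aff_dim_simplex[OF n] by simp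
    ultimately have "s \<in> triangles T" using s(1) n by (simp add: triangles_def)
    moreover have "\<Delta>1 = \<Delta>2"
      if "\<Delta>1 \<in> triangles T" "\<Delta>' \<subseteq> \<Delta>1" "\<Delta>2 \<in> triangles T" "\<Delta>' \<subseteq> \<Delta>2" for \<Delta>1 \<Delta>2
    proof -
      obtain x where x: "x \<in> interior \<Delta>'" using triangle_interior_nonempty[OF \<Delta>'] by blast
      then have "x \<in> interior \<Delta>1" "x \<in> \<Delta>2"
        using interior_mono[OF that(2)] interior_subset that(4) by blast+
      then show ?thesis using triangle_eq_if_interior_meets[OF lfK] triT(1) that(1,3) by blast
    qed
    ultimately have "\<exists>!\<Delta>. \<Delta> \<in> triangles T \<and> \<Delta>' \<subseteq> \<Delta>" using s(2) by blast
    moreover have "similar \<Delta>' \<Delta>" if \<Delta>: "\<Delta> \<in> triangles T" "\<Delta>' \<subseteq> \<Delta>" for \<Delta>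
    proof -
      have "{v} \<in> K" using v(1) T(2) by (auto simp: vertices_def)
      moreover have "\<Delta> \<in> triangles K" using \<Delta>(1) triT by blast
      ultimately obtain a b where "\<Delta> = convex hull {v, a, b}" "\<Delta>' = convex hull {v, shrink v a, shrink v b}"
        using corner_triangle_unique[OF A \<Delta>'R[unfolded R_def] v(2) _ _ \<Delta>(2)] by metis
      then show ?thesis using similar_shrunk_hull by simp
    qed
    ultimately show ?thesis by blast
  qed
  ultimately show ?thesis
    unfolding \<delta>_def by (intro exI[of _ T'] exI[of _ P]) blast
qed

end
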